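(* Let $0<q<1$ and let $a,b,c,d$ be (generic, nonzero) complex parameters. With $r_\gamma(a,b,c,d;z)$, $s_\gamma(a,b,c,d;z)$, $L_{a,b,c,d}(\gamma,E)$ and $B_{a,b,c,d}(z,D_z)$ as defined in the context, each of the two functions $$R_\gamma(a,b,c,d;z)=\frac{(az;q)_\infty}{(bcd/z;q)_\infty}\,r_\gamma(a,b,c,d;z),$$ $$S_\gamma(a,b,c,d;z)=\frac{z^{-1+\log(abcd)/\log(q)}\,(az;q)_\infty}{(zq/a,\,zq/b,\,zq/c,\,zq/d;q)_\infty}\,s_\gamma(a,b,c,d;z)$$ solves the bispectral problem: for $\Psi(\gamma,z)=R_\gamma(a,b,c,d;z)$ and for $\Psi(\gamma,z)=S_\gamma(a,b,c,d;z)$ one has $$L_{a,b,c,d}(\gamma,E)\Psi(\gamma,z)=(z+1/z)\Psi(\gamma,z),\qquad B_{a,b,c,d}(z,D_z)\Psi(\gamma,z)=\Lambda_\gamma\Psi(\gamma,z),$$ where $\Lambda_\gamma=q^{-\gamma}(1-q^\gamma)(1-abcd\,q^{\gamma-1})$.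
   Context: Notation: $(x;q)_\infty=\prod_{i\ge0}(1-xq^i)$, $(x;q)_k=(x;q)_\infty/(xq^k;q)_\infty$, $(x_1,\dots,x_r;q)_k=\prod_i(x_i;q)_k$. The very-well-poised series is $${}_8W_7(\alpha;a_1,a_2,a_3,a_4,a_5;q,x)=\sum_{k\ge0}\frac{(\alpha,q\alpha^{1/2},-q\alpha^{1/2},a_1,\dots,a_5;q)_k}{(q,\alpha^{1/2},-\alpha^{1/2},q\alpha/a_1,\dots,q\alpha/a_5;q)_k}x^k,$$ understood as the sum of the series where it converges and by analytic continuation otherwise. $E^{\pm1}h_\gamma=h_{\gamma\pm1}$, and $D_z^{\pm1}h(z)=h(q^{\pm1}z)$. Powers such as $x^\gamma$ are defined with a branch of the logarithm fixed so that $(qz)^s=q^sz^s$. $L_{a,b,c,d}(\gamma,E)=A_\gamma E+B_\gamma\,\mathrm{Id}+C_\gamma E^{-1}$ with $$A_\gamma=\frac{(1-abq^\gamma)(1-acq^\gamma)(1-adq^\gamma)(1-abcdq^{\gamma-1})}{a(1-abcdq^{2\gamma-1})(1-abcdq^{2\gamma})},\quad C_\gamma=\frac{a(1-q^\gamma)(1-bcq^{\gamma-1})(1-bdq^{\gamma-1})(1-cdq^{\gamma-1})}{(1-abcdq^{2\gamma-2})(1-abcdq^{2\gamma-1})},$$ $$B_\gamma=a+a^{-1}-(A_\gamma+C_\gamma).$$ $B_{a,b,c,d}(z,D_z)=A(z)D_z-[A(z)+A(1/z)]\mathrm{Id}+A(1/z)D_z^{-1}$ with $$A(z)=\frac{(1-az)(1-bz)(1-cz)(1-dz)}{(1-z^2)(1-qz^2)}.$$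 $$r_\gamma(a,b,c,d;z)=\frac{(abq^\gamma,acq^\gamma,adq^\gamma,bcdq^\gamma/z;q)_\infty}{(bcq^\gamma,bdq^\gamma,cdq^\gamma,azq^\gamma;q)_\infty}\Big(\frac az\Big)^\gamma\,{}_8W_7\big(bcd/qz;\,b/z,c/z,d/z,abcdq^{\gamma-1},q^{-\gamma};q,qz/a\big),$$ $$s_\gamma(a,b,c,d;z)=\frac{(abcdq^{2\gamma},bzq^{\gamma+1},czq^{\gamma+1},dzq^{\gamma+1},bcdzq^\gamma;q)_\infty}{(bcq^\gamma,bdq^\gamma,cdq^\gamma,q^{\gamma+1},bcdzq^{2\gamma+1};q)_\infty}(az)^\gamma\,{}_8W_7\big(bcdzq^{2\gamma};\,bcq^\gamma,bdq^\gamma,cdq^\gamma,q^{\gamma+1},zq/a;q,az\big).$$ *)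

theory Defs
  imports "HOL-Analysis.Analysis"
begin

section \<open>Powers\<close>

text \<open>
  Powers of the real base \<open>q\<close> are principal powers: \<open>q\<^sup>s = exp (s ln q)\<close>.
  Powers of any other base use a logarithm \<open>lg\<close> on the nonzero complex numbers that is
  compatible with multiplication by \<open>q\<close>, so that \<open>(q z)\<^sup>s = q\<^sup>s z\<^sup>s\<close>.
  The principal logarithm is one such choice, but nothing depends on it.
\<close>

abbreviation qpow :: "real \<Rightarrow> complex \<Rightarrow> complex" where
  "qpow q s \<equiv> complex_of_real q powr s"

definition log_branch :: "real \<Rightarrow> (complex \<Rightarrow> complex) \<Rightarrow> bool" where
  "log_branch q lg \<longleftrightarrow>
     (\<forall>z. z \<noteq> 0 \<longrightarrow> exp (lg z) = z \<and> lg (complex_of_real q * z) = complex_of_real (ln q) + lg z)"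

definition bpow :: "(complex \<Rightarrow> complex) \<Rightarrow> complex \<Rightarrow> complex \<Rightarrow> complex" where
  "bpow lg x s = exp (s * lg x)"

lemma log_branch_Ln:
  assumes "0 < q"
  shows "log_branch q Ln"
  using assms by (simp add: log_branch_def Ln_times_of_real Ln_of_real)

lemma bpow_q_mult:
  assumes "0 < q" "log_branch q lg" "z \<noteq> 0"
  shows "bpow lg (complex_of_real q * z) s = qpow q s * bpow lg z s"
  using assms by (simp add: bpow_def log_branch_def powr_def Ln_of_real exp_add distrib_left)

section \<open>q-shifted factorials and the very-well-poised series\<close>

definition qpoch_inf :: "real \<Rightarrow> complex \<Rightarrow> complex" where
  "qpoch_inf q x = (\<Prod>i. 1 - x * complex_of_real q ^ i)"

text \<open>
  For a natural number \<open>k\<close> the quotient \<open>(x;q)\<^sub>\<infinity> / (x q\<^sup>k;q)\<^sub>\<infinity>\<close> is the following finite product,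
  which also gives the right value when the quotient reads \<open>0/0\<close> (terminating series).
\<close>

definition qpoch :: "real \<Rightarrow> complex \<Rightarrow> nat \<Rightarrow> complex" where
  "qpoch q x k = (\<Prod>i<k. 1 - x * complex_of_real q ^ i)"

definition qpochs_inf :: "real \<Rightarrow> complex list \<Rightarrow> complex" where
  "qpochs_inf q xs = (\<Prod>x\<leftarrow>xs. qpoch_inf q x)"

definition qpochs :: "real \<Rightarrow> complex list \<Rightarrow> nat \<Rightarrow> complex" where
  "qpochs q xs k = (\<Prod>x\<leftarrow>xs. qpoch q x k)"

definition W87_num ::
  "real \<Rightarrow> complex \<Rightarrow> complex \<Rightarrow> complex \<Rightarrow> complex \<Rightarrow> complex \<Rightarrow> complex \<Rightarrow> nat \<Rightarrow> complex" where
  "W87_num q \<alpha> a1 a2 a3 a4 a5 k =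
     qpochs q [\<alpha>, q * csqrt \<alpha>, - q * csqrt \<alpha>, a1, a2, a3, a4, a5] k"

definition W87_den ::
  "real \<Rightarrow> complex \<Rightarrow> complex \<Rightarrow> complex \<Rightarrow> complex \<Rightarrow> complex \<Rightarrow> complex \<Rightarrow> nat \<Rightarrow> complex" where
  "W87_den q \<alpha> a1 a2 a3 a4 a5 k =
     qpochs q [q, csqrt \<alpha>, - csqrt \<alpha>, q * \<alpha> / a1, q * \<alpha> / a2, q * \<alpha> / a3, q * \<alpha> / a4, q * \<alpha> / a5] k"

definition W87_coeff ::
  "real \<Rightarrow> complex \<Rightarrow> complex \<Rightarrow> complex \<Rightarrow> complex \<Rightarrow> complex \<Rightarrow> complex \<Rightarrow> nat \<Rightarrow> complex" where
  "W87_coeff q \<alpha> a1 a2 a3 a4 a5 k = W87_num q \<alpha> a1 a2 a3 a4 a5 k / W87_den q \<alpha> a1 a2 a3 a4 a5 k"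

text \<open>
  The \<open>k\<close>-th coefficient is \<open>F(q\<^sup>k)\<close> for a function \<open>F\<close> analytic at \<open>0\<close>. Expanding \<open>F\<close> in powers
  of \<open>q\<^sup>k\<close> shows that the sum of the series, as a function of its argument, continues
  analytically to the complex plane without the points \<open>q\<^sup>-\<^sup>j\<close>, where it has at most simple poles.
  This domain is connected, so the continuation is unique.
\<close>

definition W87_poles :: "real \<Rightarrow> complex set" where
  "W87_poles q = {1 / complex_of_real q ^ j | j :: nat. True}"

definition W87_cont ::
  "real \<Rightarrow> complex \<Rightarrow> complex \<Rightarrow> complex \<Rightarrow> complex \<Rightarrow> complex \<Rightarrow> complex \<Rightarrow> complex \<Rightarrow> complex" where
  "W87_cont q \<alpha> a1 a2 a3 a4 a5 =
     (SOME f. f holomorphic_on (- W87_poles q) \<and>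
        (\<forall>y. norm y < 1 \<longrightarrow> (\<lambda>k. W87_coeff q \<alpha> a1 a2 a3 a4 a5 k * y ^ k) sums f y))"

definition W87 ::
  "real \<Rightarrow> complex \<Rightarrow> complex \<Rightarrow> complex \<Rightarrow> complex \<Rightarrow> complex \<Rightarrow> complex \<Rightarrow> complex \<Rightarrow> complex" where
  "W87 q \<alpha> a1 a2 a3 a4 a5 x =
     (if summable (\<lambda>k. W87_coeff q \<alpha> a1 a2 a3 a4 a5 k * x ^ k)
      then \<Sum>k. W87_coeff q \<alpha> a1 a2 a3 a4 a5 k * x ^ k
      else W87_cont q \<alpha> a1 a2 a3 a4 a5 x)"

text \<open>The series has well-defined coefficients and its argument is not one of the poles.\<close>

definition W87_defined ::
  "real \<Rightarrow> complex \<Rightarrow> complex \<Rightarrow> complex \<Rightarrow> complex \<Rightarrow> complex \<Rightarrow> complex \<Rightarrow> complex \<Rightarrow> bool" where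
  "W87_defined q \<alpha> a1 a2 a3 a4 a5 x \<longleftrightarrow>
     a1 \<noteq> 0 \<and> a2 \<noteq> 0 \<and> a3 \<noteq> 0 \<and> a4 \<noteq> 0 \<and> a5 \<noteq> 0 \<and>
     (\<forall>k. W87_den q \<alpha> a1 a2 a3 a4 a5 k \<noteq> 0) \<and> x \<notin> W87_poles q"

section \<open>The Askey-Wilson operators\<close>

definition AW_A :: "real \<Rightarrow> complex \<Rightarrow> complex \<Rightarrow> complex \<Rightarrow> complex \<Rightarrow> complex \<Rightarrow> complex" where
  "AW_A q a b c d \<gamma> =
     (1 - a*b * qpow q \<gamma>) * (1 - a*c * qpow q \<gamma>) * (1 - a*d * qpow q \<gamma>) * (1 - a*b*c*d * qpow q (\<gamma> - 1)) /
     (a * (1 - a*b*c*d * qpow q (2*\<gamma> - 1)) * (1 - a*b*c*d * qpow q (2*\<gamma>)))"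

definition AW_C :: "real \<Rightarrow> complex \<Rightarrow> complex \<Rightarrow> complex \<Rightarrow> complex \<Rightarrow> complex \<Rightarrow> complex" where
  "AW_C q a b c d \<gamma> =
     a * (1 - qpow q \<gamma>) * (1 - b*c * qpow q (\<gamma> - 1)) * (1 - b*d * qpow q (\<gamma> - 1)) * (1 - c*d * qpow q (\<gamma> - 1)) /
     ((1 - a*b*c*d * qpow q (2*\<gamma> - 2)) * (1 - a*b*c*d * qpow q (2*\<gamma> - 1)))"

definition AW_B :: "real \<Rightarrow> complex \<Rightarrow> complex \<Rightarrow> complex \<Rightarrow> complex \<Rightarrow> complex \<Rightarrow> complex" where
  "AW_B q a b c d \<gamma> = a + 1 / a - (AW_A q a b c d \<gamma> + AW_C q a b c d \<gamma>)"

definition L_op ::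
  "real \<Rightarrow> complex \<Rightarrow> complex \<Rightarrow> complex \<Rightarrow> complex \<Rightarrow> (complex \<Rightarrow> complex) \<Rightarrow> complex \<Rightarrow> complex" where
  "L_op q a b c d h \<gamma> =
     AW_A q a b c d \<gamma> * h (\<gamma> + 1) + AW_B q a b c d \<gamma> * h \<gamma> + AW_C q a b c d \<gamma> * h (\<gamma> - 1)"

definition AW_Az :: "real \<Rightarrow> complex \<Rightarrow> complex \<Rightarrow> complex \<Rightarrow> complex \<Rightarrow> complex \<Rightarrow> complex" where
  "AW_Az q a b c d z =
     (1 - a*z) * (1 - b*z) * (1 - c*z) * (1 - d*z) / ((1 - z^2) * (1 - q * z^2))"

definition B_op ::
  "real \<Rightarrow> complex \<Rightarrow> complex \<Rightarrow> complex \<Rightarrow> complex \<Rightarrow> (complex \<Rightarrow> complex) \<Rightarrow> complex \<Rightarrow> complex" where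
  "B_op q a b c d h z =
     AW_Az q a b c d z * h (q * z)
     - (AW_Az q a b c d z + AW_Az q a b c d (1 / z)) * h z
     + AW_Az q a b c d (1 / z) * h (z / q)"

definition AW_Lambda :: "real \<Rightarrow> complex \<Rightarrow> complex \<Rightarrow> complex \<Rightarrow> complex \<Rightarrow> complex \<Rightarrow> complex" where
  "AW_Lambda q a b c d \<gamma> =
     qpow q (- \<gamma>) * (1 - qpow q \<gamma>) * (1 - a*b*c*d * qpow q (\<gamma> - 1))"

section \<open>The bispectral functions\<close>

definition AW_r ::
  "real \<Rightarrow> (complex \<Rightarrow> complex) \<Rightarrow> complex \<Rightarrow> complex \<Rightarrow> complex \<Rightarrow> complex \<Rightarrow> complex \<Rightarrow> complex \<Rightarrow> complex" where
  "AW_r q lg a b c d \<gamma> z =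
     qpochs_inf q [a*b * qpow q \<gamma>, a*c * qpow q \<gamma>, a*d * qpow q \<gamma>, b*c*d * qpow q \<gamma> / z] /
     qpochs_inf q [b*c * qpow q \<gamma>, b*d * qpow q \<gamma>, c*d * qpow q \<gamma>, a*z * qpow q \<gamma>] *
     bpow lg (a / z) \<gamma> *
     W87 q (b*c*d / (q*z)) (b/z) (c/z) (d/z) (a*b*c*d * qpow q (\<gamma> - 1)) (qpow q (- \<gamma>)) (q*z / a)"

definition AW_s ::
  "real \<Rightarrow> (complex \<Rightarrow> complex) \<Rightarrow> complex \<Rightarrow> complex \<Rightarrow> complex \<Rightarrow> complex \<Rightarrow> complex \<Rightarrow> complex \<Rightarrow> complex" where
  "AW_s q lg a b c d \<gamma> z =
     qpochs_inf q [a*b*c*d * qpow q (2*\<gamma>), b*z * qpow q (\<gamma> + 1), c*z * qpow q (\<gamma> + 1),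
                   d*z * qpow q (\<gamma> + 1), b*c*d*z * qpow q \<gamma>] /
     qpochs_inf q [b*c * qpow q \<gamma>, b*d * qpow q \<gamma>, c*d * qpow q \<gamma>, qpow q (\<gamma> + 1),
                   b*c*d*z * qpow q (2*\<gamma> + 1)] *
     bpow lg (a * z) \<gamma> *
     W87 q (b*c*d*z * qpow q (2*\<gamma>)) (b*c * qpow q \<gamma>) (b*d * qpow q \<gamma>) (c*d * qpow q \<gamma>)
       (qpow q (\<gamma> + 1)) (z*q / a) (a*z)"

definition AW_R ::
  "real \<Rightarrow> (complex \<Rightarrow> complex) \<Rightarrow> complex \<Rightarrow> complex \<Rightarrow> complex \<Rightarrow> complex \<Rightarrow> complex \<Rightarrow> complex \<Rightarrow> complex" where
  "AW_R q lg a b c d \<gamma> z =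
     qpochs_inf q [a*z] / qpochs_inf q [b*c*d / z] * AW_r q lg a b c d \<gamma> z"

definition AW_S ::
  "real \<Rightarrow> (complex \<Rightarrow> complex) \<Rightarrow> complex \<Rightarrow> complex \<Rightarrow> complex \<Rightarrow> complex \<Rightarrow> complex \<Rightarrow> complex \<Rightarrow> complex" where
  "AW_S q lg a b c d \<gamma> z =
     bpow lg z (- 1 + lg (a*b*c*d) / ln q) * qpochs_inf q [a*z] /
     qpochs_inf q [z*q / a, z*q / b, z*q / c, z*q / d] * AW_s q lg a b c d \<gamma> z"

section \<open>Genericity\<close>

text \<open>
  Genericity is made explicit and kept pointwise: no denominator vanishes in the expressions
  concerned, and the very-well-poised series are not evaluated at a pole.
  Nonnegative integer values of \<open>\<gamma>\<close> (terminating series, Askey-Wilson polynomials) are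
  not excluded for \<open>AW_R\<close>.
\<close>

definition L_defined :: "real \<Rightarrow> complex \<Rightarrow> complex \<Rightarrow> complex \<Rightarrow> complex \<Rightarrow> complex \<Rightarrow> bool" where
  "L_defined q a b c d \<gamma> \<longleftrightarrow>
     a*b*c*d * qpow q (2*\<gamma> - 2) \<noteq> 1 \<and> a*b*c*d * qpow q (2*\<gamma> - 1) \<noteq> 1 \<and> a*b*c*d * qpow q (2*\<gamma>) \<noteq> 1"

text \<open>The denominators of \<open>A(z)\<close> and of \<open>A(1/z)\<close>.\<close>

definition B_defined :: "real \<Rightarrow> complex \<Rightarrow> bool" where
  "B_defined q z \<longleftrightarrow> z^2 \<noteq> 1 \<and> q * z^2 \<noteq> 1 \<and> (1/z)^2 \<noteq> 1 \<and> q * (1/z)^2 \<noteq> 1"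

definition R_defined :: "real \<Rightarrow> complex \<Rightarrow> complex \<Rightarrow> complex \<Rightarrow> complex \<Rightarrow> complex \<Rightarrow> complex \<Rightarrow> bool" where
  "R_defined q a b c d \<gamma> z \<longleftrightarrow>
     qpochs_inf q [b*c*d / z] \<noteq> 0 \<and>
     qpochs_inf q [b*c * qpow q \<gamma>, b*d * qpow q \<gamma>, c*d * qpow q \<gamma>, a*z * qpow q \<gamma>] \<noteq> 0 \<and>
     W87_defined q (b*c*d / (q*z)) (b/z) (c/z) (d/z) (a*b*c*d * qpow q (\<gamma> - 1)) (qpow q (- \<gamma>)) (q*z / a)"

definition S_defined :: "real \<Rightarrow> complex \<Rightarrow> complex \<Rightarrow> complex \<Rightarrow> complex \<Rightarrow> complex \<Rightarrow> complex \<Rightarrow> bool" where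
  "S_defined q a b c d \<gamma> z \<longleftrightarrow>
     qpochs_inf q [z*q / a, z*q / b, z*q / c, z*q / d] \<noteq> 0 \<and>
     qpochs_inf q [b*c * qpow q \<gamma>, b*d * qpow q \<gamma>, c*d * qpow q \<gamma>, qpow q (\<gamma> + 1),
                   b*c*d*z * qpow q (2*\<gamma> + 1)] \<noteq> 0 \<and>
     W87_defined q (b*c*d*z * qpow q (2*\<gamma>)) (b*c * qpow q \<gamma>) (b*d * qpow q \<gamma>) (c*d * qpow q \<gamma>)
       (qpow q (\<gamma> + 1)) (z*q / a) (a*z)"

end

(*
  The k-th coefficient of a very-well-poised series is F(q^k) with F analytic at 0, so multiplying
  the coefficients by q^k amounts to replacing the argument y by q y, also for the analytic
  continuation. If coefficients have the form x h(k+1) - h(k) with h again analytic in q^k, the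
  continued sum at x is therefore -h(0), whether or not the series converges there. This turns
  rational certificates in u = q^k into three-term contiguous relations valid for all arguments.

  Four such relations are needed. L applied to R shifts a pair of parameters in opposite directions;
  L applied to S is the same shift after reindexing the series by one, because one member of the pair
  is then the base parameter itself. B applied to R shifts four parameters and the base while two
  parameters stay fixed, and B applied to S is obtained from it by the reflection
  u -> 1/(alpha u). The Askey-Wilson coefficients are the coefficients of these relations up to the
  quotients of infinite products in the prefactors.
*)

theory Submission
  imports Defs "HOL-Complex_Analysis.Complex_Analysis"
begin

section \<open>Polynomial identities\<close>

text \<open>The certificates come from interpolation in \<open>u\<close>. For the pair shift,
  \<open>u = 1/m\<close> leaves only the term with \<open>Ym\<close>, \<open>u = 1/n\<close> only
  the one with \<open>Yp\<close>, and \<open>u = 0\<close> fixes the middle coefficient; the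
  reflection that exchanges the two products on the left supplies the mirror points. There the
  certificate is a single product with constant coefficient, whereas for the shift of four
  parameters it carries a quartic polynomial \<open>g\<close>. The obstacle is that genericity is
  pointwise: factors such as \<open>1 - n\<close> may vanish, and no limit in the parameters is
  taken. The general step would have to divide by them at \<open>k = 0\<close>, so the initial index
  of the shifts that need it has its own identity, in which these factors are already cancelled. For
  the operator in z the natural parameter is a square root \<open>r\<close> of the base. With it the
  identities are symmetric in the four quantities A_i, and only expressions even in \<open>r\<close>
  reach the result.\<close>

text \<open>
  For a very-well-poised series with parameters \<open>a\<^sub>1, \<dots>, a\<^sub>4, q m, q n\<close> and \<open>\<alpha> = m n t\<close>, the polynomial
  \<open>d0 + d1 y + d2 y\<^sup>2 + d3 y\<^sup>3 + t d4 y\<^sup>4\<close> stands for \<open>\<Prod>\<^sub>i (1 - t y / a\<^sub>i)\<close>, and \<open>u\<close> for \<open>q\<^sup>k\<close>.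
\<close>

lemma pair_shift_identity:
  fixes m n q t u :: complex
  assumes "D = (n - q * m) * (m - q * n) * (n - m)"
    and "Yp = - (n^2 * (d0 + d1*m + d2*m^2 + d3*m^3 + t*d4*m^4) * (m - q*n))"
    and "Ym = m^2 * (d0 + d1*n + d2*n^2 + d3*n^3 + t*d4*n^4) * (n - q*m)"
  shows "D * (q - t) * (m^2 * n^2 * (t^3*u^4*d0 + t^2*u^3*d1 + t*u^2*d2 + u*d3 + d4) * (1 - m*u) * (1 - n*u)
      - (d0 + d1*(m*n*u) + d2*(m*n*u)^2 + d3*(m*n*u)^3 + t*d4*(m*n*u)^4) * (1 - n*t*u) * (1 - m*t*u))
    = (1 - m*n*t*u^2) * (Yp * (1 - q*m*u) * (q - n*t*u) * (1 - m*u) * (1 - n*t*u)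
      + (D * (q - t) * (m^2 * n^2 * d4 - d0) - q*Yp - q*Ym) * (1 - m*u) * (1 - n*t*u) * (1 - n*u) * (1 - m*t*u)
      + Ym * (1 - q*n*u) * (q - m*t*u) * (1 - n*u) * (1 - m*t*u))"
  unfolding assms by algebra

text \<open>This is \<open>pair_shift_identity\<close> at \<open>u = 1\<close> when one of the four
  parameters is the base itself. The second product on the left then vanishes, and the factors
  \<open>1 - m\<close> and \<open>1 - n\<close> common to all remaining terms are cancelled.
  \<open>H\<close> belongs to the other three parameters.\<close>

lemma pair_shift_identity_initial:
  fixes m n t x :: complex
  assumes "H = (\<lambda>y. 1 - t*k1*y + t^2*k2*y^2 - t^3*k3*y^3)" and "x = m*n*t^2*k3"
  shows "(x - 1) * (1 - n*t) * (1 - m*t) * (n - m) + n * H m * (1 - n*t) - m * H n * (1 - m*t)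
    = (n - m) * m * n * t^2 * (k3 - k2 + k1 - 1)"
  unfolding assms by algebra

text \<open>
  The identities for the simultaneous shift of four parameters are normalised by \<open>a\<^sub>i = q r A\<^sub>i\<close>,
  \<open>\<alpha> = q r\<^sup>2\<close>; the other two parameters are \<open>q r / F\<close> and \<open>q r / G\<close>, and \<open>u\<close> stands for \<open>r q\<^sup>k\<close>.
  With \<open>E\<^sub>i\<close> the elementary symmetric functions of the \<open>A\<^sub>i\<close>, \<open>four_shift_res\<close> is \<open>\<Prod>\<^sub>i\<^sub><\<^sub>j (1 - A\<^sub>i A\<^sub>j)\<close>.
  The reflected identity arises from \<open>u \<mapsto> 1 / (q u)\<close>.
\<close>

definition four_shift_res :: "complex \<Rightarrow> complex \<Rightarrow> complex \<Rightarrow> complex \<Rightarrow> complex" where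
  "four_shift_res E1 E2 E3 E4 =
     (1 + E4)^3 - E2*(1 + E4)^2 + (E1*E3 - 4*E4)*(1 + E4) - (E3^2 + E1^2*E4 - 4*E2*E4)"

text \<open>The value forced by the coefficient of \<open>u\<close> to the first power in
  \<open>four_shift_identity\<close>. It is linear and homogeneous in \<open>E1\<close>,
  \<open>E3\<close> and \<open>F + G\<close>, with coefficients depending on \<open>q\<close>,
  \<open>E4\<close> and \<open>F*G\<close>; \<open>E2\<close> does not occur. This parity later
  removes the square root.\<close>

definition four_shift_mid :: "complex \<Rightarrow> complex \<Rightarrow> complex \<Rightarrow> complex \<Rightarrow> complex \<Rightarrow> complex \<Rightarrow> complex" where
  "four_shift_mid q E1 E3 E4 F G =
     (q*F*G - q^2*E4) * ((q^2*E4 - 1) * ((E3 - E1*E4) - (E4 - 1) * (F + G)) - (F*G - q^2*E4) * (E4 - 1) * E1)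
     - (E4 - 1) * (F*G - 1) * (E1*F*G + q*F + q*G)
     + q^2 * (E4 - 1) * (F*G - 1) * (E3 + q*E4*(F + G))
     + (F*G - q^2*E4) * (F*G - 1) * (E4 - 1) * (1 + q) * E1"

text \<open>Origin of \<open>g\<close>: at \<open>u = 1/(q F)\<close> and \<open>u = 1/(q G)\<close>
  only the last term on the right survives, which fixes \<open>g\<close> at \<open>1/F\<close> and
  \<open>1/G\<close> as a multiple of \<open>A\<close>. At a root of \<open>A\<close> only the first
  term survives; there the quadratic factor of \<open>g\<close> times the reversed quartic must
  equal \<open>four_shift_res\<close> times \<open>u^2 (1 - u^2)\<close>.\<close>

lemma four_shift_identity:
  fixes q u :: complex
  assumes "A = (\<lambda>u. 1 - E1*u + E2*u^2 - E3*u^3 + E4*u^4)"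
    and "g = (\<lambda>u. (q^2*E4 - 1) * (1 - F*u) * (1 - G*u) * ((E4 - 1) + (E3 - E1*E4)*u + E4*(E4 - 1)*u^2)
               + (F*G - q^2*E4) * (E4 - 1) * A u)"
  shows "g (q*u) * A u * (F - q*u) * (G - q*u)
      - q^2 * g u * (E4 - E3*u + E2*u^2 - E1*u^3 + u^4) * (1 - q*F*u) * (1 - q*G*u)
    = - (q^2 * (q^2*E4 - 1) * four_shift_res E1 E2 E3 E4) * u^2 * (1 - u^2)
        * (1 - F*u) * (1 - q*F*u) * (1 - G*u) * (1 - q*G*u)
      + four_shift_mid q E1 E3 E4 F G * u * (1 - q*u^2) * A u * (1 - q*F*u) * (1 - q*G*u)
      + (F*G - q^2*E4) * (F*G - 1) * (E4 - 1) * (1 - q^2*u^2) * A u * A (q*u)"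
  unfolding assms four_shift_res_def four_shift_mid_def by algebra

lemma four_shift_identity_reflected:
  fixes q u :: complex
  assumes "A = (\<lambda>u. 1 - E1*u + E2*u^2 - E3*u^3 + E4*u^4)"
    and "A' = (\<lambda>u. u^4 - E1*u^3 + E2*u^2 - E3*u + E4)"
    and "g = (\<lambda>u. (q^2*E4 - 1) * (u - F) * (u - G) * ((E4 - 1)*u^2 + (E3 - E1*E4)*u + E4*(E4 - 1))
               + (F*G - q^2*E4) * (E4 - 1) * A' u)"
  shows "q^2 * g u * A' (q*u) * (1 - F*u) * (1 - G*u) - g (q*u) * A (q*u) * (u - F) * (u - G)
    = - (q^2 * (q^2*E4 - 1) * four_shift_res E1 E2 E3 E4) * u^2 * (q^2*u^2 - 1)
        * (q*u - F) * (q*u - G) * (u - F) * (u - G)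
      + four_shift_mid q E1 E3 E4 F G * u * (q*u^2 - 1) * A' (q*u) * (u - F) * (u - G)
      + q^2 * ((F*G - q^2*E4) * (F*G - 1) * (E4 - 1)) * (u^2 - 1) * A' (q*u) * A' u"
  unfolding assms four_shift_res_def four_shift_mid_def by algebra

text \<open>The case \<open>u = r\<close> of \<open>four_shift_identity\<close> divided by
  \<open>A r\<close>. Since \<open>r\<close> is one of the four quantities, the reversed quartic
  vanishes at \<open>r\<close>, and \<open>A r\<close> divides what is left: its factors are
  \<open>1 - r^2\<close> and the three factors of \<open>four_shift_res\<close> that involve
  \<open>r\<close>.\<close>

lemma four_shift_identity_initial:
  fixes q r :: complex
  assumes "E1 = r + k1" "E2 = r*k1 + k2" "E3 = r*k2 + k3" "E4 = r*k3"
    and "A = (\<lambda>u. 1 - E1*u + E2*u^2 - E3*u^3 + E4*u^4)"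
    and "g = (\<lambda>u. (q^2*E4 - 1) * (1 - F*u) * (1 - G*u) * ((E4 - 1) + (E3 - E1*E4)*u + E4*(E4 - 1)*u^2)
               + (F*G - q^2*E4) * (E4 - 1) * A u)"
  shows "g (q*r) * (F - q*r) * (G - q*r)
    = - (q^2 * (q^2*E4 - 1) * (1 - k2 + k1*k3 - k3^2)) * r^2 * (1 - F*r) * (1 - q*F*r) * (1 - G*r) * (1 - q*G*r)
      + four_shift_mid q E1 E3 E4 F G * r * (1 - q*r^2) * (1 - q*F*r) * (1 - q*G*r)
      + (F*G - q^2*E4) * (F*G - 1) * (E4 - 1) * (1 - q^2*r^2) * A (q*r)"
  unfolding assms four_shift_mid_def by algebra

section \<open>Infinite q-shifted factorials\<close>

lemma qpoch_0 [simp]: "qpoch q x 0 = 1"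
  by (simp add: qpoch_def)

lemma qpoch_Suc: "qpoch q x (Suc k) = qpoch q x k * (1 - x * of_real q ^ k)"
  by (simp add: qpoch_def)

lemma qpoch_Suc_shift: "qpoch q x (Suc k) = (1 - x) * qpoch q (of_real q * x) k"
  unfolding qpoch_def by (subst prod.lessThan_Suc_shift) (simp add: mult_ac)

lemma convergent_prod_qpoch:
  assumes "0 < q" "q < 1"
  shows "convergent_prod (\<lambda>i. 1 - x * complex_of_real q ^ i)"
proof (rule abs_convergent_prod_imp_convergent_prod, rule summable_imp_abs_convergent_prod)
  show "summable (\<lambda>i. norm (1 - x * complex_of_real q ^ i - 1))"
    using assms by (simp add: norm_mult norm_power summable_mult summable_geometric)
qed

lemma qpoch_inf_split:
  assumes "0 < q" "q < 1"
  shows "qpoch_inf q x = qpoch q x k * qpoch_inf q (x * of_real q ^ k)"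
  using has_prod_ignore_initial_segment'[OF convergent_prod_qpoch[OF assms, of x], of k]
  by (simp add: qpoch_inf_def qpoch_def has_prod_iff power_add mult_ac)

lemma qpoch_inf_Suc:
  assumes "0 < q" "q < 1"
  shows "qpoch_inf q x = (1 - x) * qpoch_inf q (of_real q * x)"
  using qpoch_inf_split[OF assms, of x 1] by (simp add: qpoch_def mult_ac)

lemma qpoch_inf_nonzeroD:
  assumes "0 < q" "q < 1" "qpoch_inf q x \<noteq> 0"
  shows "qpoch q x k \<noteq> 0" "1 - x * of_real q ^ k \<noteq> 0" "qpoch_inf q (x * of_real q ^ k) \<noteq> 0"
  using qpoch_inf_split[OF assms(1,2), of x k] qpoch_inf_split[OF assms(1,2), of x "Suc k"] assms(3)
  by (auto simp: qpoch_Suc)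

lemma qpoch_inf_nonzero:
  assumes "0 < q" "q < 1" "\<And>k. 1 - x * complex_of_real q ^ k \<noteq> 0"
  shows "qpoch_inf q x \<noteq> 0"
  unfolding qpoch_inf_def using assms by (intro prodinf_nonzero convergent_prod_qpoch)

lemma qpoch_inf_holomorphic:
  assumes "0 < q" "q < 1"
  shows "qpoch_inf q holomorphic_on UNIV"
proof (rule holomorphic_uniform_sequence[where f = "\<lambda>N x. \<Prod>i<N. 1 - x * complex_of_real q ^ i"])
  fix x :: complex
  define R where "R = norm x + 1"
  have "uniformly_convergent_on (cball x 1) (\<lambda>N x. \<Prod>i<N. 1 - x * complex_of_real q ^ i)"
  proof (rule uniformly_convergent_on_prod')
    show "uniformly_convergent_on (cball x 1) (\<lambda>N y. \<Sum>i<N. norm (1 - y * complex_of_real q ^ i - 1))"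
    proof (rule Weierstrass_m_test')
      fix i y assume "y \<in> cball x 1"
      hence "norm y \<le> R"
        unfolding R_def using norm_triangle_ineq2[of y x] by (auto simp: dist_norm norm_minus_commute)
      thus "norm (norm (1 - y * complex_of_real q ^ i - 1)) \<le> R * q ^ i"
        using assms by (simp add: norm_mult norm_power mult_right_mono)
    next
      show "summable (\<lambda>i. R * q ^ i)"
        using assms by (intro summable_mult summable_geometric) auto
    qed
  qed (auto intro!: continuous_intros)
  then obtain g where g: "uniform_limit (cball x 1) (\<lambda>N x. \<Prod>i<N. 1 - x * complex_of_real q ^ i) g sequentially"
    by (auto simp: uniformly_convergent_on_def)
  have eq: "g y = qpoch_inf q y" if "y \<in> cball x 1" for y
  proof (rule LIMSEQ_unique)
    show "(\<lambda>N. \<Prod>i<N. 1 - y * complex_of_real q ^ i) \<longlonglongrightarrow> g y"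
      using tendsto_uniform_limitI[OF g that] .
    have "(\<lambda>N. \<Prod>i\<le>N. 1 - y * complex_of_real q ^ i) \<longlonglongrightarrow> qpoch_inf q y"
      unfolding qpoch_inf_def using convergent_prod_LIMSEQ[OF convergent_prod_qpoch[OF assms]] .
    thus "(\<lambda>N. \<Prod>i<N. 1 - y * complex_of_real q ^ i) \<longlonglongrightarrow> qpoch_inf q y"
      unfolding lessThan_Suc_atMost[symmetric]
      by (subst (asm) filterlim_sequentially_Suc[of "\<lambda>N. \<Prod>i<N. 1 - y * complex_of_real q ^ i"])
  qed
  have "uniform_limit (cball x 1) (\<lambda>N x. \<Prod>i<N. 1 - x * complex_of_real q ^ i) (qpoch_inf q) sequentially"
    using iffD1[OF uniform_limit_cong'[OF refl eq] g] .
  thus "\<exists>d>0. cball x d \<subseteq> UNIV \<and>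
          uniform_limit (cball x d) (\<lambda>N x. \<Prod>i<N. 1 - x * complex_of_real q ^ i) (qpoch_inf q) sequentially"
    by (intro exI[of _ 1]) auto
qed (auto intro!: holomorphic_intros)

section \<open>Sequences analytic in powers of q\<close>

text \<open>Agreement is asked only for large \<open>k\<close>: the disc on which \<open>F\<close>
  is holomorphic need not contain the first powers of \<open>q\<close>, and a sequence that ends in
  zeros is represented by the zero function.\<close>

definition q_analytic :: "real \<Rightarrow> (nat \<Rightarrow> complex) \<Rightarrow> bool" where
  "q_analytic q u \<longleftrightarrow>
     (\<exists>F. F analytic_on {0} \<and> (\<forall>\<^sub>F k in sequentially. u k = F (complex_of_real q ^ k)))"

lemma q_analyticI:
  assumes "F analytic_on {0}" "\<And>k. u k = F (complex_of_real q ^ k)"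
  shows "q_analytic q u"
  using assms by (auto simp: q_analytic_def)

lemma q_analytic_cong:
  assumes "q_analytic q u" "\<forall>\<^sub>F k in sequentially. u k = v k"
  shows "q_analytic q v"
proof -
  obtain F where "F analytic_on {0}" "\<forall>\<^sub>F k in sequentially. u k = F (complex_of_real q ^ k)"
    using assms(1) by (auto simp: q_analytic_def)
  thus ?thesis using assms(2) unfolding q_analytic_def
    by (intro exI[of _ F] conjI) (auto elim: eventually_elim2)
qed

lemma q_analytic_const: "q_analytic q (\<lambda>k. c)"
  by (rule q_analyticI[of "\<lambda>_. c"]) auto

lemma q_analytic_power: "q_analytic q (\<lambda>k. complex_of_real q ^ k)"
  by (rule q_analyticI[of "\<lambda>w. w"]) auto

lemma q_analytic_mult:
  assumes "q_analytic q u" "q_analytic q v"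
  shows "q_analytic q (\<lambda>k. u k * v k)"
proof -
  obtain F G where "F analytic_on {0}" "\<forall>\<^sub>F k in sequentially. u k = F (complex_of_real q ^ k)"
    and "G analytic_on {0}" "\<forall>\<^sub>F k in sequentially. v k = G (complex_of_real q ^ k)"
    using assms by (auto simp: q_analytic_def)
  thus ?thesis unfolding q_analytic_def
    by (intro exI[of _ "\<lambda>w. F w * G w"] conjI analytic_on_mult) (auto elim: eventually_elim2)
qed

lemma q_analytic_add:
  assumes "q_analytic q u" "q_analytic q v"
  shows "q_analytic q (\<lambda>k. u k + v k)"
proof -
  obtain F G where "F analytic_on {0}" "\<forall>\<^sub>F k in sequentially. u k = F (complex_of_real q ^ k)"
    and "G analytic_on {0}" "\<forall>\<^sub>F k in sequentially. v k = G (complex_of_real q ^ k)"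
    using assms by (auto simp: q_analytic_def)
  thus ?thesis unfolding q_analytic_def
    by (intro exI[of _ "\<lambda>w. F w + G w"] conjI analytic_on_add) (auto elim: eventually_elim2)
qed

lemma q_analytic_diff:
  assumes "q_analytic q u" "q_analytic q v"
  shows "q_analytic q (\<lambda>k. u k - v k)"
  using q_analytic_add[OF assms(1) q_analytic_mult[OF q_analytic_const[of q "-1"] assms(2)]] by simp

lemma q_analytic_pow: "q_analytic q u \<Longrightarrow> q_analytic q (\<lambda>k. u k ^ n)"
  by (induction n) (auto intro: q_analytic_mult q_analytic_const)

text \<open>The backward direction leaves the value at index 0 free. Certificates use this: they are
  given by a formula from index 1 on and have a prescribed value at 0.\<close>

lemma q_analytic_Suc_iff: "q_analytic q (\<lambda>k. u (Suc k)) \<longleftrightarrow> q_analytic q u" if "0 < q"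
proof
  assume "q_analytic q u"
  then obtain F where F: "F analytic_on {0}" "\<forall>\<^sub>F k in sequentially. u k = F (complex_of_real q ^ k)"
    by (auto simp: q_analytic_def)
  have "(F \<circ> (\<lambda>w. of_real q * w)) analytic_on {0}"
    by (rule analytic_on_compose) (use F in \<open>auto intro!: analytic_intros\<close>)
  moreover have "\<forall>\<^sub>F k in sequentially. u (Suc k) = F (complex_of_real q ^ Suc k)"
    using F(2) by (subst (asm) eventually_sequentially_Suc[symmetric])
  ultimately show "q_analytic q (\<lambda>k. u (Suc k))"
    unfolding q_analytic_def by (intro exI[of _ "F \<circ> (\<lambda>w. of_real q * w)"]) auto
next
  assume "q_analytic q (\<lambda>k. u (Suc k))"
  then obtain F where F: "F analytic_on {0}" "\<forall>\<^sub>F k in sequentially. u (Suc k) = F (complex_of_real q ^ k)"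
    by (auto simp: q_analytic_def)
  have "(F \<circ> (\<lambda>w. w / of_real q)) analytic_on {0}"
    by (rule analytic_on_compose) (use F that in \<open>auto intro!: analytic_intros\<close>)
  moreover have "\<forall>\<^sub>F k in sequentially. u (Suc k) = F (complex_of_real q ^ Suc k / of_real q)"
    using F(2) that by simp
  hence "\<forall>\<^sub>F k in sequentially. u k = F (complex_of_real q ^ k / of_real q)"
    by (subst eventually_sequentially_Suc[symmetric])
  ultimately show "q_analytic q u"
    unfolding q_analytic_def by (intro exI[of _ "F \<circ> (\<lambda>w. w / of_real q)"]) auto
qed

lemma qpoch_eventually_0:
  assumes "qpoch q x K = 0"
  shows "\<forall>\<^sub>F k in sequentially. qpoch q x k = 0"
proof -
  have "qpoch q x k = 0" if "k \<ge> K" for k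
    using that by (induction k rule: dec_induct) (auto simp: assms qpoch_Suc)
  thus ?thesis by (auto simp: eventually_sequentially)
qed

lemma analytic_qpoch_inf_scaled:
  assumes "0 < q" "q < 1"
  shows "(\<lambda>w. qpoch_inf q (x * w)) analytic_on {0}"
proof -
  have "(qpoch_inf q \<circ> (\<lambda>w. x * w)) holomorphic_on UNIV"
    by (rule holomorphic_on_compose)
       (auto intro!: holomorphic_intros intro: holomorphic_on_subset[OF qpoch_inf_holomorphic[OF assms]])
  thus ?thesis by (auto simp: o_def intro: holomorphic_on_imp_analytic_at[of _ UNIV])
qed

lemma qpoch_inf_0 [simp]: "qpoch_inf q 0 = 1"
  by (simp add: qpoch_inf_def)

text \<open>Either a factor vanishes and the sequence is eventually 0, or (x;q)_k is the constant
  (x;q)_inf divided by (xw;q)_inf at w = q^k, and this denominator is 1 at w = 0.\<close>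

lemma q_analytic_qpoch:
  assumes "0 < q" "q < 1"
  shows "q_analytic q (qpoch q x)"
proof (cases "\<exists>K. qpoch q x K = 0")
  case True
  thus ?thesis using qpoch_eventually_0 unfolding q_analytic_def
    by (intro exI[of _ "\<lambda>_. 0"]) auto
next
  case False
  hence "1 - x * complex_of_real q ^ k \<noteq> 0" for k by (metis qpoch_Suc mult_zero_right)
  hence nz: "qpoch_inf q x \<noteq> 0" by (rule qpoch_inf_nonzero[OF assms])
  show ?thesis
  proof (rule q_analyticI)
    show "(\<lambda>w. qpoch_inf q x / qpoch_inf q (x * w)) analytic_on {0}"
      by (intro analytic_on_divide analytic_qpoch_inf_scaled assms) auto
    show "qpoch q x k = qpoch_inf q x / qpoch_inf q (x * complex_of_real q ^ k)" for k
      using qpoch_inf_split[OF assms, of x k] qpoch_inf_nonzeroD(3)[OF assms nz, of k] by simp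
  qed
qed

text \<open>If some factor is 0, all later inverses are 0 by the convention
  \<open>inverse 0 = 0\<close>, so the sequence is eventually the zero function. Otherwise the
  quotient of infinite products is turned upside down.\<close>

lemma q_analytic_inverse_qpoch:
  assumes "0 < q" "q < 1"
  shows "q_analytic q (\<lambda>k. inverse (qpoch q x k))"
proof (cases "\<exists>K. qpoch q x K = 0")
  case True
  thus ?thesis using qpoch_eventually_0 unfolding q_analytic_def
    by (intro exI[of _ "\<lambda>_. 0"]) (auto elim: eventually_mono)
next
  case False
  hence "1 - x * complex_of_real q ^ k \<noteq> 0" for k by (metis qpoch_Suc mult_zero_right)
  hence nz: "qpoch_inf q x \<noteq> 0" by (rule qpoch_inf_nonzero[OF assms])
  show ?thesis
  proof (rule q_analyticI)
    show "(\<lambda>w. qpoch_inf q (x * w) / qpoch_inf q x) analytic_on {0}"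
      using nz by (intro analytic_on_divide analytic_qpoch_inf_scaled assms) auto
    show "inverse (qpoch q x k) = qpoch_inf q (x * complex_of_real q ^ k) / qpoch_inf q x" for k
      using qpoch_inf_split[OF assms, of x k] nz qpoch_inf_nonzeroD(3)[OF assms nz, of k]
      by (simp add: divide_simps)
  qed
qed

lemma q_analytic_divide_qpoch:
  assumes "0 < q" "q < 1" "q_analytic q u"
  shows "q_analytic q (\<lambda>k. u k / qpoch q x k)"
  unfolding divide_inverse by (intro q_analytic_mult assms q_analytic_inverse_qpoch)

lemmas q_analytic_intros =
  q_analytic_const q_analytic_power q_analytic_mult q_analytic_add q_analytic_diff q_analytic_pow
  q_analytic_qpoch q_analytic_divide_qpoch

section \<open>Analytic continuation of generating functions\<close>

text \<open>The property by which \<open>W87_cont\<close> selects its function, for an arbitrary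
  coefficient sequence.\<close>

definition continues :: "real \<Rightarrow> (nat \<Rightarrow> complex) \<Rightarrow> (complex \<Rightarrow> complex) \<Rightarrow> bool" where
  "continues q u f \<longleftrightarrow> f holomorphic_on (- W87_poles q) \<and> (\<forall>y. norm y < 1 \<longrightarrow> (\<lambda>k. u k * y ^ k) sums f y)"

lemma norm_W87_pole:
  assumes "0 < q" "q < 1" "y \<in> W87_poles q"
  shows "norm y \<ge> 1"
  using assms by (auto simp: W87_poles_def norm_divide norm_power power_le_one)

text \<open>The complement of the poles is stable under multiplication by \<open>q\<close> but not
  under division by it. Relations between arguments y, qy and q^2 y are therefore based at
  \<open>y\<close>, from which the other two are automatically admissible.\<close>

lemma mult_q_notin_W87_poles:
  assumes "0 < q" "y \<notin> W87_poles q"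
  shows "of_real q * y \<notin> W87_poles q"
proof
  assume "of_real q * y \<in> W87_poles q"
  then obtain j where "of_real q * y = 1 / complex_of_real q ^ j" by (auto simp: W87_poles_def)
  hence "y = 1 / complex_of_real q ^ Suc j" using assms by (simp add: field_simps)
  thus False using assms unfolding W87_poles_def by blast
qed

lemma one_minus_pow_nonzero:
  assumes "0 < q" "y \<notin> W87_poles q"
  shows "1 - of_real q ^ j * y \<noteq> 0"
proof
  assume "1 - of_real q ^ j * y = 0"
  hence "y = 1 / complex_of_real q ^ j" using assms by (simp add: field_simps)
  thus False using assms unfolding W87_poles_def by blast
qed

lemma finite_W87_poles_ball:
  assumes "0 < q" "q < 1"
  shows "finite (W87_poles q \<inter> ball 0 R)"
proof (cases "R > 0")
  case True
  obtain J where J: "q ^ J < 1 / R"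
    using real_arch_pow_inv[of "1 / R" q] True assms by auto
  have "W87_poles q \<inter> ball 0 R \<subseteq> (\<lambda>j. 1 / complex_of_real q ^ j) ` {..<J}"
  proof
    fix y assume "y \<in> W87_poles q \<inter> ball 0 R"
    then obtain j where j: "y = 1 / complex_of_real q ^ j" "norm y < R" by (auto simp: W87_poles_def)
    hence "1 / q ^ j < R" using assms by (simp add: norm_divide norm_power)
    hence "1 / R < q ^ j" using True assms by (simp add: field_simps)
    hence "q ^ J < q ^ j" using J by linarith
    moreover have "q ^ j \<le> q ^ J" if "J \<le> j" using that assms by (intro power_decreasing) auto
    ultimately have "j < J" by force
    thus "y \<in> (\<lambda>j. 1 / complex_of_real q ^ j) ` {..<J}" using j by auto
  qed
  thus ?thesis by (rule finite_subset) auto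
next
  case False
  thus ?thesis by (simp add: ball_empty)
qed

lemma open_Compl_W87_poles:
  assumes "0 < q" "q < 1"
  shows "open (- W87_poles q)"
proof (rule openI)
  fix y assume y: "y \<in> - W87_poles q"
  define R where "R = norm y + 1"
  have "open (ball 0 R - (W87_poles q \<inter> ball 0 R))"
    by (intro open_Diff finite_imp_closed finite_W87_poles_ball assms) auto
  moreover have "y \<in> ball 0 R - (W87_poles q \<inter> ball 0 R)" using y by (auto simp: R_def)
  ultimately obtain e where "e > 0" "ball y e \<subseteq> ball 0 R - (W87_poles q \<inter> ball 0 R)"
    by (meson open_contains_ball)
  thus "\<exists>e>0. ball y e \<subseteq> - W87_poles q" by (intro exI[of _ e]) auto
qed

lemma connected_Diff_W87_poles:
  assumes "open S" "connected S"
  shows "connected (S - W87_poles q)"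
proof (rule connected_open_diff_countable)
  have "W87_poles q = range (\<lambda>j. 1 / complex_of_real q ^ j)" by (auto simp: W87_poles_def)
  thus "countable (W87_poles q)" by simp
qed (use assms in auto)

text \<open>Identity theorem: the unit disc contains no pole, and a disc minus the poles stays
  connected because only countably many points are removed.\<close>

lemma continues_unique_on:
  assumes q: "0 < q" "q < 1" and f: "continues q u f"
    and g: "g holomorphic_on (ball 0 R - W87_poles q)" "R \<ge> 1"
    and gs: "\<And>y. norm y < 1 \<Longrightarrow> (\<lambda>k. u k * y ^ k) sums g y"
    and y: "y \<notin> W87_poles q" "norm y < R"
  shows "f y = g y"
proof -
  have "f y - g y = 0"
  proof (rule analytic_continuation_open[where s = "ball 0 1" and s' = "ball 0 R - W87_poles q"
        and f = "\<lambda>y. f y - g y" and g = "\<lambda>_. 0"])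
    show "ball 0 1 \<subseteq> ball 0 R - W87_poles q" using norm_W87_pole[OF q] g(2) by fastforce
    show "open (ball 0 R - W87_poles q)" unfolding Diff_eq using q by (intro open_Int open_Compl_W87_poles) auto
    show "connected (ball 0 R - W87_poles q)" by (intro connected_Diff_W87_poles) auto
    show "(\<lambda>y. f y - g y) holomorphic_on ball 0 R - W87_poles q"
      using f g unfolding continues_def by (intro holomorphic_on_diff) (auto intro: holomorphic_on_subset)
    show "f y - g y = 0" if "y \<in> ball 0 1" for y
      using that f gs[of y] by (auto simp: continues_def intro: sums_unique2)
  qed (use y in auto)
  thus ?thesis by simp
qed

lemma continues_unique:
  assumes "0 < q" "q < 1" "continues q u f" "continues q u g" "y \<notin> W87_poles q"
  shows "f y = g y"
proof (rule continues_unique_on[where f = f and g = g and y = y and R = "norm y + 1"])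
  show "g holomorphic_on ball 0 (norm y + 1) - W87_poles q"
    using assms(4) by (auto simp: continues_def intro: holomorphic_on_subset)
qed (use assms in \<open>auto simp: continues_def\<close>)

section \<open>Existence of the continuation through an expansion into simple fractions\<close>

lemma q_fraction_series_holomorphic:
  assumes q: "0 < q" "q < 1" and c: "summable (\<lambda>j. norm (c j))"
  shows "(\<lambda>y. \<Sum>j. c j / (1 - of_real q ^ j * y)) holomorphic_on (- W87_poles q)"
proof (rule holomorphic_uniform_sequence[where f = "\<lambda>N y. \<Sum>j<N. c j / (1 - of_real q ^ j * y)"])
  show "open (- W87_poles q)" by (rule open_Compl_W87_poles[OF q])
  show "(\<lambda>y. \<Sum>j<N. c j / (1 - of_real q ^ j * y)) holomorphic_on - W87_poles q" for N
    using one_minus_pow_nonzero[OF q(1)] by (intro holomorphic_intros) auto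
  fix x assume "x \<in> - W87_poles q"
  then obtain d where d: "d > 0" "cball x d \<subseteq> - W87_poles q"
    using open_Compl_W87_poles[OF q] open_contains_cball by blast
  define R where "R = norm x + d"
  \<comment> \<open>For \<open>j\<close> from \<open>J\<close> on, q^j y has modulus at most 1/2 on
    the whole closed disc, so the denominators are bounded below by 1/2 and
    \<open>2 * norm (c j)\<close> is a majorant. The finitely many earlier terms are exempt in the
    eventual form of the M-test.\<close>
  obtain J where J: "q ^ J < 1 / (2 * R)"
    using real_arch_pow_inv[of "1 / (2 * R)" q] q d by (auto simp: R_def add_nonneg_pos)
  have "uniform_limit (cball x d) (\<lambda>N y. \<Sum>j<N. c j / (1 - of_real q ^ j * y))
          (\<lambda>y. \<Sum>j. c j / (1 - of_real q ^ j * y)) sequentially"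
  proof (rule Weierstrass_m_test_ev)
    show "\<forall>\<^sub>F j in sequentially. \<forall>y\<in>cball x d. norm (c j / (1 - of_real q ^ j * y)) \<le> 2 * norm (c j)"
      using eventually_ge_at_top[of J]
    proof eventually_elim
      case (elim j)
      show ?case
      proof
        fix y assume "y \<in> cball x d"
        hence y: "norm y \<le> R" unfolding R_def using norm_triangle_ineq2[of y x]
          by (auto simp: dist_norm norm_minus_commute)
        have "norm (of_real q ^ j * y) \<le> q ^ J * R"
          unfolding norm_mult using q y elim by (intro mult_mono) (auto simp: norm_power intro: power_decreasing)
        also have "\<dots> \<le> 1 / 2"
        proof -
          have "R > 0" using d by (simp add: R_def add_nonneg_pos)
          hence "q ^ J * (2 * R) < 1" using J by (simp add: pos_less_divide_eq)
          thus ?thesis by simp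
        qed
        finally have "norm (1 - of_real q ^ j * y) \<ge> 1 / 2"
          using norm_triangle_ineq2[of 1 "of_real q ^ j * y"] by simp
        hence "norm (c j) * (1 / 2) \<le> norm (c j) * norm (1 - of_real q ^ j * y)"
          by (intro mult_left_mono) auto
        moreover have "norm (1 - of_real q ^ j * y) > 0"
          using \<open>norm (1 - of_real q ^ j * y) \<ge> 1 / 2\<close> by linarith
        ultimately show "norm (c j / (1 - of_real q ^ j * y)) \<le> 2 * norm (c j)"
          by (simp add: norm_divide pos_divide_le_eq)
      qed
    qed
    show "summable (\<lambda>j. 2 * norm (c j))" using c by (rule summable_mult)
  qed
  thus "\<exists>d>0. cball x d \<subseteq> - W87_poles q \<and>
      uniform_limit (cball x d) (\<lambda>N y. \<Sum>j<N. c j / (1 - of_real q ^ j * y))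
        (\<lambda>y. \<Sum>j. c j / (1 - of_real q ^ j * y)) sequentially"
    using d by blast
qed

text \<open>Each fraction is a geometric series, and the resulting double family is dominated by
  |c_j| |y|^k. It is therefore absolutely summable and may be summed in either order.\<close>

lemma sums_exchange:
  fixes c :: "nat \<Rightarrow> complex" and w y :: complex
  assumes c: "summable (\<lambda>j. norm (c j))" and w: "norm w \<le> 1" and y: "norm y < 1"
  shows "(\<lambda>k. (\<Sum>j. c j * w ^ (j * k)) * y ^ k) sums (\<Sum>j. c j / (1 - w ^ j * y))"
proof -
  define T where "T = (\<lambda>(j, k). c j * (w ^ j * y) ^ k)"
  have le: "norm (w ^ j * y) \<le> norm y" for j
    using w by (simp add: norm_mult norm_power mult_left_le_one_le power_le_one)
  have ssum: "summable (\<lambda>k. norm y ^ k)" using y by (simp add: summable_geometric)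
  have "(\<lambda>x. norm (T x)) summable_on UNIV \<times> UNIV"
  proof (rule summable_on_comparison_test)
    have "(\<lambda>j. norm (c j)) summable_on UNIV" "(\<lambda>k. norm y ^ k) summable_on UNIV"
      using c ssum by (auto simp: summable_on_UNIV_nonneg_real_iff)
    thus "(\<lambda>(j, k). norm (c j) * norm y ^ k) summable_on UNIV \<times> UNIV"
      by (intro summable_on_SigmaI[where g = "\<lambda>j. norm (c j) * (\<Sum>\<^sub>\<infinity>k. norm y ^ k)"])
         (auto intro!: has_sum_cmult_right summable_on_cmult_left)
    fix x :: "nat \<times> nat"
    obtain j k where x: "x = (j, k)" by force
    have "norm (T x) = norm (c j) * norm (w ^ j * y) ^ k" by (simp add: T_def x norm_mult norm_power)
    also have "\<dots> \<le> norm (c j) * norm y ^ k" using le[of j] by (intro mult_left_mono power_mono) auto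
    finally show "norm (T x) \<le> (case x of (j, k) \<Rightarrow> norm (c j) * norm y ^ k)" by (simp add: x)
  qed auto
  hence Tsum: "T summable_on UNIV \<times> UNIV" by (rule abs_summable_summable)
  have sw: "(\<lambda>(k, j). T (j, k)) summable_on UNIV \<times> UNIV"
    using Tsum summable_on_swap[of T UNIV UNIV] by (simp add: case_prod_unfold)
  have in1: "((\<lambda>k. T (j, k)) has_sum (c j / (1 - w ^ j * y))) UNIV" for j
  proof (rule norm_summable_imp_has_sum)
    show "(\<lambda>k. T (j, k)) sums (c j / (1 - w ^ j * y))"
      unfolding T_def using sums_mult[OF geometric_sums, of "w ^ j * y" "c j"] le[of j] y by simp
    have "summable (\<lambda>k. norm (c j) * norm (w ^ j * y) ^ k)"
      using le[of j] y by (intro summable_mult summable_geometric) auto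
    thus "summable (\<lambda>k. norm (T (j, k)))" by (simp add: T_def norm_mult norm_power)
  qed
  have in2: "((\<lambda>j. T (j, k)) has_sum (\<Sum>j. c j * w ^ (j * k)) * y ^ k) UNIV" for k
  proof (rule norm_summable_imp_has_sum)
    have "norm (c j * w ^ (j * k)) \<le> norm (c j)" for j
      using w by (simp add: norm_mult norm_power mult_left_le power_le_one)
    hence "summable (\<lambda>j. norm (c j * w ^ (j * k)))" by (intro summable_comparison_test'[OF c]) auto
    hence "summable (\<lambda>j. c j * w ^ (j * k))" by (rule summable_norm_cancel)
    from sums_mult2[OF summable_sums[OF this], of "y ^ k"]
    show "(\<lambda>j. T (j, k)) sums ((\<Sum>j. c j * w ^ (j * k)) * y ^ k)"
      by (simp add: T_def power_mult power_mult_distrib mult_ac)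
    have "norm (T (j, k)) \<le> norm (c j)" for j
    proof -
      have "norm (T (j, k)) = norm (c j) * norm (w ^ j * y) ^ k" by (simp add: T_def norm_mult norm_power)
      also have "\<dots> \<le> norm (c j) * 1"
        using le[of j] y by (intro mult_left_mono power_le_one) auto
      finally show ?thesis by simp
    qed
    thus "summable (\<lambda>j. norm (T (j, k)))" by (intro summable_comparison_test'[OF c]) auto
  qed
  have s1: "((\<lambda>j. c j / (1 - w ^ j * y)) has_sum infsum T (UNIV \<times> UNIV)) UNIV"
    by (rule has_sum_SigmaD[where f = T and B = "\<lambda>_. UNIV"])
       (use in1 Tsum in auto)
  have s2: "((\<lambda>k. (\<Sum>j. c j * w ^ (j * k)) * y ^ k) has_sum infsum (\<lambda>(k, j). T (j, k)) (UNIV \<times> UNIV)) UNIV"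
    by (rule has_sum_SigmaD[where f = "\<lambda>(k, j). T (j, k)" and B = "\<lambda>_. UNIV"])
       (use in2 sw in auto)
  have s3: "infsum T (UNIV \<times> UNIV) = infsum (\<lambda>(k, j). T (j, k)) (UNIV \<times> UNIV)"
    using infsum_swap_banach[of "\<lambda>k j. T (j, k)" UNIV UNIV]
    by (intro infsum_reindex_bij_witness[where i = prod.swap and j = prod.swap]) auto
  have "(\<Sum>j. c j / (1 - w ^ j * y)) = infsum T (UNIV \<times> UNIV)"
    using sums_unique[OF has_sum_imp_sums[OF s1]] by simp
  thus ?thesis using has_sum_imp_sums[OF s2] unfolding s3 by simp
qed

lemma continues_eventually:
  assumes q: "0 < q" "q < 1" and f: "continues q u f" and v: "\<And>k. k \<ge> K \<Longrightarrow> v k = u k"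
  shows "continues q v (\<lambda>y. f y + (\<Sum>k<K. (v k - u k) * y ^ k))"
  unfolding continues_def
proof (intro conjI allI impI)
  show "(\<lambda>y. f y + (\<Sum>k<K. (v k - u k) * y ^ k)) holomorphic_on - W87_poles q"
    using f by (intro holomorphic_intros) (auto simp: continues_def)
  fix y :: complex assume "norm y < 1"
  hence "(\<lambda>k. u k * y ^ k) sums f y" using f by (auto simp: continues_def)
  moreover have "(\<lambda>k. (v k - u k) * y ^ k) sums (\<Sum>k<K. (v k - u k) * y ^ k)"
    by (rule sums_finite) (use v in auto)
  ultimately have "(\<lambda>k. u k * y ^ k + (v k - u k) * y ^ k) sums (f y + (\<Sum>k<K. (v k - u k) * y ^ k))"
    by (rule sums_add)
  thus "(\<lambda>k. v k * y ^ k) sums (f y + (\<Sum>k<K. (v k - u k) * y ^ k))" by (simp add: algebra_simps)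
qed

text \<open>If \<open>u k = F (q\<^sup>k)\<close> and \<open>F w = (\<Sum>j. c j w\<^sup>j)\<close>, the generating function of \<open>u\<close> is \<open>\<Sum>j. c j / (1 - q\<^sup>j y)\<close>.\<close>

lemma q_analytic_continues:
  assumes q: "0 < q" "q < 1" and u: "q_analytic q u"
  shows "\<exists>f. continues q u f"
proof -
  obtain F e where e: "e > 0" "F holomorphic_on ball 0 e"
    and F: "\<forall>\<^sub>F k in sequentially. u k = F (complex_of_real q ^ k)"
    using u by (auto simp: q_analytic_def analytic_at_ball)
  obtain K0 where K0: "q ^ K0 < e / 2" using real_arch_pow_inv[of "e / 2" q] q e by auto
  obtain K1 where K1: "\<And>k. k \<ge> K1 \<Longrightarrow> u k = F (complex_of_real q ^ k)"
    using F by (auto simp: eventually_sequentially)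
  \<comment> \<open>Starting at index \<open>K\<close> puts q^K strictly inside the disc where
    \<open>F\<close> is holomorphic, which makes the rescaled Taylor coefficients \<open>c j\<close>
    absolutely summable. The omitted coefficients return at the end as a polynomial via
    \<open>continues_eventually\<close>.\<close>
  define K where "K = max K0 K1"
  have K: "q ^ K < e / 2"
  proof -
    have "q ^ K \<le> q ^ K0" using q by (intro power_decreasing) (auto simp: K_def)
    thus ?thesis using K0 by linarith
  qed
  define b where "b j = (deriv ^^ j) F 0 / fact j" for j
  have pw: "(\<lambda>j. b j * w ^ j) sums F w" if "norm w < e" for w
    unfolding b_def using holomorphic_power_series[OF e(2), of w] that by simp
  define c where "c j = b j * (complex_of_real q ^ K) ^ j" for j
  have c: "summable (\<lambda>j. norm (c j))"
    unfolding c_def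
  proof (rule powser_insidea)
    show "summable (\<lambda>j. b j * complex_of_real (e / 2) ^ j)"
      using pw[of "of_real (e / 2)"] e(1) by (auto simp: sums_iff norm_divide)
    show "norm (complex_of_real q ^ K) < norm (complex_of_real (e / 2))"
      using K q e by (simp add: norm_power norm_divide)
  qed
  have uc: "u (k + K) = (\<Sum>j. c j * complex_of_real q ^ (j * k))" for k
  proof -
    have "norm (complex_of_real q ^ (k + K)) < e"
    proof -
      have "q ^ (k + K) \<le> q ^ K" using q by (intro power_decreasing) auto
      moreover have "0 < q ^ K" using q by simp
      ultimately have "q ^ (k + K) < e" using K by linarith
      thus ?thesis using q by (simp add: norm_power)
    qed
    hence "(\<lambda>j. b j * (complex_of_real q ^ (k + K)) ^ j) sums F (complex_of_real q ^ (k + K))"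
      by (rule pw)
    moreover have "(complex_of_real q ^ (k + K)) ^ j = (complex_of_real q ^ K) ^ j * complex_of_real q ^ (j * k)" for j
      by (simp add: power_add power_mult_distrib flip: power_mult) (simp add: mult_ac)
    moreover have "F (complex_of_real q ^ (k + K)) = u (k + K)" using K1 by (simp add: K_def)
    ultimately show ?thesis by (simp add: c_def sums_iff mult_ac)
  qed
  define f where "f y = y ^ K * (\<Sum>j. c j / (1 - of_real q ^ j * y))" for y
  define v where "v k = (if k < K then 0 else u k)" for k
  have "continues q v f"
    unfolding continues_def
  proof (intro conjI allI impI)
    show "f holomorphic_on - W87_poles q"
      unfolding f_def by (intro holomorphic_intros q_fraction_series_holomorphic q c)
    fix y :: complex assume y: "norm y < 1"
    have "(\<lambda>k. u (k + K) * y ^ k) sums (\<Sum>j. c j / (1 - of_real q ^ j * y))"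
      unfolding uc using sums_exchange[OF c _ y, of "of_real q"] q by simp
    from sums_mult[OF this, of "y ^ K"]
    have "(\<lambda>k. v (k + K) * y ^ (k + K)) sums f y" by (simp add: v_def f_def power_add mult_ac)
    thus "(\<lambda>k. v k * y ^ k) sums f y"
      by (subst (asm) sums_iff_shift) (simp add: v_def)
  qed
  from continues_eventually[OF q this, of K u] show ?thesis by (auto simp: v_def)
qed

section \<open>Calculation rules for continued sums\<close>

definition qcont :: "real \<Rightarrow> (nat \<Rightarrow> complex) \<Rightarrow> complex \<Rightarrow> complex" where
  "qcont q u = (SOME f. continues q u f)"

text \<open>Off the poles the choice has only one possible value, so any explicit continuation
  computes it. The rules for sums, scalar factors, powers of \<open>q\<close> and index shifts are
  all obtained by exhibiting such a continuation.\<close>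

lemma qcont_eq:
  assumes "0 < q" "q < 1" "continues q u f" "y \<notin> W87_poles q"
  shows "qcont q u y = f y"
  using continues_unique[OF assms(1,2) someI[of "continues q u", OF assms(3)] assms(3,4)]
  by (simp add: qcont_def)

lemma continues_qcont:
  assumes "0 < q" "q < 1" "q_analytic q u"
  shows "continues q u (qcont q u)"
  unfolding qcont_def using someI_ex[OF q_analytic_continues[OF assms]] .

lemma qcont_add:
  assumes "0 < q" "q < 1" "q_analytic q u" "q_analytic q v" "y \<notin> W87_poles q"
  shows "qcont q (\<lambda>k. u k + v k) y = qcont q u y + qcont q v y"
proof (rule qcont_eq[where f = "\<lambda>y. qcont q u y + qcont q v y"])
  show "continues q (\<lambda>k. u k + v k) (\<lambda>y. qcont q u y + qcont q v y)"
    using continues_qcont[OF assms(1,2,3)] continues_qcont[OF assms(1,2,4)]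
    by (auto simp: continues_def distrib_right intro!: holomorphic_intros sums_add)
qed (use assms in auto)

lemma qcont_cmult:
  assumes "0 < q" "q < 1" "q_analytic q u" "y \<notin> W87_poles q"
  shows "qcont q (\<lambda>k. c * u k) y = c * qcont q u y"
proof (rule qcont_eq[where f = "\<lambda>y. c * qcont q u y"])
  show "continues q (\<lambda>k. c * u k) (\<lambda>y. c * qcont q u y)"
    using continues_qcont[OF assms(1,2,3)]
    by (auto simp: continues_def mult.assoc intro!: holomorphic_intros sums_mult)
qed (use assms in auto)

lemma qcont_power_mult:
  assumes "0 < q" "q < 1" "q_analytic q u" "y \<notin> W87_poles q"
  shows "qcont q (\<lambda>k. u k * of_real q ^ k) y = qcont q u (of_real q * y)"
proof (rule qcont_eq[where f = "\<lambda>y. qcont q u (of_real q * y)"])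
  have c: "continues q u (qcont q u)" by (rule continues_qcont[OF assms(1,2,3)])
  have "(qcont q u \<circ> (\<lambda>y. of_real q * y)) holomorphic_on - W87_poles q"
    by (rule holomorphic_on_compose)
       (use c mult_q_notin_W87_poles[OF assms(1)] in
         \<open>auto intro!: holomorphic_intros simp: continues_def elim: holomorphic_on_subset\<close>)
  moreover have "(\<lambda>k. u k * of_real q ^ k * y ^ k) sums qcont q u (of_real q * y)" if "norm y < 1" for y
  proof -
    have "norm (of_real q * y) < 1" using assms(1,2) that
      by (simp add: norm_mult) (metis less_trans mult_strict_right_mono norm_ge_zero mult_less_cancel_right1 not_less order_less_le)
    thus ?thesis using c by (auto simp: continues_def power_mult_distrib mult.assoc)
  qed
  ultimately show "continues q (\<lambda>k. u k * of_real q ^ k) (\<lambda>y. qcont q u (of_real q * y))"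
    by (auto simp: continues_def o_def)
qed (use assms in auto)

lemma qcont_Suc:
  assumes "0 < q" "q < 1" "q_analytic q u" "y \<notin> W87_poles q"
  shows "qcont q u y = u 0 + y * qcont q (\<lambda>k. u (Suc k)) y"
proof (rule qcont_eq[where f = "\<lambda>y. u 0 + y * qcont q (\<lambda>k. u (Suc k)) y"])
  have c: "continues q (\<lambda>k. u (Suc k)) (qcont q (\<lambda>k. u (Suc k)))"
    using assms by (intro continues_qcont) (auto simp: q_analytic_Suc_iff)
  have "(\<lambda>k. u k * y ^ k) sums (u 0 + y * qcont q (\<lambda>k. u (Suc k)) y)" if "norm y < 1" for y
  proof -
    have "(\<lambda>k. y * (u (Suc k) * y ^ k)) sums (y * qcont q (\<lambda>k. u (Suc k)) y)"
      using c that by (intro sums_mult) (auto simp: continues_def)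
    hence "(\<lambda>k. u (Suc k) * y ^ Suc k) sums (y * qcont q (\<lambda>k. u (Suc k)) y)" by (simp add: mult_ac)
    from sums_Suc[OF this] show ?thesis by (simp add: add.commute)
  qed
  thus "continues q u (\<lambda>y. u 0 + y * qcont q (\<lambda>k. u (Suc k)) y)"
    using c by (auto simp: continues_def intro!: holomorphic_intros)
qed (use assms in auto)

text \<open>Splitting off the first term expresses the continued sum of \<open>h\<close> as
  \<open>h 0\<close> plus \<open>x\<close> times that of the shifted sequence, also where the series
  diverges. By linearity everything except \<open>h 0\<close> cancels.\<close>

lemma qcont_telescope:
  assumes "0 < q" "q < 1" "q_analytic q h" "x \<notin> W87_poles q"
    and v: "\<And>k. v k = x * h (Suc k) - h k"
  shows "qcont q v x = - h 0"
proof -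
  have v': "v = (\<lambda>k. x * h (Suc k) + (-1) * h k)" by (auto simp: v)
  have hS: "q_analytic q (\<lambda>k. h (Suc k))" using assms by (simp add: q_analytic_Suc_iff)
  have "qcont q v x = qcont q (\<lambda>k. x * h (Suc k)) x + qcont q (\<lambda>k. (-1) * h k) x"
    unfolding v' by (intro qcont_add assms q_analytic_mult q_analytic_const hS)
  also have "\<dots> = x * qcont q (\<lambda>k. h (Suc k)) x + (-1) * qcont q h x"
    by (simp only: qcont_cmult[OF assms(1,2) hS assms(4)] qcont_cmult[OF assms(1-4)])
  finally have "qcont q v x = x * qcont q (\<lambda>k. h (Suc k)) x + (-1) * qcont q h x" .
  thus ?thesis using qcont_Suc[OF assms(1-4)] by simp
qed

section \<open>Identification of \<open>W87\<close> with a continued sum\<close>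

lemma qpochs_Cons [simp]: "qpochs q (x # xs) k = qpoch q x k * qpochs q xs k"
  and qpochs_Nil [simp]: "qpochs q [] k = 1"
  by (simp_all add: qpochs_def)

lemma qpochs_inf_Cons [simp]: "qpochs_inf q (x # xs) = qpoch_inf q x * qpochs_inf q xs"
  and qpochs_inf_Nil [simp]: "qpochs_inf q [] = 1"
  by (simp_all add: qpochs_inf_def)

lemma qpoch_LIMSEQ:
  assumes "0 < q" "q < 1"
  shows "(\<lambda>k. qpoch q x k) \<longlonglongrightarrow> qpoch_inf q x"
proof -
  have "(\<lambda>k. qpoch q x (Suc k)) \<longlonglongrightarrow> qpoch_inf q x"
    unfolding qpoch_def qpoch_inf_def lessThan_Suc_atMost
    by (rule convergent_prod_LIMSEQ[OF convergent_prod_qpoch[OF assms]])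
  thus ?thesis by (subst (asm) filterlim_sequentially_Suc)
qed

lemma qpochs_LIMSEQ:
  assumes "0 < q" "q < 1"
  shows "(\<lambda>k. qpochs q xs k) \<longlonglongrightarrow> qpochs_inf q xs"
  by (induction xs) (auto intro!: tendsto_mult qpoch_LIMSEQ[OF assms])

lemma qpochs_inf_nonzero:
  assumes "0 < q" "q < 1" "\<And>k. qpochs q xs k \<noteq> 0"
  shows "qpochs_inf q xs \<noteq> 0"
  using assms(3)
proof (induction xs)
  case (Cons x xs)
  have "1 - x * complex_of_real q ^ k \<noteq> 0" for k
    using Cons.prems[of "Suc k"] by (auto simp: qpoch_Suc)
  thus ?case using Cons qpoch_inf_nonzero[OF assms(1,2)] by auto
qed auto

lemma qpochs_eventually_0:
  assumes "qpochs q xs K = 0" "k \<ge> K"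
  shows "qpochs q xs k = 0"
  using assms(2)
proof (induction k rule: dec_induct)
  case (step n)
  thus ?case by (induction xs) (auto simp: qpoch_Suc)
qed (rule assms(1))

lemma q_analytic_W87_coeff:
  assumes "0 < q" "q < 1"
  shows "q_analytic q (W87_coeff q \<alpha> a1 a2 a3 a4 a5)"
proof -
  have 1: "q_analytic q (qpochs q xs)" for xs
  proof (induction xs)
    case (Cons x xs)
    show ?case using q_analytic_mult[OF q_analytic_qpoch[OF assms, of x] Cons.IH]
      by (elim q_analytic_cong) auto
  qed (auto simp: qpochs_def q_analytic_const)
  have 2: "q_analytic q (\<lambda>k. inverse (qpochs q xs k))" for xs
  proof (induction xs)
    case (Cons x xs)
    show ?case using q_analytic_mult[OF q_analytic_inverse_qpoch[OF assms, of x] Cons.IH]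
      by (elim q_analytic_cong) auto
  qed (auto simp: qpochs_def q_analytic_const)
  show ?thesis
    unfolding W87_coeff_def[abs_def] W87_num_def W87_den_def divide_inverse by (intro q_analytic_mult 1 2)
qed

text \<open>The delicate case is a summable series with |x| >= 1. Summability forces the
  coefficients to tend to 0. If no numerator vanished, multiplying by the denominators would give
  numerators tending to 0, although they tend to a nonzero infinite product. So the series
  terminates, and its continuation is a polynomial that agrees with the sum everywhere.\<close>

lemma W87_eq_qcont:
  assumes q: "0 < q" "q < 1" and def: "W87_defined q \<alpha> a1 a2 a3 a4 a5 x"
  shows "W87 q \<alpha> a1 a2 a3 a4 a5 x = qcont q (W87_coeff q \<alpha> a1 a2 a3 a4 a5) x"
proof -
  have x: "x \<notin> W87_poles q" and den: "\<And>k. W87_den q \<alpha> a1 a2 a3 a4 a5 k \<noteq> 0"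
    using def by (auto simp: W87_defined_def)
  define u where "u = W87_coeff q \<alpha> a1 a2 a3 a4 a5"
  have c: "continues q u (qcont q u)"
    unfolding u_def by (intro continues_qcont q q_analytic_W87_coeff)
  have cont: "W87_cont q \<alpha> a1 a2 a3 a4 a5 = qcont q u"
    by (simp add: W87_cont_def qcont_def continues_def u_def)
  have "(\<Sum>k. u k * x ^ k) = qcont q u x" if sm: "summable (\<lambda>k. u k * x ^ k)"
  proof (cases "norm x < 1")
    case True
    thus ?thesis using c by (auto simp: continues_def sums_iff)
  next
    case False
    have "\<exists>K. W87_num q \<alpha> a1 a2 a3 a4 a5 K = 0"
    proof (rule ccontr)
      assume nz: "\<not> ?thesis"
      have "(\<lambda>k. u k * x ^ k) \<longlonglongrightarrow> 0" using sm by (rule summable_LIMSEQ_zero)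
      hence "u \<longlonglongrightarrow> 0"
      proof (rule Lim_null_comparison[rotated, OF tendsto_norm_zero])
        have "norm (u k) * 1 \<le> norm (u k) * norm (x ^ k)" for k
          using False by (intro mult_left_mono) (auto simp: norm_power one_le_power)
        thus "\<forall>\<^sub>F k in sequentially. norm (u k) \<le> norm (u k * x ^ k)" by (simp add: norm_mult)
      qed
      hence "(\<lambda>k. u k * W87_den q \<alpha> a1 a2 a3 a4 a5 k) \<longlonglongrightarrow>
          0 * qpochs_inf q [q, csqrt \<alpha>, - csqrt \<alpha>, q * \<alpha> / a1, q * \<alpha> / a2, q * \<alpha> / a3, q * \<alpha> / a4, q * \<alpha> / a5]"
        unfolding W87_den_def by (intro tendsto_mult qpochs_LIMSEQ[OF q])
      moreover have "u k * W87_den q \<alpha> a1 a2 a3 a4 a5 k = W87_num q \<alpha> a1 a2 a3 a4 a5 k" for k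
        using den by (simp add: u_def W87_coeff_def)
      ultimately have "(\<lambda>k. W87_num q \<alpha> a1 a2 a3 a4 a5 k) \<longlonglongrightarrow> 0" by simp
      moreover have "(\<lambda>k. W87_num q \<alpha> a1 a2 a3 a4 a5 k) \<longlonglongrightarrow>
          qpochs_inf q [\<alpha>, q * csqrt \<alpha>, - complex_of_real q * csqrt \<alpha>, a1, a2, a3, a4, a5]"
        unfolding W87_num_def by (rule qpochs_LIMSEQ[OF q])
      moreover have "qpochs_inf q [\<alpha>, q * csqrt \<alpha>, - complex_of_real q * csqrt \<alpha>, a1, a2, a3, a4, a5] \<noteq> 0"
        using nz by (intro qpochs_inf_nonzero q) (simp_all add: W87_num_def del: qpochs_Cons)
      ultimately show False using LIMSEQ_unique by blast
    qed
    then obtain K where K: "W87_num q \<alpha> a1 a2 a3 a4 a5 K = 0" by auto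
    have "u k = 0" if "k \<ge> K" for k
      using qpochs_eventually_0[OF K[unfolded W87_num_def] that] by (simp add: u_def W87_coeff_def W87_num_def)
    hence s: "(\<lambda>k. u k * y ^ k) sums (\<Sum>k<K. u k * y ^ k)" for y
      by (intro sums_finite) auto
    hence "continues q u (\<lambda>y. \<Sum>k<K. u k * y ^ k)"
      by (auto simp: continues_def intro!: holomorphic_intros)
    thus ?thesis using qcont_eq[OF q _ x] s[of x] by (auto simp: sums_iff)
  qed
  thus ?thesis by (auto simp: W87_def cont u_def)
qed

section \<open>Very-well-poised coefficients\<close>

text \<open>
  The list contains all numerator parameters, \<open>al\<close> included. The normalising factor \<open>1 / (1 - al)\<close>
  is left out: contiguous relations mix different values of \<open>al\<close>.
\<close>

definition vwp :: "real \<Rightarrow> complex \<Rightarrow> complex list \<Rightarrow> nat \<Rightarrow> complex" where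
  "vwp q al as k = (1 - al * (of_real q ^ k)^2) * (\<Prod>a\<leftarrow>as. qpoch q a k / qpoch q (of_real q * al / a) k)"

lemma qpoch_q_nonzero:
  assumes "0 < q" "q < 1"
  shows "qpoch q (of_real q) k \<noteq> 0"
proof -
  have "complex_of_real q * of_real q ^ i \<noteq> 1" for i
  proof -
    have "norm (complex_of_real q * of_real q ^ i) < 1"
      using assms power_Suc_less_one[of q i] by (simp add: norm_mult norm_power)
    thus ?thesis by auto
  qed
  thus ?thesis by (simp add: qpoch_def)
qed

lemma qpoch_shift: "qpoch q y k * (1 - y * of_real q ^ k) = (1 - y) * qpoch q (of_real q * y) k"
  by (simp flip: qpoch_Suc qpoch_Suc_shift)

lemma qpoch_shift2:
  "(1 - y) * qpoch q (of_real q * y) (Suc j) = qpoch q y j * (1 - y * of_real q ^ j) * (1 - y * of_real q ^ Suc j)"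
  unfolding qpoch_Suc_shift[of q y "Suc j", symmetric] by (simp only: qpoch_Suc)

lemma qpoch_shift_nonzero:
  assumes "\<And>k. qpoch q y k \<noteq> 0"
  shows "qpoch q (of_real q * y) k \<noteq> 0" "1 - y \<noteq> 0" "1 - y * of_real q ^ k \<noteq> 0"
  using assms[of "Suc k"] qpoch_Suc_shift[of q y k] qpoch_Suc[of q y k] by auto

text \<open>Moves a denominator to the more shifted parameter, so that the three series of a
  contiguous relation acquire a common denominator.\<close>

lemma qpoch_inverse_shift:
  assumes "\<And>k. qpoch q y k \<noteq> 0"
  shows "(1 - y) / qpoch q y k = (1 - y * of_real q ^ k) / qpoch q (of_real q * y) k"
  using qpoch_shift[of q y k] assms[of k] qpoch_shift_nonzero(1)[OF assms, of k]
  by (simp add: field_simps)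

lemma q_analytic_vwp:
  assumes "0 < q" "q < 1"
  shows "q_analytic q (vwp q al as)"
proof -
  have "q_analytic q (\<lambda>k. \<Prod>a\<leftarrow>as. qpoch q a k / qpoch q (of_real q * al / a) k)"
    by (induction as) (auto intro!: q_analytic_intros assms)
  thus ?thesis unfolding vwp_def[abs_def] by (intro q_analytic_intros)
qed

lemma W87_defined_nonzero:
  assumes "W87_defined q \<alpha> a1 a2 a3 a4 a5 x"
  shows "qpoch q (q * \<alpha> / a1) k \<noteq> 0" "qpoch q (q * \<alpha> / a2) k \<noteq> 0" "qpoch q (q * \<alpha> / a3) k \<noteq> 0"
    "qpoch q (q * \<alpha> / a4) k \<noteq> 0" "qpoch q (q * \<alpha> / a5) k \<noteq> 0" "qpoch q q k \<noteq> 0"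
    "1 - \<alpha> \<noteq> 0" "1 - \<alpha> * (of_real q ^ k)^2 \<noteq> 0" "x \<notin> W87_poles q"
    "a1 \<noteq> 0" "a2 \<noteq> 0" "a3 \<noteq> 0" "a4 \<noteq> 0" "a5 \<noteq> 0"
proof -
  have den: "W87_den q \<alpha> a1 a2 a3 a4 a5 k \<noteq> 0" for k using assms by (auto simp: W87_defined_def)
  thus "qpoch q (q * \<alpha> / a1) k \<noteq> 0" "qpoch q (q * \<alpha> / a2) k \<noteq> 0" "qpoch q (q * \<alpha> / a3) k \<noteq> 0"
    "qpoch q (q * \<alpha> / a4) k \<noteq> 0" "qpoch q (q * \<alpha> / a5) k \<noteq> 0" "qpoch q q k \<noteq> 0"
    by (auto simp: W87_den_def)
  have "1 - csqrt \<alpha> * of_real q ^ k \<noteq> 0" "1 + csqrt \<alpha> * of_real q ^ k \<noteq> 0" for k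
    using den[of "Suc k"] by (auto simp: W87_den_def qpoch_Suc)
  hence "(1 - csqrt \<alpha> * of_real q ^ k) * (1 + csqrt \<alpha> * of_real q ^ k) \<noteq> 0" for k by simp
  moreover have "(1 - csqrt \<alpha> * of_real q ^ k) * (1 + csqrt \<alpha> * of_real q ^ k)
      = 1 - (csqrt \<alpha>)^2 * (of_real q ^ k)^2" for k
    by (simp only: power2_eq_square) (simp add: algebra_simps)
  ultimately have *: "1 - \<alpha> * (of_real q ^ k)^2 \<noteq> 0" for k unfolding power2_csqrt by metis
  show "1 - \<alpha> * (of_real q ^ k)^2 \<noteq> 0" by (rule *)
  show "1 - \<alpha> \<noteq> 0" using *[of 0] by simp
qed (use assms in \<open>auto simp: W87_defined_def\<close>)

text \<open>The four factorials with square roots collapse: the two quotients telescope to factors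
  with plus and minus the root, whose product depends on \<alpha> alone.\<close>

lemma W87_coeff_eq_vwp:
  assumes "W87_defined q \<alpha> a1 a2 a3 a4 a5 x" "0 < q" "\<alpha> \<noteq> 0"
  shows "W87_coeff q \<alpha> a1 a2 a3 a4 a5 k = vwp q \<alpha> [\<alpha>, a1, a2, a3, a4, a5] k / (1 - \<alpha>)"
proof -
  define s where "s = csqrt \<alpha>"
  have s: "s^2 = \<alpha>" by (simp add: s_def)
  have den: "W87_den q \<alpha> a1 a2 a3 a4 a5 k \<noteq> 0" for k using assms by (auto simp: W87_defined_def)
  have 1: "qpoch q s k \<noteq> 0" "qpoch q (-s) k \<noteq> 0" for k
    using den[of k] by (auto simp: W87_den_def s_def)
  have 2: "1 - s \<noteq> 0" "1 + s \<noteq> 0" using 1[of "Suc 0"] by (auto simp: qpoch_def)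
  have 3: "qpoch q (of_real q * s) k / qpoch q s k = (1 - s * of_real q ^ k) / (1 - s)"
    using qpoch_shift[of q s k] 1 2 by (simp add: field_simps)
  have 4: "qpoch q (- (of_real q * s)) k / qpoch q (- s) k = (1 + s * of_real q ^ k) / (1 + s)"
    using qpoch_shift[of q "-s" k] 1 2 by (simp add: field_simps)
  have 5: "(1 - s * of_real q ^ k) / (1 - s) * ((1 + s * of_real q ^ k) / (1 + s))
      = (1 - \<alpha> * (of_real q ^ k)^2) / (1 - \<alpha>)"
  proof -
    have "(1 - s * of_real q ^ k) * (1 + s * of_real q ^ k) = 1 - \<alpha> * (of_real q ^ k)^2"
      unfolding s[symmetric] power2_eq_square by (simp add: algebra_simps)
    moreover have "(1 - s) * (1 + s) = 1 - \<alpha>" unfolding s[symmetric] power2_eq_square by (simp add: algebra_simps)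
    ultimately show ?thesis by (simp add: times_divide_times_eq)
  qed
  have 6: "of_real q * \<alpha> / \<alpha> = complex_of_real q" using assms(3) by simp
  have "W87_coeff q \<alpha> a1 a2 a3 a4 a5 k =
      (qpoch q (of_real q * s) k / qpoch q s k) * (qpoch q (- (of_real q * s)) k / qpoch q (- s) k)
      * (\<Prod>a\<leftarrow>[\<alpha>, a1, a2, a3, a4, a5]. qpoch q a k / qpoch q (of_real q * \<alpha> / a) k)"
    unfolding W87_coeff_def W87_num_def W87_den_def qpochs_Cons qpochs_Nil list.map prod_list.Cons prod_list.Nil 6 s_def
    by (simp add: divide_inverse mult_ac)
  also have "\<dots> = vwp q \<alpha> [\<alpha>, a1, a2, a3, a4, a5] k / (1 - \<alpha>)"
    unfolding 3 4 5 vwp_def by simp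
  finally show ?thesis .
qed

lemma W87_eq_vwp:
  assumes "0 < q" "q < 1" "W87_defined q \<alpha> a1 a2 a3 a4 a5 x" "\<alpha> \<noteq> 0"
  shows "(1 - \<alpha>) * W87 q \<alpha> a1 a2 a3 a4 a5 x = qcont q (vwp q \<alpha> [\<alpha>, a1, a2, a3, a4, a5]) x"
proof -
  have "W87_coeff q \<alpha> a1 a2 a3 a4 a5 = (\<lambda>k. (1 / (1 - \<alpha>)) * vwp q \<alpha> [\<alpha>, a1, a2, a3, a4, a5] k)"
    using W87_coeff_eq_vwp[OF assms(3,1,4)] by auto
  hence "W87 q \<alpha> a1 a2 a3 a4 a5 x = 1 / (1 - \<alpha>) * qcont q (vwp q \<alpha> [\<alpha>, a1, a2, a3, a4, a5]) x"
    by (simp only: W87_eq_qcont[OF assms(1,2,3)]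
      qcont_cmult[OF assms(1,2) q_analytic_vwp[OF assms(1,2)] W87_defined_nonzero(9)[OF assms(3)]])
  thus ?thesis using W87_defined_nonzero(7)[OF assms(3)] by simp
qed

section \<open>Contiguous relations\<close>

text \<open>The polynomial identity in the form needed for series, with \<open>b0\<close>, ...,
  \<open>b3\<close> as inverse parameters; multiplication by \<open>D * q\<close> clears the
  denominators. None of the four parameters is singled out here, so the same identity serves the
  pair relation, where one of them is the base, and the base relation, where none is.\<close>

lemma pair_shift_fraction:
  fixes m n q T u :: complex
  assumes ab: "a0*b0 = 1" "a1*b1 = 1" "a2*b2 = 1" "a3*b3 = 1"
    and nz: "n - q*m \<noteq> 0" "m - q*n \<noteq> 0" "n - m \<noteq> 0" "q \<noteq> 0"
    and al: "al = q*m*n*T" and x: "x = m^2*n^2*q^3*T^3*b0*b1*b2*b3"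
    and Hp: "Hp = n^2*(1 - q*T*m*b0)*(1 - q*T*m*b1)*(1 - q*T*m*b2)*(1 - q*T*m*b3) / ((n - q*m)*(n - m))"
    and Hm: "Hm = m^2*(1 - q*T*n*b0)*(1 - q*T*n*b1)*(1 - q*T*n*b2)*(1 - q*T*n*b3) / ((m - q*n)*(n - m))"
  shows "(1 - T) * (x * ((1 - a0*u)*(1 - a1*u)*(1 - a2*u)*(1 - a3*u)) * (1 - m*u)*(1 - n*u)
      - (1 - al*b0*u)*(1 - al*b1*u)*(1 - al*b2*u)*(1 - al*b3*u) * (1 - q*n*T*u)*(1 - q*m*T*u))
    = (1 - al*u^2) * (- Hp * ((1 - m*u)*(1 - q*m*u)*(1 - n*T*u)*(1 - q*n*T*u))
      + ((1 - T)*(x - 1) + Hp - Hm) * ((1 - m*u)*(1 - n*u)*(1 - q*n*T*u)*(1 - q*m*T*u))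
      + Hm * ((1 - n*u)*(1 - q*n*u)*(1 - m*T*u)*(1 - q*m*T*u)))"
    (is "(1 - T) * ?L = ?R")
proof -
  define D where "D = (n - q * m) * (m - q * n) * (n - m)"
  define t where "t = q*T"
  \<comment> \<open>Coefficients in \<open>y\<close> of the product of the four factors
    \<open>1 - t*y*b_i\<close>. The quartic coefficient is written \<open>t*d4\<close>, since
    \<open>d4\<close> itself gives the argument: \<open>x = m^2*n^2*d4\<close>.\<close>
  define d1 d2 d3 d4 where d: "d1 = - t*(b0+b1+b2+b3)" "d2 = t^2*(b0*b1+b0*b2+b0*b3+b1*b2+b1*b3+b2*b3)"
    "d3 = - (t^3*(b0*b1*b2+b0*b1*b3+b0*b2*b3+b1*b2*b3))" "d4 = t^3*(b0*b1*b2*b3)"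
  have D0: "D * q \<noteq> 0" using nz by (simp add: D_def)
  have "D * Hp = n^2*((1 - q*T*m*b0)*(1 - q*T*m*b1)*(1 - q*T*m*b2)*(1 - q*T*m*b3))*(m - q*n)"
    using nz by (simp add: D_def Hp)
  also have "(1 - q*T*m*b0)*(1 - q*T*m*b1)*(1 - q*T*m*b2)*(1 - q*T*m*b3) = 1 + d1*m + d2*m^2 + d3*m^3 + t*d4*m^4"
    unfolding d t_def by algebra
  finally have Yp: "- (D * Hp) = - (n^2 * (1 + d1*m + d2*m^2 + d3*m^3 + t*d4*m^4) * (m - q*n))" by simp
  have "D * Hm = m^2*((1 - q*T*n*b0)*(1 - q*T*n*b1)*(1 - q*T*n*b2)*(1 - q*T*n*b3))*(n - q*m)"
    using nz by (simp add: D_def Hm)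
  also have "(1 - q*T*n*b0)*(1 - q*T*n*b1)*(1 - q*T*n*b2)*(1 - q*T*n*b3) = 1 + d1*n + d2*n^2 + d3*n^3 + t*d4*n^4"
    unfolding d t_def by algebra
  finally have Ym: "D * Hm = m^2 * (1 + d1*n + d2*n^2 + d3*n^3 + t*d4*n^4) * (n - q*m)" .
  have c: "b0 * (1 - a0*u) = b0 - u" "b1 * (1 - a1*u) = b1 - u" "b2 * (1 - a2*u) = b2 - u" "b3 * (1 - a3*u) = b3 - u"
    using ab by algebra+
  have x1: "x * ((1 - a0*u)*(1 - a1*u)*(1 - a2*u)*(1 - a3*u))
      = m^2*n^2*(t^3*u^4*1 + t^2*u^3*d1 + t*u^2*d2 + u*d3 + d4)"
  proof -
    have "x * ((1 - a0*u)*(1 - a1*u)*(1 - a2*u)*(1 - a3*u)) = m^2*n^2*t^3*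
       ((b0 * (1 - a0*u)) * (b1 * (1 - a1*u)) * (b2 * (1 - a2*u)) * (b3 * (1 - a3*u)))"
      unfolding x t_def by algebra
    also have "\<dots> = m^2*n^2*(t^3*u^4*1 + t^2*u^3*d1 + t*u^2*d2 + u*d3 + d4)"
      unfolding c d by algebra
    finally show ?thesis .
  qed
  have x2: "(1 - al*b0*u)*(1 - al*b1*u)*(1 - al*b2*u)*(1 - al*b3*u)
      = 1 + d1*(m*n*u) + d2*(m*n*u)^2 + d3*(m*n*u)^3 + t*d4*(m*n*u)^4"
    unfolding al d t_def by algebra
  have x3: "x = m^2*n^2*d4" unfolding x d t_def by algebra
  have "D * q * ((1 - T) * ?L) = D * (q - t) * (m^2 * n^2 * (t^3*u^4*1 + t^2*u^3*d1 + t*u^2*d2 + u*d3 + d4) * (1 - m*u) * (1 - n*u)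
      - (1 + d1*(m*n*u) + d2*(m*n*u)^2 + d3*(m*n*u)^3 + t*d4*(m*n*u)^4) * (1 - n*t*u) * (1 - m*t*u))"
    unfolding x1 x2 t_def by (simp add: algebra_simps)
  also have "\<dots> = (1 - m*n*t*u^2) * (- (D * Hp) * (1 - q*m*u) * (q - n*t*u) * (1 - m*u) * (1 - n*t*u)
      + (D * (q - t) * (m^2 * n^2 * d4 - 1) - q*(- (D * Hp)) - q*(D * Hm)) * (1 - m*u) * (1 - n*t*u) * (1 - n*u) * (1 - m*t*u)
      + D * Hm * (1 - q*n*u) * (q - m*t*u) * (1 - n*u) * (1 - m*t*u))"
    by (rule pair_shift_identity[OF D_def Yp Ym])
  also have "\<dots> = D * q * ?R"
    unfolding x3[symmetric] unfolding al t_def by algebra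
  finally show ?thesis by (rule iffD1[OF mult_left_cancel[OF D0]])
qed

lemma qcont_add3:
  assumes q: "0 < q" "q < 1" and y: "y \<notin> W87_poles q"
    and u: "q_analytic q u1" "q_analytic q u2" "q_analytic q u3"
  shows "qcont q (\<lambda>k. c1 * u1 k + c2 * u2 k + c3 * u3 k) y = c1 * qcont q u1 y + c2 * qcont q u2 y + c3 * qcont q u3 y"
proof -
  have "q_analytic q (\<lambda>k. c1 * u1 k)" "q_analytic q (\<lambda>k. c2 * u2 k)" "q_analytic q (\<lambda>k. c3 * u3 k)"
    by (intro q_analytic_mult q_analytic_const u)+
  thus ?thesis
    by (simp add: qcont_add[OF q _ _ y] qcont_cmult[OF q _ y] u q_analytic_add)
qed

text \<open>The middle series has the pair \<open>(Q*m, Q*n)\<close>, its neighbours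
  \<open>(Q*(Q*m), n)\<close> and \<open>(m, Q*(Q*n))\<close>. The product of the pair is constant,
  so \<open>xa\<close>, which says x = q^2 \<alpha>^2 / (a_1 ... a_5), holds for all three with the
  same \<open>x\<close>. Term by term, their combination is the difference given by
  \<open>pair_shift_fraction\<close>.\<close>

lemma vwp_contiguous_pair:
  fixes q :: real and Q al a1 a2 a3 m n T x :: complex
  defines "Q \<equiv> complex_of_real q"
  assumes q: "0 < q" "q < 1" and x: "x \<notin> W87_poles q"
    and nz: "a1 \<noteq> 0" "a2 \<noteq> 0" "a3 \<noteq> 0" "m \<noteq> 0" "n \<noteq> 0" "T \<noteq> 0"
    and al: "al = Q*m*n*T" and xa: "x*a1*a2*a3 = m*n*Q^2*T^2"
    and neq: "n - m \<noteq> 0" "n - Q*m \<noteq> 0" "m - Q*n \<noteq> 0"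
    and den: "\<And>k. qpoch q (Q*al/a1) k \<noteq> 0" "\<And>k. qpoch q (Q*al/a2) k \<noteq> 0" "\<And>k. qpoch q (Q*al/a3) k \<noteq> 0"
      "\<And>k. qpoch q (n*T) k \<noteq> 0" "\<And>k. qpoch q (m*T) k \<noteq> 0"
    and gp: "gp = n * (1 - Q*T*m/a1)*(1 - Q*T*m/a2)*(1 - Q*T*m/a3) / ((n - Q*m)*(n - m))"
    and gm: "gm = m * (1 - Q*T*n/a1)*(1 - Q*T*n/a2)*(1 - Q*T*n/a3) / ((m - Q*n)*(n - m))"
  shows "gp * ((1 - Q*m)*(1 - n*T)*(1 - Q*(n*T))) * qcont q (vwp q al [al, a1, a2, a3, Q*(Q*m), n]) x
    + ((1 - T)*(x - 1) - (1 - n)*gp + (1 - m)*gm) * ((1 - Q*(n*T))*(1 - Q*(m*T)))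
        * qcont q (vwp q al [al, a1, a2, a3, Q*m, Q*n]) x
    - gm * ((1 - Q*n)*(1 - m*T)*(1 - Q*(m*T))) * qcont q (vwp q al [al, a1, a2, a3, m, Q*(Q*n)]) x = 0"
    (is "?cp * qcont q ?Up x + ?c0 * qcont q ?U0 x - ?cm * qcont q ?Um x = 0")
proof -
  have Q0: "Q \<noteq> 0" and al0: "al \<noteq> 0" using q nz by (auto simp: Q_def al)
  have args: "Q*al/al = Q" "Q*al/(Q*(Q*m)) = n*T" "Q*al/n = Q*(Q*(m*T))" "Q*al/(Q*m) = Q*(n*T)"
    "Q*al/(Q*n) = Q*(m*T)" "Q*al/m = Q*(Q*(n*T))" "Q*al/(Q*(Q*n)) = m*T"
    using nz Q0 al0 by (simp_all add: al divide_simps)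
  define b0 b1 b2 b3 where b: "b0 = 1/al" "b1 = 1/a1" "b2 = 1/a2" "b3 = 1/a3"
  have ab: "al*b0 = 1" "a1*b1 = 1" "a2*b2 = 1" "a3*b3 = 1" using nz al0 by (simp_all add: b)
  define X where "X = Q*(Q*(n*T))"
  define Y where "Y = Q*(Q*(m*T))"
  have denQ: "qpoch q Q k \<noteq> 0" for k unfolding Q_def by (rule qpoch_q_nonzero[OF q])
  have XY: "qpoch q X k \<noteq> 0" "qpoch q Y k \<noteq> 0" for k
    using den(4,5) unfolding X_def Y_def Q_def by (auto intro!: qpoch_shift_nonzero(1))
  define P where "P j = qpoch q (Q*m) j * qpoch q (Q*n) j" for j
  define N where "N k = qpoch q al k * qpoch q a1 k * qpoch q a2 k * qpoch q a3 k" for k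
  define E where "E k = qpoch q Q k * qpoch q (Q*al/a1) k * qpoch q (Q*al/a2) k * qpoch q (Q*al/a3) k" for k
  have E0: "E k \<noteq> 0" for k unfolding E_def using den denQ by auto
  \<comment> \<open>At index \<open>k\<close> the certificate contains 1/(q;q)_(k-1), which is read
    as 0 for \<open>k = 0\<close>. The pair also enters with index \<open>k - 1\<close>, because
    this is the part common to all three shifts.\<close>
  define h where "h k = (case k of 0 \<Rightarrow> 0 | Suc j \<Rightarrow> (1 - T) * N k * P j / (E j * qpoch q X j * qpoch q Y j))" for k
  have h_an: "q_analytic q h"
  proof -
    have "q_analytic q (\<lambda>j. h (Suc j))"
      unfolding h_def nat.case N_def P_def E_def divide_inverse inverse_mult_distrib
      by (intro q_analytic_mult q_analytic_const q_analytic_qpoch q_analytic_inverse_qpoch q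
          iffD2[OF q_analytic_Suc_iff[OF q(1)]])
    thus ?thesis using q_analytic_Suc_iff[OF q(1)] by blast
  qed
  define v where "v k = ?cp * ?Up k + ?c0 * ?U0 k + (- ?cm) * ?Um k" for k
  have step: "v k = x * h (Suc k) - h k" for k
  proof (cases k)
    \<comment> \<open>The general step divides by \<open>(1 - m) (1 - n)\<close> at \<open>k = 0\<close>, which may vanish.\<close>
    case 0
    define k1 k2 k3 where k: "k1 = b1+b2+b3" "k2 = b1*b2+b1*b3+b2*b3" "k3 = b1*b2*b3"
    define H where "H y = 1 - (Q*T)*k1*y + (Q*T)^2*k2*y^2 - (Q*T)^3*k3*y^3" for y
    have H: "(1 - Q*T*y/a1)*(1 - Q*T*y/a2)*(1 - Q*T*y/a3) = H y" for y
    proof -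
      have "(1 - Q*T*y*b1)*(1 - Q*T*y*b2)*(1 - Q*T*y*b3) = H y" unfolding H_def k by algebra
      thus ?thesis by (simp add: b)
    qed
    have G: "gp * ((n - Q*m)*(n - m)) = n * H m" "gm * ((m - Q*n)*(n - m)) = m * H n"
      using neq by (simp_all add: gp gm H mult.assoc[of n] mult.assoc[of m] flip: H)
    have xk: "x = m*n*(Q*T)^2*k3"
    proof -
      have "x = (x*a1*a2*a3)*(b1*b2*b3)" using nz by (simp add: b)
      thus ?thesis by (simp add: xa k power_mult_distrib)
    qed
    have xk1: "x*((1-a1)*(1-a2)*(1-a3)) = m*n*(Q*T)^2*(k3 - k2 + k1 - 1)"
    proof -
      have c: "b1 * (1 - a1) = b1 - 1" "b2 * (1 - a2) = b2 - 1" "b3 * (1 - a3) = b3 - 1"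
        using ab by algebra+
      have "x*((1-a1)*(1-a2)*(1-a3)) = m*n*(Q*T)^2*((b1 * (1 - a1)) * (b2 * (1 - a2)) * (b3 * (1 - a3)))"
        unfolding xk k by algebra
      also have "\<dots> = m*n*(Q*T)^2*(k3 - k2 + k1 - 1)" unfolding c k by algebra
      finally show ?thesis .
    qed
    have "(n - m) * (?cp + ?c0 - ?cm) = (1 - T) * ((x - 1)*(1 - n*(Q*T))*(1 - m*(Q*T))*(n - m)
        + (gp * ((n - Q*m)*(n - m)))*(1 - n*(Q*T)) - (gm * ((m - Q*n)*(n - m)))*(1 - m*(Q*T)))"
      by algebra
    also have "\<dots> = (1 - T) * ((n - m)*m*n*(Q*T)^2*(k3 - k2 + k1 - 1))"
      unfolding G using pair_shift_identity_initial[of H "Q*T" k1 k2 k3 x m n] xk H_def by (simp add: fun_eq_iff)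
    also have "\<dots> = (n - m) * ((1 - T) * (x*((1-a1)*(1-a2)*(1-a3))))" unfolding xk1 by simp
    finally have "?cp + ?c0 - ?cm = (1 - T) * (x*((1-a1)*(1-a2)*(1-a3)))"
      by (rule iffD1[OF mult_left_cancel[OF neq(1)]])
    moreover have "v 0 = (1 - al) * (?cp + ?c0 - ?cm)"
      by (simp add: v_def vwp_def) algebra
    ultimately have "v 0 = (1 - al) * ((1 - T) * (x*((1-a1)*(1-a2)*(1-a3))))" by (simp only:)
    also have "\<dots> = x * h (Suc 0) - h 0"
      by (simp add: h_def N_def P_def E_def qpoch_def)
    finally show ?thesis by (simp only: 0)
  next
    case (Suc j)
    define u where "u = Q ^ k"
    have uj: "Q * Q ^ j = u" by (simp add: u_def Suc)
    \<comment> \<open>The common factor of the three terms: the pair at its lowest index in the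
      numerator, the most shifted denominators \<open>X\<close> and \<open>Y\<close> below. Each
      term is \<open>C\<close> times a polynomial in \<open>u\<close>.\<close>
    define C where "C = N k / E k * P j / (qpoch q X k * qpoch q Y k)"
    have p1: "(1 - Q*m) * qpoch q (Q*(Q*m)) k = qpoch q (Q*m) j * (1 - m*u) * (1 - Q*m*u)"
      using qpoch_shift2[of "Q*m" q j] by (simp add: Suc Q_def[symmetric] u_def mult_ac)
    have p2: "(1 - Q*n) * qpoch q (Q*(Q*n)) k = qpoch q (Q*n) j * (1 - n*u) * (1 - Q*n*u)"
      using qpoch_shift2[of "Q*n" q j] by (simp add: Suc Q_def[symmetric] u_def mult_ac)
    have p3: "qpoch q m k = (1 - m) * qpoch q (Q*m) j" "qpoch q n k = (1 - n) * qpoch q (Q*n) j"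
      by (simp_all add: Suc qpoch_Suc_shift Q_def)
    have p4: "qpoch q (Q*m) k = qpoch q (Q*m) j * (1 - m*u)" "qpoch q (Q*n) k = qpoch q (Q*n) j * (1 - n*u)"
      by (simp_all add: Suc qpoch_Suc Q_def[symmetric] u_def mult_ac)
    have r: "(1 - y) / qpoch q y k = (1 - y*u) / qpoch q (Q*y) k" if "\<And>k. qpoch q y k \<noteq> 0" for y
      using qpoch_inverse_shift[OF that, of k] by (simp add: Q_def u_def)
    have rr: "(1 - y) * (1 - Q*y) / qpoch q y k = (1 - y*u) * (1 - Q*y*u) / qpoch q (Q*(Q*y)) k"
        "(1 - Q*y) / qpoch q (Q*y) k = (1 - Q*y*u) / qpoch q (Q*(Q*y)) k" if "\<And>k. qpoch q y k \<noteq> 0" for y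
    proof -
      have nz': "qpoch q (Q*y) k \<noteq> 0" for k using qpoch_shift_nonzero(1)[OF that] by (simp add: Q_def)
      show 1: "(1 - Q*y) / qpoch q (Q*y) k = (1 - Q*y*u) / qpoch q (Q*(Q*y)) k" by (rule r[OF nz'])
      have "(1 - y) * (1 - Q*y) / qpoch q y k = (1 - Q*y) * ((1 - y) / qpoch q y k)" by simp
      also have "\<dots> = (1 - y*u) * ((1 - Q*y) / qpoch q (Q*y) k)" unfolding r[OF that] by simp
      also have "\<dots> = (1 - y*u) * (1 - Q*y*u) / qpoch q (Q*(Q*y)) k" unfolding 1 by simp
      finally show "(1 - y) * (1 - Q*y) / qpoch q y k = (1 - y*u) * (1 - Q*y*u) / qpoch q (Q*(Q*y)) k" .
    qed
    note rn = rr[OF den(4), folded X_def] and rm = rr[OF den(5), folded Y_def]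
    define V where "V = (1 - al*u^2) * (N k / E k)"
    have "?cp * ?Up k = V * gp * ((1 - Q*m) * qpoch q (Q*(Q*m)) k) * qpoch q n k
        * ((1 - n*T) * (1 - Q*(n*T)) / qpoch q (n*T) k) / qpoch q Y k"
      unfolding vwp_def list.map prod_list.Cons prod_list.Nil Q_def[symmetric] args
      by (simp add: V_def N_def E_def Y_def u_def divide_inverse mult_ac)
    also have "\<dots> = (1 - al*u^2) * C * ((1 - n)*gp * ((1 - m*u)*(1 - Q*m*u)*(1 - n*T*u)*(1 - Q*n*T*u)))"
      unfolding p1 p3 rn by (simp add: V_def C_def P_def divide_inverse mult_ac)
    finally have e1: "?cp * ?Up k = \<dots>" .
    have "?cm * ?Um k = V * gm * ((1 - Q*n) * qpoch q (Q*(Q*n)) k) * qpoch q m k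
        * ((1 - m*T) * (1 - Q*(m*T)) / qpoch q (m*T) k) / qpoch q X k"
      unfolding vwp_def list.map prod_list.Cons prod_list.Nil Q_def[symmetric] args
      by (simp add: V_def N_def E_def X_def u_def divide_inverse mult_ac)
    also have "\<dots> = (1 - al*u^2) * C * ((1 - m)*gm * ((1 - n*u)*(1 - Q*n*u)*(1 - m*T*u)*(1 - Q*m*T*u)))"
      unfolding p2 p3 rm by (simp add: V_def C_def P_def divide_inverse mult_ac)
    finally have e2: "?cm * ?Um k = \<dots>" .
    define c where "c = (1 - T)*(x - 1) - (1 - n)*gp + (1 - m)*gm"
    have "?c0 * ?U0 k = V * c * qpoch q (Q*m) k * qpoch q (Q*n) k
        * ((1 - Q*(n*T)) / qpoch q (Q*(n*T)) k) * ((1 - Q*(m*T)) / qpoch q (Q*(m*T)) k)"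
      unfolding vwp_def list.map prod_list.Cons prod_list.Nil Q_def[symmetric] args c_def[symmetric]
      by (simp add: V_def N_def E_def u_def divide_inverse mult_ac)
    also have "\<dots> = (1 - al*u^2) * C * (c * ((1 - m*u)*(1 - n*u)*(1 - Q*n*T*u)*(1 - Q*m*T*u)))"
      unfolding p4 rn rm by (simp add: V_def C_def P_def divide_inverse mult_ac)
    finally have e0: "?c0 * ?U0 k = \<dots>" .
    have ab': "al*b0*u = u" "Q*al/a1 * Q^j = al*b1*u" "Q*al/a2 * Q^j = al*b2*u" "Q*al/a3 * Q^j = al*b3*u"
      using ab(1) by (simp_all add: b uj[symmetric])
    have hS: "x * h (Suc k) = C * ((1 - T) * (x * ((1 - al*u)*(1 - a1*u)*(1 - a2*u)*(1 - a3*u)) * (1 - m*u)*(1 - n*u)))"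
      unfolding h_def nat.case P_def[of k] p4 N_def[of "Suc k"] qpoch_Suc Q_def[symmetric] u_def[symmetric] C_def
      by (simp add: P_def N_def divide_inverse mult_ac)
    have Ek: "E k = E j * ((1 - al*b0*u)*(1 - al*b1*u)*(1 - al*b2*u)*(1 - al*b3*u))"
      unfolding E_def Suc qpoch_Suc Q_def[symmetric] uj ab' by (simp add: mult_ac)
    have Xk: "qpoch q X k = qpoch q X j * (1 - Q*n*T*u)" "qpoch q Y k = qpoch q Y j * (1 - Q*m*T*u)"
      by (simp_all add: Suc qpoch_Suc Q_def[symmetric] uj[symmetric] X_def Y_def mult_ac)
    have hk: "h k = C * ((1 - T) * ((1 - al*b0*u)*(1 - al*b1*u)*(1 - al*b2*u)*(1 - al*b3*u) * (1 - Q*n*T*u)*(1 - Q*m*T*u)))"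
    proof -
      have "h k = (1 - T) * N k * P j / (E j * qpoch q X j * qpoch q Y j)" by (simp add: h_def Suc)
      also have "\<dots> = (1 - T) * (N k / E k) * P j / (qpoch q X k * qpoch q Y k)
          * ((1 - al*b0*u)*(1 - al*b1*u)*(1 - al*b2*u)*(1 - al*b3*u) * (1 - Q*n*T*u)*(1 - Q*m*T*u))"
        using E0[of k] XY[of k] unfolding Ek Xk by (simp add: divide_simps)
      finally show ?thesis by (simp add: C_def mult_ac)
    qed
    \<comment> \<open>Since the first of the four parameters is the base, the factor
      \<open>1 - Q*T*m*b0\<close> equals \<open>-(1 - n)/n\<close>. The coefficient
      \<open>gp\<close> is defined with this factor removed, which keeps the case
      \<open>k = 0\<close> free of division by \<open>1 - n\<close>; \<open>gm\<close> is treated in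
      the same way.\<close>
    have Hp: "- ((1 - n)*gp) = n^2*(1 - Q*T*m*b0)*(1 - Q*T*m*b1)*(1 - Q*T*m*b2)*(1 - Q*T*m*b3) / ((n - Q*m)*(n - m))"
    proof -
      have "n*(1 - Q*T*m*b0) = -(1 - n)" using nz Q0 by (simp add: b al divide_simps)
      hence eq: "n^2*(1 - Q*T*m*b0) = - ((1 - n)*n)" by algebra
      show ?thesis unfolding eq gp b(2-4)
        by (simp only: mult_minus_left minus_divide_left[symmetric] times_divide_eq_right mult.assoc
            mult_1_right)
    qed
    have Hm: "- ((1 - m)*gm) = m^2*(1 - Q*T*n*b0)*(1 - Q*T*n*b1)*(1 - Q*T*n*b2)*(1 - Q*T*n*b3) / ((m - Q*n)*(n - m))"
    proof -
      have "m*(1 - Q*T*n*b0) = -(1 - m)" using nz Q0 by (simp add: b al divide_simps)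
      hence eq: "m^2*(1 - Q*T*n*b0) = - ((1 - m)*m)" by algebra
      show ?thesis unfolding eq gm b(2-4)
        by (simp only: mult_minus_left minus_divide_left[symmetric] times_divide_eq_right mult.assoc
            mult_1_right)
    qed
    have xb: "x = m^2*n^2*Q^3*T^3*b0*b1*b2*b3"
    proof -
      have "x = (x*a1*a2*a3)*(b1*b2*b3)" using nz by (simp add: b)
      also have "\<dots> = (m*n*Q^2*T^2)*(al*b0)*(b1*b2*b3)" unfolding xa ab(1) by simp
      also have "\<dots> = m^2*n^2*Q^3*T^3*b0*b1*b2*b3" unfolding al by algebra
      finally show ?thesis .
    qed
    have "v k = C * ((1 - al*u^2) * (- (- ((1 - n)*gp)) * ((1 - m*u)*(1 - Q*m*u)*(1 - n*T*u)*(1 - Q*n*T*u))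
      + ((1 - T)*(x - 1) + (- ((1 - n)*gp)) - (- ((1 - m)*gm))) * ((1 - m*u)*(1 - n*u)*(1 - Q*n*T*u)*(1 - Q*m*T*u))
      + (- ((1 - m)*gm)) * ((1 - n*u)*(1 - Q*n*u)*(1 - m*T*u)*(1 - Q*m*T*u))))"
      unfolding v_def e0 e1 mult_minus_left e2 c_def by algebra
    also have "\<dots> = x * h (Suc k) - h k"
      unfolding pair_shift_fraction[OF ab neq(2,3,1) Q0 al xb Hp Hm, symmetric] hS hk by algebra
    finally show ?thesis .
  qed
  have "qcont q v x = ?cp * qcont q ?Up x + ?c0 * qcont q ?U0 x + (- ?cm) * qcont q ?Um x"
    unfolding v_def by (intro qcont_add3 q_analytic_vwp q x)
  moreover have "qcont q v x = - h 0" by (rule qcont_telescope[OF q h_an x step])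
  ultimately show ?thesis by (simp add: h_def)
qed

section \<open>The pair relation when one member of the pair is the base\<close>

text \<open>The case \<open>u = 1\<close> of \<open>pair_shift_identity\<close> with
  \<open>m = n*M\<close> and \<open>T = 1/n\<close>, after cancelling \<open>1 - n\<close>, which
  may be zero. The outer term with \<open>Yp\<close> carries a factor \<open>1 - u\<close> there, so
  \<open>Yp\<close> survives only in the middle coefficient.\<close>

lemma base_shift_identity_initial:
  fixes n q M :: complex
  assumes "G = (\<lambda>y. 1 + d1*y + d2*y^2 + d3*y^3 + q*d4*y^4)"
    and "D = (1 - q*M)*(M - q)*(1 - M)" and "Yp = G M * (M - q)" and "Ym = M^2 * (1 + d1 + d2 + d3 + q*d4) * (1 - q*M)"
  shows "(1 - q*n*M) * ((D*(n - 1)*(n*M^2*d4 - 1) + n*Yp - n*Ym)*(1 - q)*(1 - q*M)*(1 - n*M)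
      + n*Ym*(1 - q*n)*(1 - M)*(1 - q*M))
    = D*((n - 1)*(n*M^2*(q^3 + q^2*d1 + q*d2 + d3 + d4))*(1 - n*M) + G (n*M)*(1 - q)*(1 - q*M))"
  unfolding assms by algebra

text \<open>The bases differ by q^2 from one series to the next, and the indices are moved the
  opposite way: base q^4 w at k - 1, base q^2 w at k and base w at k + 1 share the factor 1 - q^2 w
  q^(2k). The condition \<open>xc\<close> is again x = q^2 \<alpha>^2 / (a_1 ... a_5), the same for
  all three.\<close>

lemma vwp_contiguous_base:
  fixes q :: real and Q w c1 c2 c3 c4 n mu x :: complex
  defines "Q \<equiv> complex_of_real q"
  assumes q: "0 < q" "q < 1" and x: "x \<notin> W87_poles q"
    and nz: "c1 \<noteq> 0" "c2 \<noteq> 0" "c3 \<noteq> 0" "c4 \<noteq> 0" "n \<noteq> 0" "mu \<noteq> 0"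
    and w: "w = n*mu" and xc: "x*(c1*c2*c3*c4) = Q*n*mu^2"
    and den: "\<And>k. qpoch q (Q*w/c1) k \<noteq> 0" "\<And>k. qpoch q (Q*w/c2) k \<noteq> 0" "\<And>k. qpoch q (Q*w/c3) k \<noteq> 0"
      "\<And>k. qpoch q (Q*w/c4) k \<noteq> 0" "\<And>k. qpoch q mu k \<noteq> 0"
    and w1: "1 - w \<noteq> 0" "1 - Q*w \<noteq> 0" "1 - Q*(Q*w) \<noteq> 0" "1 - Q*(Q*(Q*w)) \<noteq> 0"
    and c: "1 - c1 \<noteq> 0" "1 - c2 \<noteq> 0" "1 - c3 \<noteq> 0" "1 - c4 \<noteq> 0"
    and gp: "gp = - ((1 - Q*mu/c1)*(1 - Q*mu/c2)*(1 - Q*mu/c3)*(1 - Q*mu/c4)) / ((1 - Q*(Q*mu))*(1 - Q*mu))"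
    and gm: "gm = - (Q*mu^2*((1 - 1/c1)*(1 - 1/c2)*(1 - 1/c3)*(1 - 1/c4))) / ((1 - mu)*(1 - Q*mu))"
  shows "gp * (((1 - Q*c1)*(1 - Q*c2)*(1 - Q*c3)*(1 - Q*c4)) / ((1 - Q*(Q*w/c1))*(1 - Q*(Q*w/c2))*(1 - Q*(Q*w/c3))*(1 - Q*(Q*w/c4))))
      * ((1 - Q)*(1 - Q*(Q*w))*(1 - Q*(Q*(Q*w))) / (1 - Q*(Q*(Q*mu)))) * x
      * qcont q (vwp q (Q*(Q*(Q*(Q*w)))) [Q*(Q*(Q*(Q*w))), Q*(Q*c1), Q*(Q*c2), Q*(Q*c3), Q*(Q*c4), Q*n]) x
    + ((1 - 1/n)*(x - 1) - gp - gm) * ((1 - Q)*(1 - Q*(Q*mu)))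
      * qcont q (vwp q (Q*(Q*w)) [Q*(Q*w), Q*c1, Q*c2, Q*c3, Q*c4, Q*n]) x
    + gm * (((1 - Q*w/c1)*(1 - Q*w/c2)*(1 - Q*w/c3)*(1 - Q*w/c4)) / ((1 - c1)*(1 - c2)*(1 - c3)*(1 - c4)))
      * ((1 - Q)*(1 - mu)*(1 - Q*mu)*(1 - Q*(Q*mu)) / ((1 - w)*(1 - Q*w))) / x
      * qcont q (vwp q w [w, c1, c2, c3, c4, Q*n]) x = 0"
    (is "?cp * x * qcont q ?Tp x + ?c0 * qcont q ?T0 x + ?cm / x * qcont q ?Tm x = 0")
proof -
  have Q0: "Q \<noteq> 0" and w0: "w \<noteq> 0" using q nz by (auto simp: Q_def w)
  have x0: "x \<noteq> 0" using xc nz Q0 by auto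
  define g1 g2 g3 g4 where g: "g1 = Q*w/c1" "g2 = Q*w/c2" "g3 = Q*w/c3" "g4 = Q*w/c4"
  have args: "Q*w/w = Q" "Q*(Q*(Q*w))/(Q*(Q*w)) = Q" "Q*(Q*(Q*(Q*(Q*w))))/(Q*(Q*(Q*(Q*w)))) = Q"
    "Q*w/(Q*n) = mu" "Q*(Q*(Q*w))/(Q*n) = Q*(Q*mu)" "Q*(Q*(Q*(Q*(Q*w))))/(Q*n) = Q*(Q*(Q*(Q*mu)))"
    "Q*(Q*(Q*w))/(Q*c1) = Q*g1" "Q*(Q*(Q*w))/(Q*c2) = Q*g2" "Q*(Q*(Q*w))/(Q*c3) = Q*g3" "Q*(Q*(Q*w))/(Q*c4) = Q*g4"
    "Q*(Q*(Q*(Q*(Q*w))))/(Q*(Q*c1)) = Q*(Q*g1)" "Q*(Q*(Q*(Q*(Q*w))))/(Q*(Q*c2)) = Q*(Q*g2)"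
    "Q*(Q*(Q*(Q*(Q*w))))/(Q*(Q*c3)) = Q*(Q*g3)" "Q*(Q*(Q*(Q*(Q*w))))/(Q*(Q*c4)) = Q*(Q*g4)"
    using nz Q0 w0 by (simp_all add: w g)
  note den = den[folded g]
  define m where "m = Q*w"
  \<comment> \<open>With \<open>n*T = 1\<close> the member \<open>Q*m\<close> of the pair equals the
    base \<open>al\<close>. Its denominators (nT;q)_k, (qnT;q)_k and (q^2 nT;q)_k would become
    (1;q)_k, (q;q)_k and (q^2;q)_k; up to constants the last is (q;q)_(k+1), and the first is
    replaced by (q;q)_(k-1).\<close>
  define T where "T = 1/n"
  define al where "al = Q*m"
  have nT: "n*T = 1" "m*T = Q*mu" using nz by (simp_all add: T_def m_def w)
  define b1 b2 b3 b4 where b: "b1 = 1/(Q*c1)" "b2 = 1/(Q*c2)" "b3 = 1/(Q*c3)" "b4 = 1/(Q*c4)"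
  have ab: "(Q*c1)*b1 = 1" "(Q*c2)*b2 = 1" "(Q*c3)*b3 = 1" "(Q*c4)*b4 = 1" using nz Q0 by (simp_all add: b)
  have cb: "1/c1 = Q*b1" "1/c2 = Q*b2" "1/c3 = Q*b3" "1/c4 = Q*b4" using nz Q0 by (simp_all add: b)
  have gb: "g1 = al*b1" "g2 = al*b2" "g3 = al*b3" "g4 = al*b4" using nz Q0 by (simp_all add: b g al_def m_def)
  define X where "X = Q*Q"
  define Y where "Y = Q*(Q*(Q*mu))"
  have denQ: "qpoch q Q k \<noteq> 0" for k unfolding Q_def by (rule qpoch_q_nonzero[OF q])
  have mu1: "1 - mu \<noteq> 0" "1 - Q*mu \<noteq> 0" "1 - Q*(Q*mu) \<noteq> 0" "1 - Q*(Q*(Q*mu)) \<noteq> 0"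
    using qpoch_shift_nonzero(3)[OF den(5), of 0] qpoch_shift_nonzero(3)[OF den(5), of 1]
      qpoch_shift_nonzero(3)[OF den(5), of 2] qpoch_shift_nonzero(3)[OF den(5), of 3]
    by (simp_all add: Q_def power2_eq_square power3_eq_cube mult_ac)
  have denmu: "qpoch q (Q*mu) k \<noteq> 0" "qpoch q (Q*(Q*mu)) k \<noteq> 0" "qpoch q Y k \<noteq> 0" "qpoch q (Q*Y) k \<noteq> 0" for k
    using den(5) unfolding Y_def Q_def by (auto intro!: qpoch_shift_nonzero(1))
  have X0: "qpoch q X k \<noteq> 0" for k
    using denQ unfolding X_def Q_def by (auto intro!: qpoch_shift_nonzero(1))
  have deng: "qpoch q (Q*g1) k \<noteq> 0" "qpoch q (Q*g2) k \<noteq> 0" "qpoch q (Q*g3) k \<noteq> 0" "qpoch q (Q*g4) k \<noteq> 0" for k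
    using den unfolding Q_def by (auto intro!: qpoch_shift_nonzero(1))
  have g1: "1 - g1 \<noteq> 0" "1 - g2 \<noteq> 0" "1 - g3 \<noteq> 0" "1 - g4 \<noteq> 0"
    using qpoch_shift_nonzero(2) den by blast+
  have Q1: "1 - Q \<noteq> 0" using denQ[of 1] by (simp add: qpoch_def)
  define P where "P j = qpoch q (Q*m) j * qpoch q (Q*n) j" for j
  define N where "N k = qpoch q (Q*c1) k * qpoch q (Q*c2) k * qpoch q (Q*c3) k * qpoch q (Q*c4) k" for k
  define E where "E k = qpoch q (Q*g1) k * qpoch q (Q*g2) k * qpoch q (Q*g3) k * qpoch q (Q*g4) k" for k
  have E0: "E k \<noteq> 0" for k unfolding E_def using deng by auto
  \<comment> \<open>\<open>h0\<close> compensates the term of index \<open>-1\<close> of the shifted series \<open>?Tm\<close>.\<close>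
  define h0 where "h0 = ?cm * (1 - w) / x"
  define h where "h k = (case k of 0 \<Rightarrow> h0 | Suc j \<Rightarrow> (1 - T) * N k * P j / (E j * qpoch q X j * qpoch q Y j))" for k
  have h_an: "q_analytic q h"
  proof -
    have "q_analytic q (\<lambda>j. h (Suc j))"
      unfolding h_def nat.case N_def P_def E_def divide_inverse inverse_mult_distrib
      by (intro q_analytic_mult q_analytic_const q_analytic_qpoch q_analytic_inverse_qpoch q
          iffD2[OF q_analytic_Suc_iff[OF q(1)]])
    thus ?thesis using q_analytic_Suc_iff[OF q(1)] by blast
  qed
  \<comment> \<open>Raising the index multiplies the generating function by \<open>x\<close>;
    lowering it drops the term of index 0 and divides by \<open>x\<close>. This is the origin of the
    factors \<open>x\<close> and \<open>1/x\<close> in the statement.\<close>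
  define Up where "Up k = (case k of 0 \<Rightarrow> 0 | Suc j \<Rightarrow> ?Tp j)" for k
  define Um where "Um k = ?Tm (Suc k)" for k
  have Up_an: "q_analytic q Up"
    using q_analytic_Suc_iff[OF q(1), of Up] q_analytic_vwp[OF q] by (simp add: Up_def)
  have Um_an: "q_analytic q Um"
    unfolding Um_def by (rule iffD2[OF q_analytic_Suc_iff[OF q(1)]]) (rule q_analytic_vwp[OF q])
  define v where "v k = ?cp * Up k + ?c0 * ?T0 k + ?cm * Um k" for k
  have xb: "x = m^2*n^2*Q^3*T^3*b1*b2*b3*b4"
  proof -
    have "x = (x*(c1*c2*c3*c4)) * ((1/c1)*(1/c2)*(1/c3)*(1/c4))" using nz by simp
    also have "\<dots> = (n*T)^3 * (Q*n*mu^2) * ((Q*b1)*(Q*b2)*(Q*b3)*(Q*b4))" unfolding xc cb nT by simp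
    also have "\<dots> = m^2*n^2*Q^3*T^3*b1*b2*b3*b4" unfolding m_def w by algebra
    finally show ?thesis .
  qed
  have dn: "n - Q*m = n*(1 - Q*(Q*mu))" "m - Q*n = - (Q*n*(1 - mu))" "n - m = n*(1 - Q*mu)"
    by (simp_all add: m_def w algebra_simps)
  have neq: "n - Q*m \<noteq> 0" "m - Q*n \<noteq> 0" "n - m \<noteq> 0"
    unfolding dn using nz Q0 mu1 by simp_all
  have TM: "Q*T*m*b = (m*T)*(Q*b)" "Q*T*n*b = (n*T)*(Q*b)" for b by (simp_all add: mult_ac)
  have Hp: "- gp = n^2*(1 - Q*T*m*b1)*(1 - Q*T*m*b2)*(1 - Q*T*m*b3)*(1 - Q*T*m*b4) / ((n - Q*m)*(n - m))"
  proof -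
    have "- gp = ((1 - Q*mu*(1/c1))*(1 - Q*mu*(1/c2))*(1 - Q*mu*(1/c3))*(1 - Q*mu*(1/c4))) / ((1 - Q*(Q*mu))*(1 - Q*mu))"
      by (simp add: gp)
    also have "\<dots> = n^2*((1 - Q*mu*(1/c1))*(1 - Q*mu*(1/c2))*(1 - Q*mu*(1/c3))*(1 - Q*mu*(1/c4))) / (n^2*((1 - Q*(Q*mu))*(1 - Q*mu)))"
      using nz by simp
    finally show ?thesis unfolding cb dn TM nT by (simp add: power2_eq_square mult_ac)
  qed
  have Hm: "gm = m^2*(1 - Q*T*n*b1)*(1 - Q*T*n*b2)*(1 - Q*T*n*b3)*(1 - Q*T*n*b4) / ((m - Q*n)*(n - m))"
  proof -
    have "gm = (- (Q*n^2)) * (Q*mu^2*((1 - 1/c1)*(1 - 1/c2)*(1 - 1/c3)*(1 - 1/c4))) / ((Q*n^2)*((1 - mu)*(1 - Q*mu)))"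
      using nz Q0 by (simp add: gm)
    also have "\<dots> = m^2*((1 - 1/c1)*(1 - 1/c2)*(1 - 1/c3)*(1 - 1/c4)) / (- ((Q*n^2)*((1 - mu)*(1 - Q*mu))))"
      by (simp add: m_def w power2_eq_square mult_ac)
    also have "- ((Q*n^2)*((1 - mu)*(1 - Q*mu))) = (m - Q*n)*(n - m)"
      unfolding dn by (simp add: power2_eq_square mult_ac)
    finally show ?thesis unfolding cb TM nT by (simp add: mult.assoc)
  qed
  have shift_ratio: "(1 - g) / (1 - c) * (qpoch q c (Suc k) / qpoch q g (Suc k)) = qpoch q (Q*c) k / qpoch q (Q*g) k"
    if "1 - c \<noteq> 0" "1 - g \<noteq> 0" for c g k
    using that by (simp add: qpoch_Suc_shift Q_def)
  note sr = shift_ratio[OF c(1) g1(1)] shift_ratio[OF c(2) g1(2)] shift_ratio[OF c(3) g1(3)] shift_ratio[OF c(4) g1(4)]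
  have cmUm: "?cm * Um k = gm * (1 - al*(Q^k)^2) * (N k / E k) * (qpoch q w (Suc k) / ((1 - w)*(1 - Q*w))) * ((1 - Q) / qpoch q Q (Suc k))
      * qpoch q (Q*n) (Suc k) * ((1 - mu)*(1 - Q*mu)*(1 - Q*(Q*mu)) / qpoch q mu (Suc k))" for k
  proof -
    have "w * (Q ^ Suc k)^2 = al*(Q^k)^2" by (simp add: al_def m_def power2_eq_square mult_ac)
    hence "?cm * Um k = gm * (1 - al*(Q^k)^2)
      * ((1 - g1)/(1 - c1) * (qpoch q c1 (Suc k) / qpoch q g1 (Suc k))) * ((1 - g2)/(1 - c2) * (qpoch q c2 (Suc k) / qpoch q g2 (Suc k)))
      * ((1 - g3)/(1 - c3) * (qpoch q c3 (Suc k) / qpoch q g3 (Suc k))) * ((1 - g4)/(1 - c4) * (qpoch q c4 (Suc k) / qpoch q g4 (Suc k)))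
      * (qpoch q w (Suc k) / ((1 - w)*(1 - Q*w))) * ((1 - Q) / qpoch q Q (Suc k))
      * qpoch q (Q*n) (Suc k) * ((1 - mu)*(1 - Q*mu)*(1 - Q*(Q*mu)) / qpoch q mu (Suc k))"
      unfolding Um_def vwp_def list.map prod_list.Cons prod_list.Nil Q_def[symmetric] args g[symmetric]
      by (simp only: divide_inverse inverse_mult_distrib mult_ac mult_1_right mult_1_left)
    thus ?thesis unfolding sr by (simp add: N_def E_def divide_inverse mult_ac)
  qed
  have step: "v k = x * h (Suc k) - h k" for k
  proof (cases k)
    case 0
    define M where "M = Q*mu"
    define d1 d2 d3 d4 where d: "d1 = - Q*(b1+b2+b3+b4)" "d2 = Q^2*(b1*b2+b1*b3+b1*b4+b2*b3+b2*b4+b3*b4)"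
      "d3 = - (Q^3*(b1*b2*b3+b1*b2*b4+b1*b3*b4+b2*b3*b4))" "d4 = Q^3*(b1*b2*b3*b4)"
    define G where "G y = 1 + d1*y + d2*y^2 + d3*y^3 + Q*d4*y^4" for y
    have Gf: "G = (\<lambda>y. 1 + d1*y + d2*y^2 + d3*y^3 + Q*d4*y^4)" by (rule ext) (rule G_def)
    define D where "D = (1 - Q*M)*(M - Q)*(1 - M)"
    have MQ: "M - Q = - (Q*(1 - mu))" by (simp add: M_def algebra_simps)
    have D0: "D \<noteq> 0" unfolding D_def MQ using Q0 mu1 by (simp add: M_def)
    have G: "(1 - y*(Q*b1))*(1 - y*(Q*b2))*(1 - y*(Q*b3))*(1 - y*(Q*b4)) = G y" for y
      unfolding G_def d by algebra
    have Yp: "D*(- gp) = G M * (M - Q)"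
    proof -
      have "- gp = G M / ((1 - Q*M)*(1 - M))"
        unfolding G[symmetric] cb[symmetric] by (simp add: gp M_def)
      thus ?thesis using mu1 by (simp add: D_def M_def)
    qed
    have Ym: "D*gm = M^2 * (1 + d1 + d2 + d3 + Q*d4) * (1 - Q*M)"
    proof -
      have "(1 - 1/c1)*(1 - 1/c2)*(1 - 1/c3)*(1 - 1/c4) = G 1"
        unfolding G[symmetric] cb by simp
      hence gm': "gm = - (Q*mu^2*G 1) / ((1 - mu)*(1 - Q*mu))" by (simp add: gm)
      have "D*gm = Q*Q*mu^2*G 1*(1 - Q*M)"
        unfolding gm' D_def MQ using mu1 by (simp add: M_def)
      thus ?thesis by (simp add: G_def M_def power2_eq_square mult_ac)
    qed
    have xd: "n*M^2*d4 = x" unfolding xb M_def d m_def w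
    proof -
      have "n*(Q*mu)^2*(Q^3*(b1*b2*b3*b4)) = (n*T)^3*(n*(Q*mu)^2*(Q^3*(b1*b2*b3*b4)))" unfolding nT by simp
      also have "\<dots> = (Q*(n*mu))^2*n^2*Q^3*T^3*b1*b2*b3*b4" by algebra
      finally show "n*(Q*mu)^2*(Q^3*(b1*b2*b3*b4)) = (Q*(n*mu))^2*n^2*Q^3*T^3*b1*b2*b3*b4" .
    qed
    have xP: "n*M^2*(Q^3 + Q^2*d1 + Q*d2 + d3 + d4) = x*((1 - Q*c1)*(1 - Q*c2)*(1 - Q*c3)*(1 - Q*c4))"
    proof -
      have r: "b1 * (1 - Q*c1) = b1 - 1" "b2 * (1 - Q*c2) = b2 - 1" "b3 * (1 - Q*c3) = b3 - 1" "b4 * (1 - Q*c4) = b4 - 1"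
        using ab by algebra+
      have "x*((1 - Q*c1)*(1 - Q*c2)*(1 - Q*c3)*(1 - Q*c4))
          = n*M^2*Q^3*((b1 * (1 - Q*c1)) * (b2 * (1 - Q*c2)) * (b3 * (1 - Q*c3)) * (b4 * (1 - Q*c4)))"
        unfolding xd[symmetric] d by algebra
      also have "\<dots> = n*M^2*(Q^3 + Q^2*d1 + Q*d2 + d3 + d4)" unfolding r d by algebra
      finally show ?thesis by simp
    qed
    have gP: "G (n*M) = (1 - g1)*(1 - g2)*(1 - g3)*(1 - g4)"
      unfolding G[symmetric] gb by (simp add: al_def m_def w M_def mult_ac)
    have nM: "n*M = Q*w" "Q*n*M = al" by (simp_all add: M_def w al_def m_def)
    have "D * ((1 - al) * (((n - 1)*(x - 1) - n*gp - n*gm)*(1 - Q)*(1 - Q*M)*(1 - Q*w) + n*gm*(1 - Q*n)*(1 - M)*(1 - Q*M)))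
        = (1 - Q*n*M) * ((D*(n - 1)*(n*M^2*d4 - 1) + n*(D*(- gp)) - n*(D*gm))*(1 - Q)*(1 - Q*M)*(1 - n*M)
           + n*(D*gm)*(1 - Q*n)*(1 - M)*(1 - Q*M))"
      unfolding xd nM by algebra
    also have "\<dots> = D*((n - 1)*(n*M^2*(Q^3 + Q^2*d1 + Q*d2 + d3 + d4))*(1 - n*M) + G (n*M)*(1 - Q)*(1 - Q*M))"
      by (rule base_shift_identity_initial[OF Gf D_def Yp Ym])
    finally have id: "(1 - al) * (((n - 1)*(x - 1) - n*gp - n*gm)*(1 - Q)*(1 - Q*M)*(1 - Q*w) + n*gm*(1 - Q*n)*(1 - M)*(1 - Q*M))
        = (n - 1)*(x*((1 - Q*c1)*(1 - Q*c2)*(1 - Q*c3)*(1 - Q*c4)))*(1 - Q*w) + ((1 - g1)*(1 - g2)*(1 - g3)*(1 - g4))*(1 - Q)*(1 - Q*M)"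
      unfolding xP nM gP[unfolded nM] by (rule iffD1[OF mult_left_cancel[OF D0]])
    have Um0: "n*(1 - Q*w)*(?cm * Um 0) = (1 - al)*(n*gm*(1 - Q*n)*(1 - M)*(1 - Q*M))"
      unfolding cmUm using w1 Q1 mu1 by (simp add: qpoch_Suc N_def E_def M_def)
    have h0': "n*(1 - Q*w)*h0 = - (((1 - g1)*(1 - g2)*(1 - g3)*(1 - g4))*(1 - Q)*(1 - Q*M))"
    proof -
      have cc: "(1 - 1/c1)*(1 - 1/c2)*(1 - 1/c3)*(1 - 1/c4) = ((1 - c1)*(1 - c2)*(1 - c3)*(1 - c4)) / (c1*c2*c3*c4)"
        using nz by (simp add: field_simps)
      have xn: "x * (c1*c2*c3*c4) \<noteq> 0" using x0 nz by simp
      define cP where "cP = (1 - c1)*(1 - c2)*(1 - c3)*(1 - c4)"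
      define gG where "gG = (1 - g1)*(1 - g2)*(1 - g3)*(1 - g4)"
      define cc4 where "cc4 = c1*c2*c3*c4"
      have cP0: "cP \<noteq> 0" using c by (simp add: cP_def)
      have "n*(1 - Q*w)*h0 = n*(1 - Q*w)*((- (Q*mu^2*(cP/cc4)) / ((1 - mu)*(1 - Q*mu))) * (gG/cP)
          * ((1 - Q)*(1 - mu)*(1 - Q*mu)*(1 - Q*(Q*mu)) / ((1 - w)*(1 - Q*w))) * (1 - w) / x)"
        unfolding h0_def gm cc cP_def gG_def cc4_def g[symmetric] by simp
      also have "\<dots> = - ((Q*n*mu^2) * gG*(1 - Q)*(1 - Q*(Q*mu))) / (x*cc4)"
        using mu1 w1 cP0 by (simp add: divide_simps)
      also have "\<dots> = - (gG*(1 - Q)*(1 - Q*(Q*mu)))"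
        using xn unfolding xc[symmetric] cc4_def by simp
      finally show ?thesis by (simp add: gG_def M_def)
    qed
    have "n*(1 - Q*w)*(v 0) = (1 - al) * (((n - 1)*(x - 1) - n*gp - n*gm)*(1 - Q)*(1 - Q*M)*(1 - Q*w) + n*gm*(1 - Q*n)*(1 - M)*(1 - Q*M))"
    proof -
      have e: "n*(1 - 1/n) = n - 1" using nz by (simp add: right_diff_distrib)
      have "n*(1 - Q*w)*(?c0 * ?T0 0) = (1 - al) * (((n*(1 - 1/n))*(x - 1) - n*gp - n*gm)*(1 - Q)*(1 - Q*M)*(1 - Q*w))"
        by (simp add: vwp_def al_def m_def M_def) algebra
      thus ?thesis using Um0 unfolding e v_def by (simp add: Up_def distrib_left)
    qed
    also have "\<dots> = n*(1 - Q*w)*(x * h (Suc 0) - h0)"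
    proof -
      have nT1: "n*(1 - T) = n - 1" using nT by (simp add: right_diff_distrib)
      have xh: "x * h (Suc 0) = (1 - T) * (x*((1 - Q*c1)*(1 - Q*c2)*(1 - Q*c3)*(1 - Q*c4)))"
        by (simp add: h_def N_def P_def E_def qpoch_def)
      have "n*(1 - Q*w)*(x * h (Suc 0)) = (n*(1 - T))*(x*((1 - Q*c1)*(1 - Q*c2)*(1 - Q*c3)*(1 - Q*c4)))*(1 - Q*w)"
        unfolding xh by (simp only: mult_ac)
      hence xhn: "n*(1 - Q*w)*(x * h (Suc 0)) = (n - 1)*(x*((1 - Q*c1)*(1 - Q*c2)*(1 - Q*c3)*(1 - Q*c4)))*(1 - Q*w)"
        unfolding nT1 .
      show ?thesis unfolding id right_diff_distrib[of _ "x * h (Suc 0)"] h0' xhn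
        by (simp only: diff_minus_eq_add)
    qed
    finally have "v 0 = x * h (Suc 0) - h0"
      by (rule iffD1[OF mult_left_cancel, rotated]) (use nz w1 in simp)
    thus ?thesis by (simp add: 0 h_def)
  next
    case (Suc j)
    define u where "u = Q ^ k"
    have uj: "Q * Q ^ j = u" by (simp add: u_def Suc)
    define C where "C = N k / E k * P j / (qpoch q X k * qpoch q Y k)"
    \<comment> \<open>The factors \<open>1 - u\<close> and \<open>1 - Q*u\<close> of the upper term
      are those that turn 1/(q;q)_(k-1) of the shifted series into the common denominator, as
      \<open>r4\<close> shows.\<close>
    have f: "1 - n*T*u = 1 - u" "1 - Q*n*T*u = 1 - Q*u" "1 - m*T*u = 1 - Q*mu*u" "1 - Q*m*T*u = 1 - Q*(Q*mu)*u"
      using nT by (simp_all add: mult.assoc[of Q])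
    have p1: "(1 - Q*(Q*w))*(1 - Q*(Q*(Q*w))) * qpoch q (Q*(Q*(Q*(Q*w)))) j = qpoch q (Q*m) j * (1 - m*u) * (1 - Q*m*u)"
    proof -
      have "qpoch q (Q*m) (Suc (Suc j)) = (1 - Q*(Q*w))*(1 - Q*(Q*(Q*w))) * qpoch q (Q*(Q*(Q*(Q*w)))) j"
        by (simp only: qpoch_Suc_shift Q_def[symmetric] m_def mult.assoc)
      moreover have "qpoch q (Q*m) (Suc (Suc j)) = qpoch q (Q*m) j * (1 - m*u) * (1 - Q*m*u)"
        by (simp add: qpoch_Suc Q_def[symmetric] uj[symmetric] mult_ac)
      ultimately show ?thesis by simp
    qed
    have p2: "qpoch q (Q*n) (Suc k) = qpoch q (Q*n) j * (1 - n*u) * (1 - Q*n*u)"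
      by (simp add: Suc qpoch_Suc Q_def[symmetric] uj[symmetric] mult_ac)
    have p3: "qpoch q w (Suc k) / ((1 - w)*(1 - Q*w)) = qpoch q (Q*m) j"
      using w1 by (simp add: Suc qpoch_Suc_shift Q_def[symmetric] m_def)
    have p4: "qpoch q (Q*(Q*w)) k = qpoch q (Q*m) j * (1 - m*u)" "qpoch q (Q*n) k = qpoch q (Q*n) j * (1 - n*u)"
      by (simp_all add: Suc qpoch_Suc Q_def[symmetric] uj[symmetric] m_def mult_ac)
    have r: "(1 - y) / qpoch q y k = (1 - y*u) / qpoch q (Q*y) k" if "\<And>k. qpoch q y k \<noteq> 0" for y
      using qpoch_inverse_shift[OF that, of k] by (simp add: Q_def u_def)
    have r1: "(1 - Q) / qpoch q Q k = (1 - Q*u) / qpoch q X k" using r[OF denQ] by (simp add: X_def)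
    have r2: "(1 - Q*(Q*mu)) / qpoch q (Q*(Q*mu)) k = (1 - Q*(Q*mu)*u) / qpoch q Y k"
      using r[OF denmu(2)] by (simp add: Y_def)
    have r3: "(1 - mu)*(1 - Q*mu)*(1 - Q*(Q*mu)) / qpoch q mu (Suc k) = (1 - Q*mu*u)*(1 - Q*(Q*mu)*u) / qpoch q Y k"
    proof -
      have "(1 - mu)*(1 - Q*mu)*(1 - Q*(Q*mu)) / qpoch q mu (Suc k) = (1 - Q*(Q*mu)) * ((1 - Q*mu) / qpoch q (Q*mu) k)"
        using mu1 by (simp add: qpoch_Suc_shift Q_def[symmetric])
      also have "\<dots> = (1 - Q*mu*u) * ((1 - Q*(Q*mu)) / qpoch q (Q*(Q*mu)) k)" unfolding r[OF denmu(1)] by simp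
      finally show ?thesis unfolding r2 by simp
    qed
    have r4: "(1 - Q) / qpoch q Q j = (1 - u)*(1 - Q*u) / qpoch q X k"
    proof -
      have "qpoch q Q (Suc k) = (1 - Q) * qpoch q X k" by (simp add: qpoch_Suc_shift Q_def[symmetric] X_def)
      moreover have "qpoch q Q (Suc k) = qpoch q Q j * (1 - u) * (1 - Q*u)"
        by (simp add: Suc qpoch_Suc Q_def[symmetric] uj[symmetric])
      ultimately show ?thesis using denQ[of j] X0[of k] by (simp add: frac_eq_eq mult_ac)
    qed
    have r5: "(1 - Q) / qpoch q Q (Suc k) = 1 / qpoch q X k"
      using Q1 by (simp add: qpoch_Suc_shift Q_def[symmetric] X_def)
    have NE: "N k / E k = ((1 - Q*c1)*(1 - Q*c2)*(1 - Q*c3)*(1 - Q*c4)) / ((1 - Q*g1)*(1 - Q*g2)*(1 - Q*g3)*(1 - Q*g4))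
        * ((qpoch q (Q*(Q*c1)) j * qpoch q (Q*(Q*c2)) j * qpoch q (Q*(Q*c3)) j * qpoch q (Q*(Q*c4)) j)
         / (qpoch q (Q*(Q*g1)) j * qpoch q (Q*(Q*g2)) j * qpoch q (Q*(Q*g3)) j * qpoch q (Q*(Q*g4)) j))"
      unfolding N_def E_def Suc qpoch_Suc_shift Q_def[symmetric] by (simp add: divide_inverse mult_ac)
    have Yk': "qpoch q Y k = (1 - Q*(Q*(Q*mu))) * qpoch q (Q*(Q*(Q*(Q*mu)))) j"
      by (simp add: Suc qpoch_Suc_shift Q_def[symmetric] Y_def)
    have alu: "Q*(Q*(Q*(Q*w)))*(Q^j)^2 = al*u^2"
      by (simp add: al_def m_def uj[symmetric] power2_eq_square mult_ac)
    have "?cp * Up k = (1 - al*u^2) * gp * (N k / E k)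
        * ((1 - Q*(Q*w))*(1 - Q*(Q*(Q*w))) * qpoch q (Q*(Q*(Q*(Q*w)))) j) * ((1 - Q) / qpoch q Q j)
        * qpoch q (Q*n) j / qpoch q Y k"
      unfolding Up_def Suc nat.case vwp_def list.map prod_list.Cons prod_list.Nil Q_def[symmetric] args alu g[symmetric]
      unfolding NE[unfolded Suc] Yk'[unfolded Suc]
      by (simp only: divide_inverse inverse_mult_distrib mult_ac mult_1_right mult_1_left)
    also have "\<dots> = (1 - al*u^2) * C * (gp * ((1 - m*u)*(1 - Q*m*u)*(1 - u)*(1 - Q*u)))"
      unfolding p1 r4 by (simp add: C_def P_def divide_inverse mult_ac)
    finally have e1: "?cp * Up k = \<dots>" .
    have "?cm * Um k = gm * (1 - al*u^2) * (N k / E k) * qpoch q (Q*m) j * (1 / qpoch q X k)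
      * (qpoch q (Q*n) j * (1 - n*u) * (1 - Q*n*u)) * ((1 - Q*mu*u)*(1 - Q*(Q*mu)*u) / qpoch q Y k)"
      unfolding cmUm r3 r5 p2 p3 u_def[symmetric] by simp
    hence e2: "?cm * Um k = (1 - al*u^2) * C * (gm * ((1 - n*u)*(1 - Q*n*u)*(1 - Q*mu*u)*(1 - Q*(Q*mu)*u)))"
      by (simp add: C_def P_def divide_inverse mult_ac)
    define c where "c = (1 - T)*(x - 1) - gp - gm"
    have "?c0 * ?T0 k = (1 - al*u^2) * (N k / E k) * c * qpoch q (Q*(Q*w)) k * qpoch q (Q*n) k
        * ((1 - Q) / qpoch q Q k) * ((1 - Q*(Q*mu)) / qpoch q (Q*(Q*mu)) k)"
      unfolding vwp_def list.map prod_list.Cons prod_list.Nil Q_def[symmetric] args T_def[symmetric] c_def[symmetric]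
        u_def[symmetric] al_def m_def N_def E_def
      by (simp only: divide_inverse inverse_mult_distrib mult_ac mult_1_right mult_1_left)
    also have "\<dots> = (1 - al*u^2) * C * (c * ((1 - m*u)*(1 - n*u)*(1 - Q*u)*(1 - Q*(Q*mu)*u)))"
      unfolding p4 r1 r2 by (simp add: C_def P_def divide_inverse mult_ac)
    finally have e0: "?c0 * ?T0 k = \<dots>" .
    have ab': "Q*g1 * Q^j = al*b1*u" "Q*g2 * Q^j = al*b2*u" "Q*g3 * Q^j = al*b3*u" "Q*g4 * Q^j = al*b4*u"
      by (simp_all add: gb uj[symmetric])
    have hS: "x * h (Suc k) = C * ((1 - T) * (x * ((1 - Q*c1*u)*(1 - Q*c2*u)*(1 - Q*c3*u)*(1 - Q*c4*u)) * (1 - m*u)*(1 - n*u)))"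
      unfolding h_def nat.case P_def[of k] p4[folded m_def] N_def[of "Suc k"] qpoch_Suc Q_def[symmetric] u_def[symmetric] C_def
      by (simp add: P_def N_def divide_inverse mult_ac)
    have Ek: "E k = E j * ((1 - al*b1*u)*(1 - al*b2*u)*(1 - al*b3*u)*(1 - al*b4*u))"
      unfolding E_def Suc qpoch_Suc Q_def[symmetric] ab' by (simp add: mult_ac)
    have Xk: "qpoch q X k = qpoch q X j * (1 - Q*u)" "qpoch q Y k = qpoch q Y j * (1 - Q*(Q*mu)*u)"
      by (simp_all add: Suc qpoch_Suc Q_def[symmetric] uj[symmetric] X_def Y_def mult_ac)
    have hk: "h k = C * ((1 - T) * ((1 - al*b1*u)*(1 - al*b2*u)*(1 - al*b3*u)*(1 - al*b4*u) * (1 - Q*u)*(1 - Q*(Q*mu)*u)))"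
    proof -
      have "h k = (1 - T) * N k * P j / (E j * qpoch q X j * qpoch q Y j)" by (simp add: h_def Suc)
      also have "\<dots> = (1 - T) * (N k / E k) * P j / (qpoch q X k * qpoch q Y k)
          * ((1 - al*b1*u)*(1 - al*b2*u)*(1 - al*b3*u)*(1 - al*b4*u) * (1 - Q*u)*(1 - Q*(Q*mu)*u))"
        using E0[of k] X0[of k] denmu(3)[of k] unfolding Ek Xk by (simp add: divide_simps)
      finally show ?thesis by (simp add: C_def mult_ac)
    qed
    have alT: "al = Q*m*n*T" using nT by (simp add: al_def mult.assoc)
    have "v k = C * ((1 - al*u^2) * (- (- gp) * ((1 - m*u)*(1 - Q*m*u)*(1 - u)*(1 - Q*u))
      + ((1 - T)*(x - 1) + (- gp) - gm) * ((1 - m*u)*(1 - n*u)*(1 - Q*u)*(1 - Q*(Q*mu)*u))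
      + gm * ((1 - n*u)*(1 - Q*n*u)*(1 - Q*mu*u)*(1 - Q*(Q*mu)*u))))"
      unfolding v_def e0 e1 e2 c_def by algebra
    also have "\<dots> = x * h (Suc k) - h k"
      unfolding pair_shift_fraction[OF ab neq Q0 alT xb Hp Hm, of u, unfolded f, symmetric] hS hk by algebra
    finally show ?thesis .
  qed
  have "qcont q v x = ?cp * qcont q Up x + ?c0 * qcont q ?T0 x + ?cm * qcont q Um x"
    unfolding v_def by (intro qcont_add3 q_analytic_vwp Up_an Um_an q x)
  moreover have "qcont q v x = - h0" using qcont_telescope[OF q h_an x step] by (simp add: h_def)
  moreover have "qcont q Up x = x * qcont q ?Tp x" using qcont_Suc[OF q Up_an x] by (simp add: Up_def)
  moreover have "qcont q Um x = (qcont q ?Tm x - (1 - w)) / x"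
  proof -
    have "qcont q ?Tm x = ?Tm 0 + x * qcont q Um x"
      using qcont_Suc[OF q q_analytic_vwp[OF q] x] by (simp only: Um_def[abs_def])
    thus ?thesis using x0 by (simp add: vwp_def)
  qed
  ultimately have "?cp * (x * qcont q ?Tp x) + ?c0 * qcont q ?T0 x + ?cm * ((qcont q ?Tm x - (1 - w)) / x) = - h0"
    by (simp only:)
  moreover have "p * x * A + r * B + s / x * D = 0"
    if "p * (x * A) + r * B + s * ((D - (1 - w)) / x) = - (s * (1 - w) / x)" for p A r B s D :: complex
  proof -
    have "s * ((D - (1 - w)) / x) = s / x * D - s * (1 - w) / x" by (simp add: diff_divide_distrib right_diff_distrib)
    thus ?thesis using that by (simp add: mult.assoc add.assoc)
  qed
  ultimately show ?thesis unfolding h0_def by blast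
qed

section \<open>Contiguous relations in which base and argument both move\<close>

text \<open>When one of the four quantities is \<open>r\<close>, the product over pairs splits into
  the three pairs containing \<open>r\<close> and the three others. In
  \<open>vwp_contiguous_four\<close> only the latter appear as a coefficient; the former are
  produced by the numerators of the least shifted series.\<close>

lemma four_shift_res_factor:
  "four_shift_res (r + k1) (r*k1 + k2) (r*k2 + k3) (r*k3) = (1 - r*k1 + r^2*k2 - r^3*k3) * (1 - k2 + k1*k3 - k3^2)"
  unfolding four_shift_res_def by algebra

text \<open>The fourth quantity is \<open>r\<close> itself, since the base is \<open>r*r\<close>.
  Base and the parameters \<open>r*A_i\<close> scale alike, so the denominators
  \<open>Q*(r/A_i)\<close> are the same in all three series, and only those of the fixed pair move.
  By \<open>yE\<close> every one of the three arguments is q^2 \<alpha>^2 / (a_1 ... a_5); weights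
  q^k and q^(2k) bring them to the common argument \<open>y\<close>.\<close>

lemma vwp_contiguous_four:
  fixes q :: real and Q r A1 A2 A3 F G y :: complex
  defines "Q \<equiv> complex_of_real q"
  assumes q: "0 < q" "q < 1" and y: "y \<notin> W87_poles q"
    and nz: "r \<noteq> 0" "A1 \<noteq> 0" "A2 \<noteq> 0" "A3 \<noteq> 0" "F \<noteq> 0" "G \<noteq> 0"
    and k: "k1 = A1 + A2 + A3" "k2 = A1*A2 + A1*A3 + A2*A3" "k3 = A1*A2*A3"
    and E: "E1 = r + k1" "E2 = r*k1 + k2" "E3 = r*k2 + k3" "E4 = r*k3"
    and yE: "y * (Q^2*E4) = F*G"
    and den: "\<And>k. qpoch q (Q*(r/A1)) k \<noteq> 0" "\<And>k. qpoch q (Q*(r/A2)) k \<noteq> 0" "\<And>k. qpoch q (Q*(r/A3)) k \<noteq> 0"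
      "\<And>k. qpoch q (r*F) k \<noteq> 0" "\<And>k. qpoch q (r*G) k \<noteq> 0" and r1: "1 - r^2 \<noteq> 0"
  shows "- (Q^2*(Q^2*E4 - 1)*(1 - k2 + k1*k3 - k3^2)) * r^2 * ((1 - r*F)*(1 - Q*(r*F))*(1 - r*G)*(1 - Q*(r*G))) / (1 - r^2)
        * qcont q (vwp q (r^2) [r^2, r*A1, r*A2, r*A3, Q*r/F, Q*r/G]) (Q*(Q*y))
    + four_shift_mid Q E1 E3 E4 F G * r * ((1 - Q*(r*F))*(1 - Q*(r*G)))
        * qcont q (vwp q (Q*r^2) [Q*r^2, Q*(r*A1), Q*(r*A2), Q*(r*A3), Q*r/F, Q*r/G]) (Q*y)
    + (F*G - Q^2*E4)*(F*G - 1)*(E4 - 1) * ((1 - Q*r^2)*(1 - Q*(r*A1))*(1 - Q*(r*A2))*(1 - Q*(r*A3)))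
        * qcont q (vwp q (Q*(Q*r^2)) [Q*(Q*r^2), Q*(Q*(r*A1)), Q*(Q*(r*A2)), Q*(Q*(r*A3)), Q*r/F, Q*r/G]) y = 0"
    (is "?cp * qcont q ?Tp (Q*(Q*y)) + ?c0 * qcont q ?T0 (Q*y) + ?cm * qcont q ?Tm y = 0")
proof -
  have Q0: "Q \<noteq> 0" using q by (auto simp: Q_def)
  have args: "Q*r^2/r^2 = Q" "Q*(Q*r^2)/(Q*r^2) = Q" "Q*(Q*(Q*r^2))/(Q*(Q*r^2)) = Q"
    "Q*r^2/(Q*r/F) = r*F" "Q*(Q*r^2)/(Q*r/F) = Q*(r*F)" "Q*(Q*(Q*r^2))/(Q*r/F) = Q*(Q*(r*F))"
    "Q*r^2/(Q*r/G) = r*G" "Q*(Q*r^2)/(Q*r/G) = Q*(r*G)" "Q*(Q*(Q*r^2))/(Q*r/G) = Q*(Q*(r*G))"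
    using nz Q0 by (simp_all add: power2_eq_square divide_simps)
  have args': "Q*r^2/(r*A) = Q*(r/A)" "Q*(Q*r^2)/(Q*(r*A)) = Q*(r/A)" "Q*(Q*(Q*r^2))/(Q*(Q*(r*A))) = Q*(r/A)" for A
    using nz Q0 by (simp_all add: power2_eq_square)
  have denQ: "qpoch q Q k \<noteq> 0" for k unfolding Q_def by (rule qpoch_q_nonzero[OF q])
  define X where "X = Q*(Q*(r*F))"
  define Y where "Y = Q*(Q*(r*G))"
  have XY: "qpoch q X k \<noteq> 0" "qpoch q Y k \<noteq> 0" for k
    using den(4,5) unfolding X_def Y_def Q_def by (auto intro!: qpoch_shift_nonzero(1))
  define N where "N k = qpoch q (Q*r^2) k * qpoch q (Q*(r*A1)) k * qpoch q (Q*(r*A2)) k * qpoch q (Q*(r*A3)) k" for k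
  define D where "D k = qpoch q Q k * qpoch q (Q*(r/A1)) k * qpoch q (Q*(r/A2)) k * qpoch q (Q*(r/A3)) k" for k
  define P where "P k = qpoch q (Q*r/F) k * qpoch q (Q*r/G) k" for k
  have D0: "D k \<noteq> 0" for k unfolding D_def using den denQ by auto
  define A where "A = (\<lambda>u::complex. 1 - E1*u + E2*u^2 - E3*u^3 + E4*u^4)"
  define g where "g = (\<lambda>u. (Q^2*E4 - 1) * (1 - F*u) * (1 - G*u) * ((E4 - 1) + (E3 - E1*E4)*u + E4*(E4 - 1)*u^2)
               + (F*G - Q^2*E4) * (E4 - 1) * A u)"
  have Aprod: "A u = (1 - r*u)*(1 - A1*u)*(1 - A2*u)*(1 - A3*u)" for u
    unfolding A_def E k by algebra
  \<comment> \<open>As before the certificate is 0 at index 0 because it contains 1/(q;q)_(k-1). The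
    constant \<open>Q^2*E4\<close> is the one that multiplication by \<open>y\<close> turns into
    \<open>F*G\<close>.\<close>
  define h where "h k = (case k of 0 \<Rightarrow> 0 | Suc j \<Rightarrow>
      Q^2*E4 * g (r * Q ^ Suc j) * N j * P (Suc j) / (D j * qpoch q X j * qpoch q Y j))" for k
  have h_an: "q_analytic q h"
  proof -
    have "q_analytic q (\<lambda>j. h (Suc j))"
      unfolding h_def nat.case N_def P_def D_def g_def A_def divide_inverse inverse_mult_distrib power_Suc Q_def
      by (intro q_analytic_mult q_analytic_add q_analytic_diff q_analytic_pow q_analytic_power q_analytic_const
          q_analytic_qpoch q_analytic_inverse_qpoch q iffD2[OF q_analytic_Suc_iff[OF q(1)]])
    thus ?thesis using q_analytic_Suc_iff[OF q(1)] by blast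
  qed
  define v where "v k = ?cp * (?Tp k * of_real q ^ k * of_real q ^ k) + ?c0 * (?T0 k * of_real q ^ k) + ?cm * ?Tm k" for k
  have step: "v k = y * h (Suc k) - h k" for k
  proof (cases k)
    case 0
    have "v 0 = ?cp * (1 - r^2) + ?c0 * (1 - Q*r^2) + ?cm * (1 - Q*(Q*r^2))"
      by (simp add: v_def vwp_def)
    also have "?cp * (1 - r^2) = - (Q^2*(Q^2*E4 - 1)*(1 - k2 + k1*k3 - k3^2)) * r^2 * ((1 - r*F)*(1 - Q*(r*F))*(1 - r*G)*(1 - Q*(r*G)))"
      using r1 by simp
    also have "\<dots> + ?c0 * (1 - Q*r^2) + ?cm * (1 - Q*(Q*r^2)) =
       - (Q^2 * (Q^2*E4 - 1) * (1 - k2 + k1*k3 - k3^2)) * r^2 * (1 - F*r) * (1 - Q*F*r) * (1 - G*r) * (1 - Q*G*r)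
      + four_shift_mid Q E1 E3 E4 F G * r * (1 - Q*r^2) * (1 - Q*F*r) * (1 - Q*G*r)
      + (F*G - Q^2*E4) * (F*G - 1) * (E4 - 1) * (1 - Q^2*r^2) * A (Q*r)"
      unfolding Aprod by algebra
    also have "\<dots> = g (Q*r) * (F - Q*r) * (G - Q*r)"
      by (rule four_shift_identity_initial[OF E A_def g_def, symmetric])
    also have "\<dots> = (F*G) * g (Q*r) * (1 - Q*r/F) * (1 - Q*r/G)"
      using nz by (simp add: field_simps)
    also have "\<dots> = y * h (Suc 0) - h 0"
      unfolding yE[symmetric] by (simp add: h_def N_def P_def D_def qpoch_def mult_ac)
    finally show ?thesis by (simp add: 0)
  next
    case (Suc j)
    define u where "u = Q ^ k"
    define p where "p = r*u"
    have uj: "Q * Q ^ j = u" by (simp add: u_def Suc)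
    define C where "C = N j / D k * P k / (qpoch q X k * qpoch q Y k)"
    have n1: "qpoch q (r*A) k = (1 - r*A) * qpoch q (Q*(r*A)) j" for A
      by (simp add: Suc qpoch_Suc_shift Q_def)
    have n2: "qpoch q (Q*(r*A)) k = qpoch q (Q*(r*A)) j * (1 - A*p)" for A
      by (simp add: Suc qpoch_Suc Q_def[symmetric] p_def uj[symmetric] mult_ac)
    have n3: "(1 - Q*(r*A)) * qpoch q (Q*(Q*(r*A))) k = qpoch q (Q*(r*A)) j * (1 - A*p) * (1 - Q*A*p)" for A
      using qpoch_shift2[of "Q*(r*A)" q j] by (simp add: Suc Q_def[symmetric] p_def uj[symmetric] mult_ac)
    have n1': "qpoch q (r^2) k = (1 - r^2) * qpoch q (Q*r^2) j"
      using n1[of r] by (simp add: power2_eq_square)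
    have n2': "qpoch q (Q*r^2) k = qpoch q (Q*r^2) j * (1 - r*p)" using n2[of r] by (simp add: power2_eq_square)
    have n3': "(1 - Q*r^2) * qpoch q (Q*(Q*r^2)) k = qpoch q (Q*r^2) j * (1 - r*p) * (1 - Q*r*p)"
      using n3[of r] by (simp add: power2_eq_square)
    have d: "(1 - z) / qpoch q z k = (1 - z*u) / qpoch q (Q*z) k" if "\<And>k. qpoch q z k \<noteq> 0" for z
      using qpoch_inverse_shift[OF that, of k] by (simp add: Q_def u_def)
    have d2: "(1 - r*f)*(1 - Q*(r*f)) / qpoch q (r*f) k = (1 - f*p)*(1 - Q*f*p) / qpoch q (Q*(Q*(r*f))) k"
         "(1 - Q*(r*f)) / qpoch q (Q*(r*f)) k = (1 - Q*f*p) / qpoch q (Q*(Q*(r*f))) k"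
      if "\<And>k. qpoch q (r*f) k \<noteq> 0" for f
    proof -
      have nz': "qpoch q (Q*(r*f)) k \<noteq> 0" for k using qpoch_shift_nonzero(1)[OF that] by (simp add: Q_def)
      show 1: "(1 - Q*(r*f)) / qpoch q (Q*(r*f)) k = (1 - Q*f*p) / qpoch q (Q*(Q*(r*f))) k"
        using d[OF nz'] by (simp add: p_def mult_ac)
      have "(1 - r*f)*(1 - Q*(r*f)) / qpoch q (r*f) k = (1 - Q*(r*f)) * ((1 - r*f) / qpoch q (r*f) k)" by simp
      also have "\<dots> = (1 - f*p) * ((1 - Q*(r*f)) / qpoch q (Q*(r*f)) k)"
        unfolding d[OF that] by (simp add: p_def mult_ac)
      finally show "(1 - r*f)*(1 - Q*(r*f)) / qpoch q (r*f) k = (1 - f*p)*(1 - Q*f*p) / qpoch q (Q*(Q*(r*f))) k"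
        unfolding 1 by simp
    qed
    note dF = d2[OF den(4), folded X_def] and dG = d2[OF den(5), folded Y_def]
    define rA where "rA = (1 - r*A1)*(1 - r*A2)*(1 - r*A3)"
    have res: "four_shift_res E1 E2 E3 E4 = rA*(1 - k2 + k1*k3 - k3^2)"
      unfolding E four_shift_res_factor rA_def k by algebra
    define R' where "R' = Q^2*(Q^2*E4 - 1)*(1 - k2 + k1*k3 - k3^2)"
    have "?cp * (?Tp k * of_real q ^ k * of_real q ^ k) = - R' * r^2 * (1 - r^2*u^2) * u^2
       * (qpoch q (r^2) k / (1 - r^2)) * (qpoch q (r*A1) k * qpoch q (r*A2) k * qpoch q (r*A3) k) / D k * P k
       * ((1 - r*F)*(1 - Q*(r*F)) / qpoch q (r*F) k) * ((1 - r*G)*(1 - Q*(r*G)) / qpoch q (r*G) k)"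
      unfolding vwp_def list.map prod_list.Cons prod_list.Nil Q_def[symmetric] args args' R'_def[symmetric]
        u_def[symmetric] D_def P_def
      by (simp only: divide_inverse inverse_mult_distrib mult_ac mult_1_right mult_1_left power2_eq_square[of u])
    also have "\<dots> = C * (- (R'*rA) * p^2 * (1 - p^2) * (1 - F*p) * (1 - Q*F*p) * (1 - G*p) * (1 - Q*G*p))"
    proof -
      have "qpoch q (r^2) k / (1 - r^2) = qpoch q (Q*r^2) j" using r1 by (simp add: n1')
      thus ?thesis unfolding dF dG n1[of A1] n1[of A2] n1[of A3]
        by (simp add: C_def N_def rA_def p_def power_mult_distrib divide_inverse mult_ac)
    qed
    finally have e1: "?cp * (?Tp k * of_real q ^ k * of_real q ^ k) = \<dots>" .
    have "?c0 * (?T0 k * of_real q ^ k) = four_shift_mid Q E1 E3 E4 F G * r * u * (1 - Q*r^2*u^2)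
       * N k / D k * P k * ((1 - Q*(r*F)) / qpoch q (Q*(r*F)) k) * ((1 - Q*(r*G)) / qpoch q (Q*(r*G)) k)"
      unfolding vwp_def list.map prod_list.Cons prod_list.Nil Q_def[symmetric] args args' u_def[symmetric] D_def P_def N_def
      by (simp only: divide_inverse inverse_mult_distrib mult_ac mult_1_right mult_1_left)
    also have "\<dots> = C * (four_shift_mid Q E1 E3 E4 F G * p * (1 - Q*p^2) * A p * (1 - Q*F*p) * (1 - Q*G*p))"
      unfolding dF dG N_def[of k] n2[of A1] n2[of A2] n2[of A3] n2' Aprod
      by (simp add: C_def N_def[of j] p_def power_mult_distrib divide_inverse mult_ac)
    finally have e0: "?c0 * (?T0 k * of_real q ^ k) = \<dots>" .
    define Ym where "Ym = (F*G - Q^2*E4)*(F*G - 1)*(E4 - 1)"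
    have "?cm * ?Tm k = Ym * (1 - Q*(Q*r^2)*u^2) * ((1 - Q*r^2) * qpoch q (Q*(Q*r^2)) k) * ((1 - Q*(r*A1)) * qpoch q (Q*(Q*(r*A1))) k)
        * ((1 - Q*(r*A2)) * qpoch q (Q*(Q*(r*A2))) k) * ((1 - Q*(r*A3)) * qpoch q (Q*(Q*(r*A3))) k) / D k * P k
        / (qpoch q X k * qpoch q Y k)"
      unfolding vwp_def list.map prod_list.Cons prod_list.Nil Q_def[symmetric] args args' u_def[symmetric] D_def P_def
        Ym_def[symmetric] X_def Y_def
      by (simp only: divide_inverse inverse_mult_distrib mult_ac mult_1_right mult_1_left)
    also have "\<dots> = C * (Ym * (1 - Q^2*p^2) * A p * A (Q*p))"
      unfolding n3[of A1] n3[of A2] n3[of A3] n3' Aprod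
      by (simp add: C_def N_def[of j] p_def power_mult_distrib divide_inverse mult_ac power2_eq_square)
    finally have e2: "?cm * ?Tm k = \<dots>" .
    have Pk: "P (Suc k) * (F*G) = P k * ((F - Q*p)*(G - Q*p))"
    proof -
      have "1 - Q*r/f*u = (f - Q*p)/f" if "f \<noteq> 0" for f using that by (simp add: p_def divide_simps)
      thus ?thesis using nz by (simp add: P_def qpoch_Suc Q_def[symmetric] u_def[symmetric])
    qed
    have hS: "y * h (Suc k) = C * (g (Q*p) * A p * (F - Q*p) * (G - Q*p))"
    proof -
      have "y * h (Suc k) = (y*(Q^2*E4)) * g (Q*p) * N k * P (Suc k) / (D k * qpoch q X k * qpoch q Y k)"
        by (simp add: h_def p_def u_def mult_ac)
      also have "\<dots> = g (Q*p) * N k * (P (Suc k) * (F*G)) / (D k * qpoch q X k * qpoch q Y k)"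
        unfolding yE by (simp add: mult_ac)
      also have "\<dots> = C * (g (Q*p) * A p * (F - Q*p) * (G - Q*p))"
        unfolding Pk N_def[of k] n2[of A1] n2[of A2] n2[of A3] n2' Aprod by (simp add: C_def N_def[of j] divide_inverse mult_ac)
      finally show ?thesis .
    qed
    \<comment> \<open>The denominators contribute factors \<open>1 - p/A_i\<close>; multiplied by
      \<open>E4\<close>, the product of the four quantities, they become the reversed quartic. The
      factor with \<open>r\<close> is \<open>1 - u\<close>, from (q;q)_k.\<close>
    have Dk: "E4 * D k = D j * (E4 - E3*p + E2*p^2 - E1*p^3 + p^4)"
    proof -
      have a: "Q*(r/A) * Q^j = p/A" for A by (simp add: p_def uj[symmetric])
      have "E4 * D k = D j * ((r*(1 - u)) * (A1*(1 - p/A1)) * (A2*(1 - p/A2)) * (A3*(1 - p/A3)))"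
        unfolding D_def Suc qpoch_Suc Q_def[symmetric] a uj E k by (simp add: mult_ac)
      also have "(r*(1 - u)) * (A1*(1 - p/A1)) * (A2*(1 - p/A2)) * (A3*(1 - p/A3)) = (r - p)*(A1 - p)*(A2 - p)*(A3 - p)"
        using nz by (simp add: right_diff_distrib p_def)
      also have "\<dots> = E4 - E3*p + E2*p^2 - E1*p^3 + p^4" unfolding E k by algebra
      finally show ?thesis .
    qed
    have Xk: "qpoch q X k = qpoch q X j * (1 - Q*F*p)" "qpoch q Y k = qpoch q Y j * (1 - Q*G*p)"
      by (simp_all add: Suc qpoch_Suc Q_def[symmetric] p_def uj[symmetric] X_def Y_def mult_ac)
    have hk: "h k = C * (Q^2 * g p * (E4 - E3*p + E2*p^2 - E1*p^3 + p^4) * (1 - Q*F*p) * (1 - Q*G*p))"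
    proof -
      define W where "W = E4 - E3*p + E2*p^2 - E1*p^3 + p^4"
      have nz': "D j \<noteq> 0" "qpoch q X j \<noteq> 0" "qpoch q Y j \<noteq> 0" "1 - Q*F*p \<noteq> 0" "1 - Q*G*p \<noteq> 0" "D k \<noteq> 0"
        using D0 XY[of k] unfolding Xk by auto
      have "h k = Q^2*E4 * g p * N j * P k / (D j * qpoch q X j * qpoch q Y j)"
        by (simp add: h_def Suc p_def u_def)
      also have "\<dots> = Q^2 * g p * N j * P k * W / (D k * qpoch q X j * qpoch q Y j)"
        using Dk[folded W_def] nz' by (simp add: frac_eq_eq mult_ac)
      also have "\<dots> = C * (Q^2 * g p * W * (1 - Q*F*p) * (1 - Q*G*p))"
        unfolding C_def Xk using nz' by (simp add: divide_simps)
      finally show ?thesis unfolding W_def .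
    qed
    have "v k = C * (- (R'*rA) * p^2 * (1 - p^2) * (1 - F*p) * (1 - Q*F*p) * (1 - G*p) * (1 - Q*G*p)
      + four_shift_mid Q E1 E3 E4 F G * p * (1 - Q*p^2) * A p * (1 - Q*F*p) * (1 - Q*G*p)
      + Ym * (1 - Q^2*p^2) * A p * A (Q*p))"
      unfolding v_def e0 e1 e2 by (simp only: distrib_left)
    also have "R'*rA = Q^2*(Q^2*E4 - 1)*four_shift_res E1 E2 E3 E4" unfolding res R'_def by (simp add: mult_ac)
    also have "C * (- (Q^2*(Q^2*E4 - 1)*four_shift_res E1 E2 E3 E4) * p^2 * (1 - p^2) * (1 - F*p) * (1 - Q*F*p) * (1 - G*p) * (1 - Q*G*p)
      + four_shift_mid Q E1 E3 E4 F G * p * (1 - Q*p^2) * A p * (1 - Q*F*p) * (1 - Q*G*p)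
      + Ym * (1 - Q^2*p^2) * A p * A (Q*p)) = y * h (Suc k) - h k"
      unfolding Ym_def four_shift_identity[OF A_def g_def, symmetric] hS hk by (simp only: right_diff_distrib)
    finally show ?thesis .
  qed
  have "qcont q v y = ?cp * qcont q (\<lambda>k. ?Tp k * of_real q ^ k * of_real q ^ k) y
      + ?c0 * qcont q (\<lambda>k. ?T0 k * of_real q ^ k) y + ?cm * qcont q ?Tm y"
    unfolding v_def by (intro qcont_add3 q_analytic_mult q_analytic_power q_analytic_vwp q y)
  moreover have "qcont q v y = - h 0" by (rule qcont_telescope[OF q h_an y step])
  moreover have "qcont q (\<lambda>k. ?T0 k * of_real q ^ k) y = qcont q ?T0 (Q*y)"
    unfolding Q_def by (intro qcont_power_mult q_analytic_vwp q y)
  moreover have "qcont q (\<lambda>k. ?Tp k * of_real q ^ k * of_real q ^ k) y = qcont q ?Tp (Q*(Q*y))"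
    unfolding Q_def
    by (subst qcont_power_mult qcont_power_mult, (intro qcont_power_mult q_analytic_mult q_analytic_power q_analytic_vwp q y mult_q_notin_W87_poles)+)
  ultimately show ?thesis by (simp add: h_def)
qed

text \<open>After reflection the roles are exchanged: the four parameters \<open>Q*(r*A_i)\<close>
  stay fixed, while the pair moves. By \<open>rF\<close> its first member \<open>r/F\<close> is the
  base parameter \<open>r^2\<close>, and its second is \<open>r/G\<close>. No quantity A_i is tied
  to \<open>r\<close>, so all six factors of \<open>four_shift_res\<close> remain.\<close>

lemma vwp_contiguous_four_reflected:
  fixes q :: real and Q r A1 A2 A3 A4 F G y :: complex
  defines "Q \<equiv> complex_of_real q"
  assumes q: "0 < q" "q < 1" and y: "y \<notin> W87_poles q"
    and nz: "A1 \<noteq> 0" "A2 \<noteq> 0" "A3 \<noteq> 0" "A4 \<noteq> 0" "G \<noteq> 0" and rF: "r*F = 1"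
    and E: "E1 = A1 + A2 + A3 + A4" "E2 = A1*A2 + A1*A3 + A1*A4 + A2*A3 + A2*A4 + A3*A4"
      "E3 = A1*A2*A3 + A1*A2*A4 + A1*A3*A4 + A2*A3*A4" "E4 = A1*A2*A3*A4"
    and yE: "y * (Q^2*E4) = F*G"
    and den: "\<And>k. qpoch q (r/A1) k \<noteq> 0" "\<And>k. qpoch q (r/A2) k \<noteq> 0" "\<And>k. qpoch q (r/A3) k \<noteq> 0"
      "\<And>k. qpoch q (r/A4) k \<noteq> 0" "\<And>k. qpoch q (Q*(r*G)) k \<noteq> 0"
  shows "- (Q^2*(Q^2*E4 - 1)*four_shift_res E1 E2 E3 E4) * G^2 * ((1 - r^2)*(1 - Q*r^2)*(1 - r/G)*(1 - Q*(r/G)))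
        * qcont q (vwp q (Q*(Q*r^2)) [Q*(Q*r^2), Q*(r*A1), Q*(r*A2), Q*(r*A3), Q*(r*A4), Q*(Q*(r/G))]) (Q*(Q*y))
    + four_shift_mid Q E1 E3 E4 F G * E4 * G * ((1 - Q*(r/A1))*(1 - Q*(r/A2))*(1 - Q*(r/A3))*(1 - Q*(r/A4))*(1 - r^2)*(1 - r/G))
        * qcont q (vwp q (Q*r^2) [Q*r^2, Q*(r*A1), Q*(r*A2), Q*(r*A3), Q*(r*A4), Q*(r/G)]) (Q*y)
    + Q^2*((F*G - Q^2*E4)*(F*G - 1)*(E4 - 1)) * E4^2 * (((1 - r/A1)*(1 - r/A2)*(1 - r/A3)*(1 - r/A4))
        * ((1 - Q*(r/A1))*(1 - Q*(r/A2))*(1 - Q*(r/A3))*(1 - Q*(r/A4))))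
        * qcont q (vwp q (r^2) [r^2, Q*(r*A1), Q*(r*A2), Q*(r*A3), Q*(r*A4), r/G]) y = 0"
    (is "?cp * qcont q ?Tp (Q*(Q*y)) + ?c0 * qcont q ?T0 (Q*y) + ?cm * qcont q ?Tm y = 0")
proof -
  have Q0: "Q \<noteq> 0" and r0: "r \<noteq> 0" using q rF by (auto simp: Q_def)
  have args: "Q*r^2/r^2 = Q" "Q*(Q*r^2)/(Q*r^2) = Q" "Q*(Q*(Q*r^2))/(Q*(Q*r^2)) = Q"
    "Q*r^2/(r/G) = Q*(r*G)" "Q*(Q*r^2)/(Q*(r/G)) = Q*(r*G)" "Q*(Q*(Q*r^2))/(Q*(Q*(r/G))) = Q*(r*G)"
    using nz r0 Q0 by (simp_all add: power2_eq_square)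
  have args': "Q*r^2/(Q*(r*A)) = r/A" "Q*(Q*r^2)/(Q*(r*A)) = Q*(r/A)" "Q*(Q*(Q*r^2))/(Q*(r*A)) = Q*(Q*(r/A))" for A
    using r0 Q0 by (simp_all add: power2_eq_square)
  define N where "N k = qpoch q (Q*(r*A1)) k * qpoch q (Q*(r*A2)) k * qpoch q (Q*(r*A3)) k * qpoch q (Q*(r*A4)) k" for k
  define D where "D k = qpoch q (Q*(Q*(r/A1))) k * qpoch q (Q*(Q*(r/A2))) k * qpoch q (Q*(Q*(r/A3))) k * qpoch q (Q*(Q*(r/A4))) k" for k
  define B where "B k = N k / D k * (qpoch q (r^2) k * qpoch q (r/G) k) / (qpoch q Q k * qpoch q (Q*(r*G)) k)" for k
  define A where "A = (\<lambda>u::complex. 1 - E1*u + E2*u^2 - E3*u^3 + E4*u^4)"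
  define A' where "A' = (\<lambda>u::complex. u^4 - E1*u^3 + E2*u^2 - E3*u + E4)"
  define g where "g = (\<lambda>u. (Q^2*E4 - 1) * (u - F) * (u - G) * ((E4 - 1)*u^2 + (E3 - E1*E4)*u + E4*(E4 - 1))
               + (F*G - Q^2*E4) * (E4 - 1) * A' u)"
  have Aprod: "A u = (1 - A1*u)*(1 - A2*u)*(1 - A3*u)*(1 - A4*u)" for u
    unfolding A_def E by algebra
  have A'prod: "A' u = E4 * ((1 - u/A1)*(1 - u/A2)*(1 - u/A3)*(1 - u/A4))" for u
  proof -
    have "A' u = (A1 - u)*(A2 - u)*(A3 - u)*(A4 - u)" unfolding A'_def E by algebra
    also have "\<dots> = (A1*(1 - u/A1))*(A2*(1 - u/A2))*(A3*(1 - u/A3))*(A4*(1 - u/A4))"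
      using nz by (simp add: right_diff_distrib)
    finally show ?thesis by (simp add: E mult_ac)
  qed
  \<comment> \<open>The factor \<open>1 - F*(r * Q^k)\<close> is \<open>1 - q^k\<close> because
    \<open>r*F = 1\<close>. It makes \<open>h 0\<close> vanish, so the formula covers all indices
    and no separate initial identity is required.\<close>
  define h where "h k = Q^2 * g (r * Q^k) * A' (Q*(r * Q^k)) * (1 - F*(r * Q^k)) * (1 - G*(r * Q^k)) * B k" for k
  have h_an: "q_analytic q h"
    unfolding h_def[abs_def] B_def N_def D_def g_def A'_def divide_inverse inverse_mult_distrib Q_def
    by (intro q_analytic_mult q_analytic_add q_analytic_diff q_analytic_pow q_analytic_power q_analytic_const
          q_analytic_qpoch q_analytic_inverse_qpoch q)
  define v where "v k = ?cp * (?Tp k * of_real q ^ k * of_real q ^ k) + ?c0 * (?T0 k * of_real q ^ k) + ?cm * ?Tm k" for k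
  have step: "v k = y * h (Suc k) - h k" for k
  proof -
    define u where "u = Q ^ k"
    define w where "w = r*u"
    have Fw: "F*w = u" using rF by (simp add: w_def mult_ac flip: mult.assoc)
    have ru: "r^2*u = r*w" by (simp add: w_def power2_eq_square)
    have mF: "w - F = - (F*(1 - r*w))" "Q*w - F = - (F*(1 - Q*(r*w)))"
      using rF by (simp_all add: right_diff_distrib) (simp_all add: mult_ac flip: mult.assoc)
    have mG: "w - G = - (G*(1 - w/G))" "Q*w - G = - (G*(1 - Q*(w/G)))"
      using nz by (simp_all add: right_diff_distrib)
    have up1: "(1 - z) * qpoch q (Q*z) k = qpoch q z k * (1 - z*u)" for z
      using qpoch_shift[of q z k] by (simp add: Q_def u_def)
    have up2: "(1 - z)*(1 - Q*z) * qpoch q (Q*(Q*z)) k = qpoch q z k * ((1 - z*u) * (1 - Q*(z*u)))" for z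
    proof -
      have "(1 - z)*(1 - Q*z) * qpoch q (Q*(Q*z)) k = (1 - z) * (qpoch q (Q*z) k * (1 - Q*z*u))"
        using up1[of "Q*z"] by simp
      also have "\<dots> = ((1 - z) * qpoch q (Q*z) k) * (1 - Q*z*u)" by simp
      finally show ?thesis unfolding up1 by (simp add: mult_ac)
    qed
    have d: "(1 - z) / qpoch q z k = (1 - z*u) / qpoch q (Q*z) k" if "\<And>k. qpoch q z k \<noteq> 0" for z
      using qpoch_inverse_shift[OF that, of k] by (simp add: Q_def u_def)
    have d2: "(1 - r/f)*(1 - Q*(r/f)) / qpoch q (r/f) k = (1 - w/f)*(1 - Q*w/f) / qpoch q (Q*(Q*(r/f))) k"
         "(1 - Q*(r/f)) / qpoch q (Q*(r/f)) k = (1 - Q*w/f) / qpoch q (Q*(Q*(r/f))) k"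
      if "\<And>k. qpoch q (r/f) k \<noteq> 0" for f
    proof -
      have nz': "qpoch q (Q*(r/f)) k \<noteq> 0" for k using qpoch_shift_nonzero(1)[OF that] by (simp add: Q_def)
      show 1: "(1 - Q*(r/f)) / qpoch q (Q*(r/f)) k = (1 - Q*w/f) / qpoch q (Q*(Q*(r/f))) k"
        using d[OF nz'] by (simp add: w_def)
      have "(1 - r/f)*(1 - Q*(r/f)) / qpoch q (r/f) k = (1 - Q*(r/f)) * ((1 - r/f) / qpoch q (r/f) k)" by simp
      also have "\<dots> = (1 - w/f) * ((1 - Q*(r/f)) / qpoch q (Q*(r/f)) k)"
        unfolding d[OF that] by (simp add: w_def)
      finally show "(1 - r/f)*(1 - Q*(r/f)) / qpoch q (r/f) k = (1 - w/f)*(1 - Q*w/f) / qpoch q (Q*(Q*(r/f))) k"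
        unfolding 1 by simp
    qed
    note dA = d2[OF den(1)] d2[OF den(2)] d2[OF den(3)] d2[OF den(4)]
    define R where "R = Q^2*(Q^2*E4 - 1)*four_shift_res E1 E2 E3 E4"
    have "?cp * (?Tp k * of_real q ^ k * of_real q ^ k) = - R * G^2 * u^2 * (1 - Q*(Q*r^2)*u^2)
       * ((1 - r^2)*(1 - Q*r^2) * qpoch q (Q*(Q*r^2)) k) * ((1 - r/G)*(1 - Q*(r/G)) * qpoch q (Q*(Q*(r/G))) k)
       * (N k / D k) / (qpoch q Q k * qpoch q (Q*(r*G)) k)"
      unfolding vwp_def list.map prod_list.Cons prod_list.Nil Q_def[symmetric] args args' R_def[symmetric]
        u_def[symmetric] D_def N_def
      by (simp only: divide_inverse inverse_mult_distrib mult_ac mult_1_right mult_1_left power2_eq_square[of u])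
    also have "\<dots> = B k * (- R * (u^2 * G^2 * (1 - Q^2*w^2) * ((1 - r*w) * (1 - Q*(r*w)) * (1 - w/G) * (1 - Q*(w/G)))))"
      unfolding up2 ru by (simp add: B_def w_def power_mult_distrib divide_inverse mult_ac power2_eq_square[of Q])
    also have "\<dots> = B k * (R * w^2 * (Q^2*w^2 - 1) * (Q*w - F) * (Q*w - G) * (w - F) * (w - G))"
      unfolding mF mG Fw[symmetric] by algebra
    finally have e1: "?cp * (?Tp k * of_real q ^ k * of_real q ^ k) = \<dots>" .
    define Y0 where "Y0 = four_shift_mid Q E1 E3 E4 F G"
    have "?c0 * (?T0 k * of_real q ^ k) = Y0 * E4 * G * u * (1 - Q*r^2*u^2)
       * ((1 - r^2) * qpoch q (Q*r^2) k) * ((1 - r/G) * qpoch q (Q*(r/G)) k) * N k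
       * ((1 - Q*(r/A1)) / qpoch q (Q*(r/A1)) k) * ((1 - Q*(r/A2)) / qpoch q (Q*(r/A2)) k)
       * ((1 - Q*(r/A3)) / qpoch q (Q*(r/A3)) k) * ((1 - Q*(r/A4)) / qpoch q (Q*(r/A4)) k)
       / (qpoch q Q k * qpoch q (Q*(r*G)) k)"
      unfolding vwp_def list.map prod_list.Cons prod_list.Nil Q_def[symmetric] args args' u_def[symmetric] N_def Y0_def
      by (simp only: divide_inverse inverse_mult_distrib mult_ac mult_1_right mult_1_left)
    also have "\<dots> = B k * (Y0 * u * G * (1 - Q*w^2) * A' (Q*w) * (1 - r*w) * (1 - w/G))"
      unfolding dA up1 ru A'prod by (simp add: B_def D_def w_def power_mult_distrib divide_inverse mult_ac)
    also have "\<dots> = B k * (- Y0 * w * (Q*w^2 - 1) * A' (Q*w) * (w - F) * (w - G))"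
      unfolding mF mG Fw[symmetric] by algebra
    finally have e0: "?c0 * (?T0 k * of_real q ^ k) = \<dots>" .
    define Ym where "Ym = (F*G - Q^2*E4)*(F*G - 1)*(E4 - 1)"
    have "?cm * ?Tm k = Q^2 * Ym * E4^2 * (1 - r^2*u^2) * N k
       * ((1 - r/A1)*(1 - Q*(r/A1)) / qpoch q (r/A1) k) * ((1 - r/A2)*(1 - Q*(r/A2)) / qpoch q (r/A2) k)
       * ((1 - r/A3)*(1 - Q*(r/A3)) / qpoch q (r/A3) k) * ((1 - r/A4)*(1 - Q*(r/A4)) / qpoch q (r/A4) k)
       * (qpoch q (r^2) k * qpoch q (r/G) k) / (qpoch q Q k * qpoch q (Q*(r*G)) k)"
      unfolding vwp_def list.map prod_list.Cons prod_list.Nil Q_def[symmetric] args args' u_def[symmetric] N_def Ym_def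
      by (simp only: divide_inverse inverse_mult_distrib mult_ac mult_1_right mult_1_left)
    also have "\<dots> = B k * (- (Q^2 * Ym) * (w^2 - 1) * A' (Q*w) * A' w)"
    proof -
      have "- (Q^2 * Ym) * (w^2 - 1) * A' (Q*w) * A' w = Q^2 * Ym * (1 - r^2*u^2) * A' (Q*w) * A' w"
        unfolding w_def by algebra
      thus ?thesis unfolding dA A'prod by (simp add: B_def D_def power2_eq_square[of E4] divide_inverse mult_ac)
    qed
    finally have e2: "?cm * ?Tm k = \<dots>" .
    have hS: "y * h (Suc k) = B k * (g (Q*w) * A (Q*w) * (w - F) * (w - G))"
    proof -
      have DS: "A' (Q*(Q*w)) / D (Suc k) = E4 / D k"
      proof -
        have "qpoch q (Q*(Q*(r/a))) (Suc k) = qpoch q (Q*(Q*(r/a))) k * (1 - Q*(Q*w)/a)" for a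
          by (simp add: qpoch_Suc Q_def[symmetric] w_def u_def)
        hence D1: "D (Suc k) = D k * ((1 - Q*(Q*w)/A1)*(1 - Q*(Q*w)/A2)*(1 - Q*(Q*w)/A3)*(1 - Q*(Q*w)/A4))"
          by (simp add: D_def mult_ac)
        have "qpoch q (Q*(Q*(r/a))) (Suc k) \<noteq> 0" if "\<And>k. qpoch q (r/a) k \<noteq> 0" for a
        proof -
          have "qpoch q (Q*(r/a)) k \<noteq> 0" for k using qpoch_shift_nonzero(1)[OF that] by (simp add: Q_def)
          from qpoch_shift_nonzero(1)[OF this] show ?thesis by (simp add: Q_def)
        qed
        hence "D (Suc k) \<noteq> 0" unfolding D_def using den by simp
        thus ?thesis unfolding A'prod D1 by simp
      qed
      have z: "qpoch q (r^2) (Suc k) = qpoch q (r^2) k * (1 - r*w)"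
        "qpoch q (r/G) (Suc k) = qpoch q (r/G) k * (1 - w/G)"
        by (simp_all add: qpoch_Suc Q_def[symmetric] u_def[symmetric] w_def power2_eq_square)
      have Qk: "qpoch q Q (Suc k) \<noteq> 0" unfolding Q_def by (rule qpoch_q_nonzero[OF q])
      have z1: "(1 - F*(Q*w)) / qpoch q Q (Suc k) = 1 / qpoch q Q k"
        using Qk Fw by (simp add: qpoch_Suc Q_def[symmetric] u_def[symmetric] mult.left_commute[of F])
      have z2: "(1 - G*(Q*w)) / qpoch q (Q*(r*G)) (Suc k) = 1 / qpoch q (Q*(r*G)) k"
        using den(5)[of "Suc k"] by (simp add: qpoch_Suc Q_def[symmetric] u_def[symmetric] w_def mult_ac)
      have NS: "N (Suc k) = N k * A (Q*w)"
        unfolding Aprod by (simp add: N_def qpoch_Suc Q_def[symmetric] u_def[symmetric] w_def mult_ac)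
      have rk: "r * Q ^ Suc k = Q*w" by (simp add: w_def u_def)
      have "y * h (Suc k) = y * Q^2 * g (Q*w) * (A' (Q*(Q*w)) / D (Suc k)) * ((1 - F*(Q*w)) / qpoch q Q (Suc k))
         * ((1 - G*(Q*w)) / qpoch q (Q*(r*G)) (Suc k)) * N (Suc k) * qpoch q (r^2) (Suc k) * qpoch q (r/G) (Suc k)"
        unfolding h_def B_def rk by (simp only: divide_inverse inverse_mult_distrib mult_ac)
      also have "\<dots> = (y * (Q^2*E4)) * B k * g (Q*w) * A (Q*w) * (1 - r*w) * (1 - w/G)"
        unfolding DS z1 z2 NS z by (simp add: B_def divide_inverse mult_ac)
      finally show ?thesis unfolding yE mF mG by (simp add: mult_ac)
    qed
    have hk: "h k = B k * (Q^2 * g w * A' (Q*w) * (1 - F*w) * (1 - G*w))"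
      by (simp add: h_def w_def u_def mult_ac)
    have "v k = - (B k * (- R * w^2 * (Q^2*w^2 - 1) * (Q*w - F) * (Q*w - G) * (w - F) * (w - G)
      + Y0 * w * (Q*w^2 - 1) * A' (Q*w) * (w - F) * (w - G) + Q^2 * Ym * (w^2 - 1) * A' (Q*w) * A' w))"
      unfolding v_def e0 e1 e2 by algebra
    also have "\<dots> = y * h (Suc k) - h k"
      unfolding Ym_def Y0_def R_def four_shift_identity_reflected[OF A_def A'_def g_def, symmetric] hS hk
      by (simp add: right_diff_distrib)
    finally show ?thesis .
  qed
  have h0: "h 0 = 0" using rF by (simp add: h_def mult.commute)
  have "qcont q v y = ?cp * qcont q (\<lambda>k. ?Tp k * of_real q ^ k * of_real q ^ k) y
      + ?c0 * qcont q (\<lambda>k. ?T0 k * of_real q ^ k) y + ?cm * qcont q ?Tm y"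
    unfolding v_def by (intro qcont_add3 q_analytic_mult q_analytic_power q_analytic_vwp q y)
  moreover have "qcont q v y = - h 0" by (rule qcont_telescope[OF q h_an y step])
  moreover have "qcont q (\<lambda>k. ?T0 k * of_real q ^ k) y = qcont q ?T0 (Q*y)"
    unfolding Q_def by (intro qcont_power_mult q_analytic_vwp q y)
  moreover have "qcont q (\<lambda>k. ?Tp k * of_real q ^ k * of_real q ^ k) y = qcont q ?Tp (Q*(Q*y))"
    unfolding Q_def
    by (subst qcont_power_mult qcont_power_mult, (intro qcont_power_mult q_analytic_mult q_analytic_power q_analytic_vwp q y mult_q_notin_W87_poles)+)
  ultimately show ?thesis using h0 by simp
qed

section \<open>The Askey-Wilson functions\<close>

text \<open>In terms of \<open>Q\<close> and \<open>e\<close> all powers of \<open>q\<close> that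
  occur are monomials, possibly with negative exponents, so the comparison of coefficients becomes a
  matter of rational identities.\<close>

lemma qpow_shift:
  assumes "0 < q" and Q: "Q = complex_of_real q" and e: "e = qpow q (\<gamma> - 1)"
  shows "e \<noteq> 0" "qpow q \<gamma> = Q * e" "qpow q (\<gamma> + 1) = Q * (Q * e)"
    "qpow q (\<gamma> - 1) = e" "qpow q (\<gamma> - 1 - 1) = e / Q" "qpow q (\<gamma> + 1 - 1) = Q * e"
    "qpow q (2*\<gamma> - 2) = e^2" "qpow q (2*\<gamma> - 1) = Q * e^2" "qpow q (2*\<gamma>) = Q^2 * e^2"
    "qpow q (\<gamma> - 1 + 1) = Q * e" "qpow q (\<gamma> + 1 + 1) = Q * (Q * (Q * e))"
    "qpow q (- \<gamma>) = 1 / (Q * e)" "qpow q (- (\<gamma> + 1)) = 1 / (Q * (Q * e))"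
    "qpow q (- (\<gamma> - 1)) = 1 / e"
proof -
  have Q0: "Q \<noteq> 0" using assms(1) by (simp add: Q)
  have p1: "Q powr 1 = Q" using Q0 by simp
  have add: "Q powr (x + y) = Q powr x * Q powr y" for x y by (rule powr_add)
  have m: "Q powr (- x) = 1 / Q powr x" for x by (rule powr_minus_divide)
  have e': "Q powr (\<gamma> - 1) = e" by (simp add: e Q)
  have g: "Q powr \<gamma> = Q * e" using add[of "\<gamma> - 1" 1] p1 e' by simp
  have g1: "Q powr (\<gamma> + 1) = Q * (Q * e)" using add[of \<gamma> 1] p1 g by simp
  have g2: "Q powr (\<gamma> + 1 + 1) = Q * (Q * (Q * e))" using add[of "\<gamma> + 1" 1] p1 g1 by simp
  have gm: "e = Q powr (\<gamma> - 1 - 1) * Q" using add[of "\<gamma> - 1 - 1" 1] p1 e' by simp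
  have "\<gamma> - 1 + (\<gamma> - 1) = 2*\<gamma> - 2" "\<gamma> + (\<gamma> - 1) = 2*\<gamma> - 1" "\<gamma> + \<gamma> = 2*\<gamma>" by simp_all
  hence h: "Q powr (2*\<gamma> - 2) = e^2" "Q powr (2*\<gamma> - 1) = Q * e^2" "Q powr (2*\<gamma>) = Q^2 * e^2"
    using add[of "\<gamma> - 1" "\<gamma> - 1"] add[of "\<gamma>" "\<gamma> - 1"] add[of \<gamma> \<gamma>] e' g by (simp_all add: power2_eq_square mult_ac)
  show "qpow q \<gamma> = Q * e" "qpow q (\<gamma> + 1) = Q * (Q * e)" "qpow q (\<gamma> - 1) = e"
    "qpow q (2*\<gamma> - 2) = e^2" "qpow q (2*\<gamma> - 1) = Q * e^2" "qpow q (2*\<gamma>) = Q^2 * e^2"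
    "qpow q (\<gamma> + 1 + 1) = Q * (Q * (Q * e))"
    "qpow q (- \<gamma>) = 1 / (Q * e)" "qpow q (- (\<gamma> + 1)) = 1 / (Q * (Q * e))" "qpow q (- (\<gamma> - 1)) = 1 / e"
    unfolding Q[symmetric] m g g1 g2 e' h by (rule refl)+
  show "qpow q (\<gamma> - 1 - 1) = e / Q" unfolding Q[symmetric] using gm Q0 by (metis nonzero_mult_div_cancel_right)
  show "qpow q (\<gamma> - 1 + 1) = Q * e" "qpow q (\<gamma> + 1 - 1) = Q * e"
    unfolding Q[symmetric] using g by simp_all
  show "e \<noteq> 0" using Q0 e' by auto
qed

lemma bpow_add1:
  assumes "log_branch q lg" "x \<noteq> 0"
  shows "bpow lg x (s + 1) = x * bpow lg x s"
  using assms by (simp add: bpow_def log_branch_def distrib_right exp_add)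

text \<open>The comparison of middle coefficients for the recurrence of \<open>AW_R\<close>, with
  denominators cleared. The terms in z have cancelled beforehand: what remains of them and of the
  argument is the factor \<open>(q - 1) * (a^2 - q)\<close>.\<close>

lemma AW_R_L_identity:
  fixes a b c d e q :: complex
  shows "(q - 1) * (a^2 - q) * (1 - a*b*c*d*e^2) * (1 - a*b*c*d*q*e^2) * (1 - a*b*c*d*q^2*e^2)
     + a^2*(1 - q*(q*e)) * ((1 - b*c*(q*e))*(1 - b*d*(q*e))*(1 - c*d*(q*e))) * (1 - a*b*c*d*e^2)
     + (q^2 - q*(a*b*c*d*e)) * ((1 - a*b*e)*(1 - a*c*e)*(1 - a*d*e)) * (1 - a*b*c*d*q^2*e^2)
   = q * ((1 - a*b*(q*e))*(1 - a*c*(q*e))*(1 - a*d*(q*e))) * (1 - a*b*c*d*e) * (1 - a*b*c*d*e^2)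
     + a^2*q*(1 - q*e) * ((1 - b*c*e)*(1 - b*d*e)*(1 - c*d*e)) * (1 - a*b*c*d*q^2*e^2)"
  by algebra

lemma AW_R_L:
  assumes q: "0 < q" "q < 1" and lg: "log_branch q lg"
    and nz: "a \<noteq> 0" "b \<noteq> 0" "c \<noteq> 0" "d \<noteq> 0" "z \<noteq> 0"
    and L: "L_defined q a b c d \<gamma>" and R: "\<forall>g\<in>{\<gamma> - 1, \<gamma>, \<gamma> + 1}. R_defined q a b c d g z"
  shows "L_op q a b c d (\<lambda>g. AW_R q lg a b c d g z) \<gamma> = (z + 1 / z) * AW_R q lg a b c d \<gamma> z"
proof -
  define Q where "Q = complex_of_real q"
  define e where "e = qpow q (\<gamma> - 1)"
  note qs = qpow_shift[OF q(1) Q_def e_def]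
  have Q0: "Q \<noteq> 0" using q by (simp add: Q_def)
  define al where "al = b*c*d / (Q*z)"
  define x where "x = Q*z/a"
  \<comment> \<open>\<open>m\<close> and \<open>n\<close> are chosen such that \<open>Q*m\<close>
    and \<open>Q*n\<close> are the parameters abcd q^(\<gamma>-1) and q^(-\<gamma>). Raising
    \<gamma> by one then gives \<open>Q*(Q*m)\<close> and \<open>n\<close>, and \<open>T\<close> is
    determined by \<open>al = Q*m*n*T\<close>.\<close>
  define m where "m = a*b*c*d*e/Q"
  define n where "n = 1/(Q*(Q*e))"
  define T where "T = Q/(a*z)"
  have al0: "al \<noteq> 0" using nz Q0 by (simp add: al_def)
  define W where "W g = W87 q al (b/z) (c/z) (d/z) (a*b*c*d * qpow q (g - 1)) (qpow q (- g)) x" for g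
  have Wd: "W87_defined q al (b/z) (c/z) (d/z) (a*b*c*d * qpow q (g - 1)) (qpow q (- g)) x"
    if "g \<in> {\<gamma> - 1, \<gamma>, \<gamma> + 1}" for g
    using R that by (auto simp: R_defined_def al_def x_def Q_def)
  have Weq: "(1 - al) * W g = qcont q (vwp q al [al, b/z, c/z, d/z, a*b*c*d * qpow q (g - 1), qpow q (- g)]) x"
    if "g \<in> {\<gamma> - 1, \<gamma>, \<gamma> + 1}" for g
    unfolding W_def by (rule W87_eq_vwp[OF q Wd[OF that] al0])
  have W0: "(1 - al) * W \<gamma> = qcont q (vwp q al [al, b/z, c/z, d/z, Q*m, Q*n]) x"
    using Weq[of \<gamma>] unfolding qs using Q0 by (simp add: m_def n_def)
  have Wp: "(1 - al) * W (\<gamma> + 1) = qcont q (vwp q al [al, b/z, c/z, d/z, Q*(Q*m), n]) x"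
    using Weq[of "\<gamma> + 1"] unfolding qs using Q0 by (simp add: m_def n_def mult_ac)
  have Wm: "(1 - al) * W (\<gamma> - 1) = qcont q (vwp q al [al, b/z, c/z, d/z, m, Q*(Q*n)]) x"
    using Weq[of "\<gamma> - 1"] unfolding qs using Q0 by (simp add: m_def n_def)
  note D0 = W87_defined_nonzero[OF Wd[of \<gamma>], folded Q_def]
  have al1: "1 - al \<noteq> 0" and x: "x \<notin> W87_poles q" using D0(7,9) by auto
  \<comment> \<open>The least shifted denominators are those of the neighbouring series, so their
    nonvanishing is taken from the definedness at \<gamma> + 1 and, in \<open>denm\<close>, at
    \<gamma> - 1.\<close>
  have denp: "qpoch q (n*T) k \<noteq> 0" for k
  proof -
    have "complex_of_real q * al / (a*b*c*d * qpow q (\<gamma> + 1 - 1)) = n*T"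
      unfolding qs unfolding Q_def[symmetric] using nz Q0 qs(1) by (simp add: al_def n_def T_def divide_simps)
    thus ?thesis using W87_defined_nonzero(4)[OF Wd[of "\<gamma> + 1"], of k] by simp
  qed
  have denm: "qpoch q (m*T) k \<noteq> 0" for k
  proof -
    have "complex_of_real q * al / qpow q (- (\<gamma> - 1)) = m*T"
      unfolding qs unfolding Q_def[symmetric] using nz Q0 qs(1) by (simp add: al_def m_def T_def divide_simps)
    thus ?thesis using W87_defined_nonzero(5)[OF Wd[of "\<gamma> - 1"], of k] by simp
  qed
  define X0 X1 X2 where X: "X0 = 1 - a*b*c*d*e^2" "X1 = 1 - a*b*c*d*Q*e^2" "X2 = 1 - a*b*c*d*Q^2*e^2"
  have X0: "X0 \<noteq> 0" "X1 \<noteq> 0" "X2 \<noteq> 0"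
    using L unfolding L_defined_def qs X by (auto simp: mult.assoc)
  have mn: "n - m = X1/(Q*(Q*e))" "n - Q*m = X2/(Q*(Q*e))" "m - Q*n = - (X0/(Q*e))"
    using Q0 qs(1) by (simp_all add: m_def n_def X field_simps power2_eq_square)
  define d0' d1' n0' n1' where P: "d0' = (1 - b*c*e)*(1 - b*d*e)*(1 - c*d*e)"
    "d1' = (1 - b*c*(Q*e))*(1 - b*d*(Q*e))*(1 - c*d*(Q*e))"
    "n0' = (1 - a*b*e)*(1 - a*c*e)*(1 - a*d*e)" "n1' = (1 - a*b*(Q*e))*(1 - a*c*(Q*e))*(1 - a*d*(Q*e))"
  define gp where "gp = n * (1 - Q*T*m/(b/z))*(1 - Q*T*m/(c/z))*(1 - Q*T*m/(d/z)) / ((n - Q*m)*(n - m))"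
  define gm where "gm = m * (1 - Q*T*n/(b/z))*(1 - Q*T*n/(c/z))*(1 - Q*T*n/(d/z)) / ((m - Q*n)*(n - m))"
  have gp': "gp = Q*(Q*e)*d1'/(X1*X2)"
  proof -
    have t: "Q*T*m/(b/z) = c*d*(Q*e)" "Q*T*m/(c/z) = b*d*(Q*e)" "Q*T*m/(d/z) = b*c*(Q*e)"
      using nz Q0 by (simp_all add: T_def m_def)
    show ?thesis unfolding gp_def t mn P using Q0 qs(1) X0 by (simp add: n_def divide_simps)
  qed
  have gm': "gm = Q^2*n0'/(a^2*(X0*X1))"
  proof -
    have t: "1 - Q*T*n/(b/z) = - (1 - a*b*e)/(a*b*e)" "1 - Q*T*n/(c/z) = - (1 - a*c*e)/(a*c*e)"
      "1 - Q*T*n/(d/z) = - (1 - a*d*e)/(a*d*e)"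
      using nz Q0 qs(1) by (simp_all add: T_def n_def field_simps)
    show ?thesis unfolding gm_def t mn P
      by (simp add: nz Q0 qs(1) X0 m_def divide_simps power2_eq_square) algebra
  qed
  define cc where "cc = (1 - T)*(x - 1) - (1 - n)*gp + (1 - m)*gm"
  have "gp * ((1 - Q*m)*(1 - n*T)*(1 - Q*(n*T))) * qcont q (vwp q al [al, b/z, c/z, d/z, Q*(Q*m), n]) x
    + cc * ((1 - Q*(n*T))*(1 - Q*(m*T))) * qcont q (vwp q al [al, b/z, c/z, d/z, Q*m, Q*n]) x
    - gm * ((1 - Q*n)*(1 - m*T)*(1 - Q*(m*T))) * qcont q (vwp q al [al, b/z, c/z, d/z, m, Q*(Q*n)]) x = 0"
    unfolding cc_def
  proof (rule vwp_contiguous_pair[where q = q, folded Q_def])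
    show "al = Q*m*n*T" "x*(b/z)*(c/z)*(d/z) = m*n*Q^2*T^2"
      using nz Q0 qs(1) by (simp_all add: al_def m_def n_def T_def x_def divide_simps power2_eq_square)
    show "m \<noteq> 0" "n \<noteq> 0" "T \<noteq> 0" using nz Q0 qs(1) by (simp_all add: m_def n_def T_def)
    show "n - m \<noteq> 0" "n - Q*m \<noteq> 0" "m - Q*n \<noteq> 0" unfolding mn using X0 Q0 qs(1) by auto
  qed (use q x nz D0 denp denm gp_def gm_def in auto)
  hence "(1 - al) * (gp * ((1 - Q*m)*(1 - n*T)*(1 - Q*(n*T))) * W (\<gamma> + 1)
    + cc * ((1 - Q*(n*T))*(1 - Q*(m*T))) * W \<gamma>
    - gm * ((1 - Q*n)*(1 - m*T)*(1 - Q*(m*T))) * W (\<gamma> - 1)) = 0"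
    unfolding W0[symmetric] Wp[symmetric] Wm[symmetric] by (simp add: algebra_simps)
  hence rel: "gp * ((1 - Q*m)*(1 - n*T)*(1 - Q*(n*T))) * W (\<gamma> + 1)
    + cc * ((1 - Q*(n*T))*(1 - Q*(m*T))) * W \<gamma>
    - gm * ((1 - Q*n)*(1 - m*T)*(1 - Q*(m*T))) * W (\<gamma> - 1) = 0" using al1 by simp
  define Av Cv where AC: "Av = AW_A q a b c d \<gamma>" "Cv = AW_C q a b c d \<gamma>"
  have Av: "Av = n1'*(1 - a*b*c*d*e)/(a*(X1*X2))"
    unfolding AC AW_A_def qs P X by (simp add: mult.assoc)
  have Cv: "Cv = a*(1 - Q*e)*d0'/(X0*X1)"
    unfolding AC AW_C_def qs P X by (simp add: mult.assoc)
  have cc: "cc = - (Q/a)*(a + 1/a - (Av + Cv) - (z + 1/z))"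
  proof -
    have "(a^2*X0*X1*X2) * (cc + (Q/a)*(a + 1/a - (Av + Cv) - (z + 1/z))) =
       (Q - 1) * (a^2 - Q) * X0 * X1 * X2 + a^2*(1 - Q*(Q*e)) * d1' * X0 + (Q^2 - Q*(a*b*c*d*e)) * n0' * X2
       - (Q * n1' * (1 - a*b*c*d*e) * X0 + a^2*Q*(1 - Q*e) * d0' * X2)"
    proof -
      have 1: "(a^2*X0*X1*X2) * ((1 - n)*gp) = - (a^2*(1 - Q*(Q*e)) * d1' * X0)"
        unfolding gp' using X0 Q0 qs(1) by (simp add: n_def field_simps)
      have 2: "(a^2*X0*X1*X2) * ((1 - m)*gm) = (Q^2 - Q*(a*b*c*d*e)) * n0' * X2"
        unfolding gm' using X0 Q0 nz by (simp add: m_def field_simps power2_eq_square)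
      have 3: "(a^2*X0*X1*X2) * ((Q/a)*Av) = Q * n1' * (1 - a*b*c*d*e) * X0"
        unfolding Av using X0 nz by (simp add: field_simps power2_eq_square)
      have 4: "(a^2*X0*X1*X2) * ((Q/a)*Cv) = a^2*Q*(1 - Q*e) * d0' * X2"
        unfolding Cv using X0 nz by (simp add: field_simps power2_eq_square)
      have 5: "a^2 * ((1 - T)*(x - 1) + (Q/a)*(a + 1/a - (z + 1/z))) = (Q - 1) * (a^2 - Q)"
        using nz by (simp add: T_def x_def field_simps power2_eq_square)
      have "(a^2*X0*X1*X2) * (cc + (Q/a)*(a + 1/a - (Av + Cv) - (z + 1/z))) =
         (a^2 * ((1 - T)*(x - 1) + (Q/a)*(a + 1/a - (z + 1/z)))) * X0 * X1 * X2
         - (a^2*X0*X1*X2) * ((1 - n)*gp) + (a^2*X0*X1*X2) * ((1 - m)*gm)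
         - (a^2*X0*X1*X2) * ((Q/a)*Av) - (a^2*X0*X1*X2) * ((Q/a)*Cv)"
        unfolding cc_def by algebra
      thus ?thesis unfolding 1 2 3 4 5 by simp
    qed
    also have "\<dots> = 0" using AW_R_L_identity[of Q a b c d e] unfolding X P by simp
    finally have "cc + (Q/a)*(a + 1/a - (Av + Cv) - (z + 1/z)) = 0" using X0 nz by simp
    thus ?thesis by (simp add: eq_neg_iff_add_eq_0)
  qed
  define nb where "nb e' = qpochs_inf q [a*b*e', a*c*e', a*d*e', b*c*d*e'/z]" for e'
  define db where "db e' = qpochs_inf q [b*c*e', b*d*e', c*d*e', a*z*e']" for e'
  have nS: "nb y = (1 - a*b*y)*(1 - a*c*y)*(1 - a*d*y)*(1 - b*c*d*y/z) * nb (Q*y)" for y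
    unfolding nb_def qpochs_inf_Cons qpochs_inf_Nil Q_def
    by (subst qpoch_inf_Suc[OF q, of "a*b*y"], subst qpoch_inf_Suc[OF q, of "a*c*y"],
        subst qpoch_inf_Suc[OF q, of "a*d*y"], subst qpoch_inf_Suc[OF q, of "b*c*d*y/z"]) (simp add: mult_ac)
  have dS: "db y = (1 - b*c*y)*(1 - b*d*y)*(1 - c*d*y)*(1 - a*z*y) * db (Q*y)" for y
    unfolding db_def qpochs_inf_Cons qpochs_inf_Nil Q_def
    by (subst qpoch_inf_Suc[OF q, of "b*c*y"], subst qpoch_inf_Suc[OF q, of "b*d*y"],
        subst qpoch_inf_Suc[OF q, of "c*d*y"], subst qpoch_inf_Suc[OF q, of "a*z*y"]) (simp add: mult_ac)
  have db0: "db e \<noteq> 0" using R qs unfolding R_defined_def db_def by auto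
  \<comment> \<open>Numerator products at the highest shift and denominator products at the lowest:
    relative to \<open>K\<close> the prefactors of the three values are polynomials in the shift
    factors and \<open>a/z\<close>.\<close>
  define K where "K = qpochs_inf q [a*z] / qpochs_inf q [b*c*d/z] * nb (Q*(Q*e)) / db e * bpow lg (a/z) (\<gamma> - 1)"
  define w0 w1 where w: "w0 = (1 - a*z*e)" "w1 = (1 - a*z*(Q*e))"
  define t0 t1 where t: "t0 = (1 - b*c*d*e/z)" "t1 = (1 - b*c*d*(Q*e)/z)"
  have az: "a/z \<noteq> 0" using nz by simp
  have bp: "bpow lg (a/z) \<gamma> = a/z * bpow lg (a/z) (\<gamma> - 1)"
    "bpow lg (a/z) (\<gamma> + 1) = a/z * (a/z * bpow lg (a/z) (\<gamma> - 1))"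
    using bpow_add1[OF lg az, of "\<gamma> - 1"] bpow_add1[OF lg az, of \<gamma>] by simp_all
  have db1: "db e = d0'*w0 * db (Q*e)" "db (Q*e) = d1'*w1 * db (Q*(Q*e))"
    using dS[of e] dS[of "Q*e"] by (simp_all add: P w)
  have nb1: "nb e = n0'*t0 * nb (Q*e)" "nb (Q*e) = n1'*t1 * nb (Q*(Q*e))"
    using nS[of e] nS[of "Q*e"] by (simp_all add: P t)
  have Rg: "AW_R q lg a b c d g z = qpochs_inf q [a*z] / qpochs_inf q [b*c*d/z] * (nb (qpow q g) / db (qpow q g) * bpow lg (a/z) g * W g)" for g
    unfolding AW_R_def AW_r_def nb_def db_def W_def al_def x_def Q_def by simp
  have nzs: "d0' \<noteq> 0" "w0 \<noteq> 0" "d1' \<noteq> 0" "w1 \<noteq> 0" "db (Q*(Q*e)) \<noteq> 0"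
    using db0 unfolding db1 by auto
  have Rp: "AW_R q lg a b c d (\<gamma> + 1) z = K * (d0'*w0*(d1'*w1)*(a/z)^2) * W (\<gamma> + 1)"
    unfolding Rg qs K_def bp db1 using nzs by (simp add: power2_eq_square mult_ac)
  have R0: "AW_R q lg a b c d \<gamma> z = K * (n1'*t1*(d0'*w0)*(a/z)) * W \<gamma>"
    unfolding Rg qs K_def bp db1 nb1 using nzs by (simp add: mult_ac)
  have Rm: "AW_R q lg a b c d (\<gamma> - 1) z = K * (n0'*t0*(n1'*t1)) * W (\<gamma> - 1)"
    unfolding Rg qs K_def nb1 by (simp add: mult_ac)
  \<comment> \<open>The ratio between an operator coefficient with its prefactor and the matching
    coefficient of the contiguous relation. The facts \<open>e1\<close>, \<open>e2\<close> and
    \<open>e0\<close> show that it is the same for all three terms.\<close>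
  define th where "th = a^3*e/Q * (n1'*d0')"
  have e1: "Av * (d0'*w0*(d1'*w1)*(a/z)^2) = th * (gp * ((1 - Q*m)*(1 - n*T)*(1 - Q*(n*T))))"
  proof -
    have r: "1 - n*T = - w1/(a*z*(Q*e))" "1 - Q*(n*T) = - w0/(a*z*e)" "1 - Q*m = 1 - a*b*c*d*e"
      using nz Q0 qs(1) by (simp_all add: n_def T_def w m_def field_simps)
    show ?thesis unfolding r th_def gp' Av using nz Q0 qs(1) X0
      by (simp add: divide_simps power2_eq_square power3_eq_cube)
  qed
  have e2: "Cv * (n0'*t0*(n1'*t1)) = - (th * (gm * ((1 - Q*n)*(1 - m*T)*(1 - Q*(m*T)))))"
  proof -
    have r: "1 - Q*n = - (1 - Q*e)/(Q*e)" "1 - m*T = t0" "1 - Q*(m*T) = t1"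
      using nz Q0 qs(1) by (simp_all add: n_def T_def t m_def field_simps)
    show ?thesis unfolding r th_def gm' Cv
      by (simp add: nz Q0 qs(1) X0 divide_simps power2_eq_square power3_eq_cube) algebra
  qed
  have e0: "(AW_B q a b c d \<gamma> - (z + 1/z)) * (n1'*t1*(d0'*w0)*(a/z)) = th * (cc * ((1 - Q*(n*T))*(1 - Q*(m*T))))"
  proof -
    have r: "1 - Q*(n*T) = - w0/(a*z*e)" "1 - Q*(m*T) = t1"
      using nz Q0 qs(1) by (simp_all add: n_def T_def w t m_def field_simps)
    show ?thesis unfolding r th_def cc AW_B_def AC[symmetric] using nz Q0 qs(1)
      by (simp add: divide_simps power2_eq_square power3_eq_cube)
  qed
  have "L_op q a b c d (\<lambda>g. AW_R q lg a b c d g z) \<gamma> - (z + 1/z) * AW_R q lg a b c d \<gamma> z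
     = K * ((Av * (d0'*w0*(d1'*w1)*(a/z)^2)) * W (\<gamma> + 1) + ((AW_B q a b c d \<gamma> - (z + 1/z)) * (n1'*t1*(d0'*w0)*(a/z))) * W \<gamma>
        + (Cv * (n0'*t0*(n1'*t1))) * W (\<gamma> - 1))"
    unfolding L_op_def AC[symmetric] Rp R0 Rm by (simp add: algebra_simps)
  also have "\<dots> = K * th * (gp * ((1 - Q*m)*(1 - n*T)*(1 - Q*(n*T))) * W (\<gamma> + 1)
    + cc * ((1 - Q*(n*T))*(1 - Q*(m*T))) * W \<gamma>
    - gm * ((1 - Q*n)*(1 - m*T)*(1 - Q*(m*T))) * W (\<gamma> - 1))"
    unfolding e0 e1 e2 by algebra
  finally show ?thesis unfolding rel by simp
qed

section \<open>The recurrence in \<gamma> for \<open>AW_S\<close>\<close>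

lemma qpow_add1: "0 < q \<Longrightarrow> qpow q (t + 1) = of_real q * qpow q t"
  by (simp add: powr_add)

lemma qpow_double: "qpow q (2*t) = (qpow q t)^2"
  using powr_add[of "complex_of_real q" t t] by (simp add: power2_eq_square)

lemma AW_S_L:
  assumes q: "0 < q" "q < 1" and lg: "log_branch q lg"
    and nz: "a \<noteq> 0" "b \<noteq> 0" "c \<noteq> 0" "d \<noteq> 0" "z \<noteq> 0"
    and L: "L_defined q a b c d \<gamma>" and S: "\<forall>g\<in>{\<gamma> - 1, \<gamma>, \<gamma> + 1}. S_defined q a b c d g z"
  shows "L_op q a b c d (\<lambda>g. AW_S q lg a b c d g z) \<gamma> = (z + 1 / z) * AW_S q lg a b c d \<gamma> z"
proof -
  define Q where "Q = complex_of_real q"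
  define e where "e = qpow q (\<gamma> - 1)"
  note qs = qpow_shift[OF q(1) Q_def e_def]
  have Q0: "Q \<noteq> 0" and Q1: "1 - Q \<noteq> 0" using q by (auto simp: Q_def)
  define x where "x = a*z"
  define n where "n = z/a"
  define al where "al y = b*c*d*z*y^2" for y
  define W where "W y = W87 q (al y) (b*c*y) (b*d*y) (c*d*y) (Q*y) (z*Q/a) x" for y
  define nb where "nb y = qpochs_inf q [a*b*c*d*y^2, b*z*(Q*y), c*z*(Q*y), d*z*(Q*y), b*c*d*z*y]" for y
  define db where "db y = qpochs_inf q [b*c*y, b*d*y, c*d*y, Q*y, b*c*d*z*(Q*y^2)]" for y
  have Wd: "W87_defined q (al y) (b*c*y) (b*d*y) (c*d*y) (Q*y) (z*Q/a) x" and db0: "db y \<noteq> 0"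
    if "y \<in> {e, Q*e, Q*(Q*e)}" for y
  proof -
    have "\<exists>g\<in>{\<gamma> - 1, \<gamma>, \<gamma> + 1}. qpow q g = y"
      unfolding bex_simps qs using that by auto
    then obtain g where g: "g \<in> {\<gamma> - 1, \<gamma>, \<gamma> + 1}" "qpow q g = y" by (rule bexE)
    have "S_defined q a b c d g z" using S g(1) by blast
    thus "W87_defined q (al y) (b*c*y) (b*d*y) (c*d*y) (Q*y) (z*Q/a) x" "db y \<noteq> 0"
      unfolding S_defined_def qpow_add1[OF q(1)] qpow_double g(2) al_def x_def db_def Q_def by simp_all
  qed
  have yz: "y \<noteq> 0" if "y \<in> {e, Q*e, Q*(Q*e)}" for y using that Q0 qs(1) by auto
  have Weq: "(1 - al y) * W y = qcont q (vwp q (al y) [al y, b*c*y, b*d*y, c*d*y, Q*y, z*Q/a]) x"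
    if "y \<in> {e, Q*e, Q*(Q*e)}" for y
    unfolding W_def by (rule W87_eq_vwp[OF q Wd[OF that]]) (use yz[OF that] nz in \<open>simp add: al_def\<close>)
  \<comment> \<open>The lowest of the three series, at \<gamma> - 1, provides the base
    \<open>w\<close> and the parameters \<open>c1\<close>, ..., \<open>c4\<close>. A unit step in
    \<gamma> multiplies these parameters by \<open>Q\<close> and the base by \<open>Q^2\<close>,
    while \<open>z*Q/a = Q*n\<close> stays fixed; \<open>mu\<close> is \<open>w/n\<close>.\<close>
  define w mu where wm: "w = al e" "mu = a*b*c*d*e^2"
  define c1 c2 c3 c4 where cs: "c1 = b*c*e" "c2 = b*d*e" "c3 = c*d*e" "c4 = Q*e"
  have Qn: "z*Q/a = Q*n" by (simp add: n_def)
  have Wp: "(1 - al (Q*(Q*e))) * W (Q*(Q*e)) = qcont q (vwp q (Q*(Q*(Q*(Q*w)))) [Q*(Q*(Q*(Q*w))), Q*(Q*c1), Q*(Q*c2), Q*(Q*c3), Q*(Q*c4), Q*n]) x"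
    using Weq[of "Q*(Q*e)"] by (simp add: wm cs al_def n_def power2_eq_square mult_ac)
  have W0: "(1 - al (Q*e)) * W (Q*e) = qcont q (vwp q (Q*(Q*w)) [Q*(Q*w), Q*c1, Q*c2, Q*c3, Q*c4, Q*n]) x"
    using Weq[of "Q*e"] by (simp add: wm cs al_def n_def power2_eq_square mult_ac)
  have Wm: "(1 - al e) * W e = qcont q (vwp q w [w, c1, c2, c3, c4, Q*n]) x"
    using Weq[of e] by (simp add: wm cs Qn)
  have nz': "c1 \<noteq> 0" "c2 \<noteq> 0" "c3 \<noteq> 0" "c4 \<noteq> 0" "n \<noteq> 0" "mu \<noteq> 0" "w \<noteq> 0" "x \<noteq> 0"
    using nz Q0 qs(1) by (simp_all add: cs n_def wm al_def x_def)
  have den: "qpoch q (Q*w/c1) k \<noteq> 0" "qpoch q (Q*w/c2) k \<noteq> 0" "qpoch q (Q*w/c3) k \<noteq> 0"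
      "qpoch q (Q*w/c4) k \<noteq> 0" "qpoch q mu k \<noteq> 0" and w0: "1 - w \<noteq> 0" and x: "x \<notin> W87_poles q" for k
  proof -
    note D = W87_defined_nonzero[OF Wd[of e], folded Q_def cs wm]
    have "Q*w/(z*Q/a) = mu" using nz Q0 by (simp add: wm al_def power2_eq_square)
    thus "qpoch q mu k \<noteq> 0" using D(5)[of k] by simp
    show "qpoch q (Q*w/c1) k \<noteq> 0" "qpoch q (Q*w/c2) k \<noteq> 0" "qpoch q (Q*w/c3) k \<noteq> 0" "qpoch q (Q*w/c4) k \<noteq> 0"
      using D(1-4)[of k] by simp_all
    show "1 - w \<noteq> 0" "x \<notin> W87_poles q" using D(7,9) by simp_all
  qed
  have ph: "1 - y \<noteq> 0" "1 - Q*(Q*y) \<noteq> 0" if "qpoch_inf q y \<noteq> 0" for y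
    using qpoch_inf_nonzeroD(2)[OF q that, of 0] qpoch_inf_nonzeroD(2)[OF q that, of 2]
    by (simp_all add: Q_def power2_eq_square mult_ac)
  have dbe: "qpoch_inf q c1 \<noteq> 0" "qpoch_inf q c2 \<noteq> 0" "qpoch_inf q c3 \<noteq> 0" "qpoch_inf q c4 \<noteq> 0" "qpoch_inf q (Q*w) \<noteq> 0"
    using db0[of e] by (simp_all add: db_def cs wm al_def mult_ac)
  have ww: "1 - Q*w \<noteq> 0" "1 - Q*(Q*(Q*w)) \<noteq> 0" using ph[OF dbe(5)] by simp_all
  have w2: "1 - Q*(Q*w) \<noteq> 0"
    using W87_defined_nonzero(7)[OF Wd[of "Q*e"]] by (simp add: wm al_def power2_eq_square mult_ac)
  have cn: "1 - c1 \<noteq> 0" "1 - c2 \<noteq> 0" "1 - c3 \<noteq> 0" "1 - c4 \<noteq> 0" using ph(1) dbe(1-4) by blast+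
  define gp where "gp = - ((1 - Q*mu/c1)*(1 - Q*mu/c2)*(1 - Q*mu/c3)*(1 - Q*mu/c4)) / ((1 - Q*(Q*mu))*(1 - Q*mu))"
  define gm where "gm = - (Q*mu^2*((1 - 1/c1)*(1 - 1/c2)*(1 - 1/c3)*(1 - 1/c4))) / ((1 - mu)*(1 - Q*mu))"
  define cc where "cc = (1 - 1/n)*(x - 1) - gp - gm"
  define cP cP' gP gP' where P: "cP = (1 - c1)*(1 - c2)*(1 - c3)*(1 - c4)"
    "cP' = (1 - Q*c1)*(1 - Q*c2)*(1 - Q*c3)*(1 - Q*c4)"
    "gP = (1 - Q*w/c1)*(1 - Q*w/c2)*(1 - Q*w/c3)*(1 - Q*w/c4)"
    "gP' = (1 - Q*(Q*w/c1))*(1 - Q*(Q*w/c2))*(1 - Q*(Q*w/c3))*(1 - Q*(Q*w/c4))"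
  have "gp * (cP' / gP') * ((1 - Q)*(1 - Q*(Q*w))*(1 - Q*(Q*(Q*w))) / (1 - Q*(Q*(Q*mu)))) * x
      * qcont q (vwp q (Q*(Q*(Q*(Q*w)))) [Q*(Q*(Q*(Q*w))), Q*(Q*c1), Q*(Q*c2), Q*(Q*c3), Q*(Q*c4), Q*n]) x
    + cc * ((1 - Q)*(1 - Q*(Q*mu))) * qcont q (vwp q (Q*(Q*w)) [Q*(Q*w), Q*c1, Q*c2, Q*c3, Q*c4, Q*n]) x
    + gm * (gP / cP) * ((1 - Q)*(1 - mu)*(1 - Q*mu)*(1 - Q*(Q*mu)) / ((1 - w)*(1 - Q*w))) / x
      * qcont q (vwp q w [w, c1, c2, c3, c4, Q*n]) x = 0"
    unfolding P cc_def
  proof (rule vwp_contiguous_base[where q = q, folded Q_def])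
    show "w = n*mu" using nz by (simp add: wm n_def al_def)
    show "x*(c1*c2*c3*c4) = Q*n*mu^2" using nz by (simp add: cs wm n_def x_def power2_eq_square)
  qed (use q x nz' den w0 ww w2 cn gp_def gm_def in auto)
  hence rel: "gp * (cP' / gP') * ((1 - Q)*(1 - Q*(Q*w))*(1 - Q*(Q*(Q*w))) / (1 - Q*(Q*(Q*mu)))) * x * ((1 - Q*(Q*(Q*(Q*w)))) * W (Q*(Q*e)))
    + cc * ((1 - Q)*(1 - Q*(Q*mu))) * ((1 - Q*(Q*w)) * W (Q*e))
    + gm * (gP / cP) * ((1 - Q)*(1 - mu)*(1 - Q*mu)*(1 - Q*(Q*mu)) / ((1 - w)*(1 - Q*w))) / x * ((1 - w) * W e) = 0"
    unfolding Wp[symmetric] W0[symmetric] Wm[symmetric] by (simp add: wm al_def power2_eq_square mult_ac)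
  have X: "1 - mu = 1 - a*b*c*d*e^2" "1 - Q*mu = 1 - a*b*c*d*(Q*e^2)" "1 - Q*(Q*mu) = 1 - a*b*c*d*(Q^2*e^2)"
    by (simp_all add: wm power2_eq_square mult_ac)
  have X0: "1 - mu \<noteq> 0" "1 - Q*mu \<noteq> 0" "1 - Q*(Q*mu) \<noteq> 0"
    using L unfolding L_defined_def qs X by auto
  \<comment> \<open>Here the contiguous coefficients are the Askey-Wilson coefficients up to the
    factor \<open>-a\<close>, directly and without a further polynomial identity: the product
    \<open>(1 - 1/n)*(x - 1)\<close> is exactly \<open>-a*(a + 1/a - z - 1/z)\<close>.\<close>
  have A: "a * AW_A q a b c d \<gamma> = - gp"
  proof -
    have t: "Q*mu/c1 = a*d*(Q*e)" "Q*mu/c2 = a*c*(Q*e)" "Q*mu/c3 = a*b*(Q*e)" "Q*mu/c4 = a*b*c*d*e"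
      using nz Q0 qs(1) by (simp_all add: cs wm power2_eq_square)
    show ?thesis unfolding gp_def t AW_A_def qs X[symmetric] using nz X0 by (simp add: mult_ac)
  qed
  have C: "a * AW_C q a b c d \<gamma> = - gm"
  proof -
    have t: "Q*mu^2*((1 - 1/c1)*(1 - 1/c2)*(1 - 1/c3)*(1 - 1/c4)) = a^2*((1 - Q*e)*(1 - b*c*e)*(1 - b*d*e)*(1 - c*d*e))"
      by (simp add: cs wm nz Q0 qs(1) divide_simps power2_eq_square) algebra
    show ?thesis unfolding gm_def t AW_C_def qs X[symmetric] using nz X0
      by (simp add: mult_ac power2_eq_square)
  qed
  have B: "a * (AW_B q a b c d \<gamma> - (z + 1/z)) = - cc"
  proof -
    have "a * (AW_B q a b c d \<gamma> - (z + 1/z)) = a*(a + 1/a - (z + 1/z)) - a * AW_A q a b c d \<gamma> - a * AW_C q a b c d \<gamma>"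
      by (simp add: AW_B_def algebra_simps)
    also have "a*(a + 1/a - (z + 1/z)) = - ((1 - 1/n)*(x - 1))"
      using nz by (simp add: n_def x_def field_simps)
    finally show ?thesis unfolding A C cc_def by simp
  qed
  have sh: "qpoch_inf q y = (1 - y) * qpoch_inf q (Q*y)" for y unfolding Q_def by (rule qpoch_inf_Suc[OF q])
  have nS: "nb y = (1 - a*b*c*d*y^2)*(1 - Q*(a*b*c*d*y^2))*((1 - d*z*(Q*y))*(1 - c*z*(Q*y))*(1 - b*z*(Q*y))*(1 - b*c*d*z*y)) * nb (Q*y)" for y
    unfolding nb_def qpochs_inf_Cons qpochs_inf_Nil
    using sh[of "a*b*c*d*y^2"] sh[of "Q*(a*b*c*d*y^2)"] sh[of "b*z*(Q*y)"] sh[of "c*z*(Q*y)"] sh[of "d*z*(Q*y)"] sh[of "b*c*d*z*y"]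
    by (simp add: power2_eq_square mult_ac)
  have dS: "db y = (1 - b*c*y)*(1 - b*d*y)*(1 - c*d*y)*(1 - Q*y)*((1 - b*c*d*z*(Q*y^2))*(1 - Q*(b*c*d*z*(Q*y^2)))) * db (Q*y)" for y
    unfolding db_def qpochs_inf_Cons qpochs_inf_Nil
    using sh[of "b*c*y"] sh[of "b*d*y"] sh[of "c*d*y"] sh[of "Q*y"] sh[of "b*c*d*z*(Q*y^2)"] sh[of "Q*(b*c*d*z*(Q*y^2))"]
    by (simp add: power2_eq_square mult_ac)
  define C0 where "C0 = bpow lg z (- 1 + lg (a*b*c*d) / ln q) * qpochs_inf q [a*z] / qpochs_inf q [z*q / a, z*q / b, z*q / c, z*q / d]"
  define K where "K = C0 * nb (Q*(Q*e)) / db e * bpow lg x (\<gamma> - 1)"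
  have Sg: "AW_S q lg a b c d g z = C0 * (nb (qpow q g) / db (qpow q g) * bpow lg x g * W (qpow q g))" for g
    unfolding AW_S_def AW_s_def nb_def db_def W_def al_def x_def Q_def C0_def qpow_add1[OF q(1)] qpow_double by simp
  have bp: "bpow lg x \<gamma> = x * bpow lg x (\<gamma> - 1)" "bpow lg x (\<gamma> + 1) = x * (x * bpow lg x (\<gamma> - 1))"
    using bpow_add1[OF lg nz'(8), of "\<gamma> - 1"] bpow_add1[OF lg nz'(8), of \<gamma>] by simp_all
  have g: "Q*w/c1 = d*z*(Q*e)" "Q*w/c2 = c*z*(Q*e)" "Q*w/c3 = b*z*(Q*e)" "Q*w/c4 = b*c*d*z*e"
    using nz Q0 qs(1) by (simp_all add: cs wm al_def power2_eq_square)
  have db1: "db e = cP*((1 - Q*w)*(1 - Q*(Q*w))) * db (Q*e)"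
    "db (Q*e) = cP'*((1 - Q*(Q*(Q*w)))*(1 - Q*(Q*(Q*(Q*w))))) * db (Q*(Q*e))"
    unfolding dS[of e] dS[of "Q*e"] by (simp_all add: P cs wm al_def power2_eq_square mult_ac)
  have nb1: "nb e = (1 - mu)*(1 - Q*mu)*gP * nb (Q*e)"
    "nb (Q*e) = (1 - Q*(Q*mu))*(1 - Q*(Q*(Q*mu)))*gP' * nb (Q*(Q*e))"
    unfolding nS[of e] nS[of "Q*e"] P g by (simp_all add: wm power2_eq_square mult_ac)
  have mu3: "1 - Q*(Q*(Q*mu)) \<noteq> 0" and gP0: "gP' \<noteq> 0"
  proof -
    have "qpoch q mu k \<noteq> 0" for k by (rule den(5))
    from qpoch_shift_nonzero(3)[OF this, of 3] show "1 - Q*(Q*(Q*mu)) \<noteq> 0"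
      by (simp add: Q_def power3_eq_cube mult_ac)
    have h: "1 - Q*y \<noteq> 0" if "\<And>k. qpoch q y k \<noteq> 0" for y
      using qpoch_shift_nonzero(3)[OF that, of 1] by (simp add: Q_def mult_ac)
    show "gP' \<noteq> 0"
      unfolding P mult_eq_0_iff using h[OF den(1)] h[OF den(2)] h[OF den(3)] h[OF den(4)] by blast
  qed
  have nzs: "cP \<noteq> 0" "cP' \<noteq> 0" "1 - Q*(Q*(Q*(Q*w))) \<noteq> 0" "db (Q*(Q*e)) \<noteq> 0"
    using db0[of e] unfolding db1 by auto
  have Sp: "AW_S q lg a b c d (\<gamma> + 1) z
      = K * (cP*((1 - Q*w)*(1 - Q*(Q*w)))*(cP'*((1 - Q*(Q*(Q*w)))*(1 - Q*(Q*(Q*(Q*w))))))*x^2) * W (Q*(Q*e))"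
    unfolding Sg qs K_def bp db1 using nzs ww w2 by (simp add: power2_eq_square mult_ac)
  have S0: "AW_S q lg a b c d \<gamma> z
      = K * ((1 - Q*(Q*mu))*(1 - Q*(Q*(Q*mu)))*gP'*(cP*((1 - Q*w)*(1 - Q*(Q*w))))*x) * W (Q*e)"
    unfolding Sg qs K_def bp db1 nb1 using nzs ww w2 by (simp add: mult_ac)
  have Sm: "AW_S q lg a b c d (\<gamma> - 1) z
      = K * ((1 - mu)*(1 - Q*mu)*gP*((1 - Q*(Q*mu))*(1 - Q*(Q*(Q*mu)))*gP')) * W e"
    unfolding Sg qs K_def nb1 by (simp add: mult_ac)
  define th where "th = cP*(1 - Q*w)*gP'*(1 - Q*(Q*(Q*mu)))*x/(1 - Q)"
  have "a * (L_op q a b c d (\<lambda>g. AW_S q lg a b c d g z) \<gamma> - (z + 1/z) * AW_S q lg a b c d \<gamma> z)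
      = (a * AW_A q a b c d \<gamma>) * AW_S q lg a b c d (\<gamma> + 1) z + (a * (AW_B q a b c d \<gamma> - (z + 1/z))) * AW_S q lg a b c d \<gamma> z
        + (a * AW_C q a b c d \<gamma>) * AW_S q lg a b c d (\<gamma> - 1) z"
    unfolding L_op_def by (simp add: algebra_simps)
  also have "\<dots> = - K * (th * (gp * (cP' / gP') * ((1 - Q)*(1 - Q*(Q*w))*(1 - Q*(Q*(Q*w))) / (1 - Q*(Q*(Q*mu)))) * x * ((1 - Q*(Q*(Q*(Q*w)))) * W (Q*(Q*e)))
    + cc * ((1 - Q)*(1 - Q*(Q*mu))) * ((1 - Q*(Q*w)) * W (Q*e))
    + gm * (gP / cP) * ((1 - Q)*(1 - mu)*(1 - Q*mu)*(1 - Q*(Q*mu)) / ((1 - w)*(1 - Q*w))) / x * ((1 - w) * W e)))"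
  proof -
    have 1: "th * (gp * (cP' / gP') * ((1 - Q)*(1 - Q*(Q*w))*(1 - Q*(Q*(Q*w))) / (1 - Q*(Q*(Q*mu)))) * x * ((1 - Q*(Q*(Q*(Q*w)))) * W (Q*(Q*e))))
      = gp * ((cP*((1 - Q*w)*(1 - Q*(Q*w)))*(cP'*((1 - Q*(Q*(Q*w)))*(1 - Q*(Q*(Q*(Q*w))))))*x^2) * W (Q*(Q*e)))"
      unfolding th_def using gP0 mu3 Q1 by (simp add: power2_eq_square mult_ac)
    have 2: "th * (cc * ((1 - Q)*(1 - Q*(Q*mu))) * ((1 - Q*(Q*w)) * W (Q*e)))
      = cc * (((1 - Q*(Q*mu))*(1 - Q*(Q*(Q*mu)))*gP'*(cP*((1 - Q*w)*(1 - Q*(Q*w))))*x) * W (Q*e))"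
      unfolding th_def using Q1 by (simp add: mult_ac)
    have 3: "th * (gm * (gP / cP) * ((1 - Q)*(1 - mu)*(1 - Q*mu)*(1 - Q*(Q*mu)) / ((1 - w)*(1 - Q*w))) / x * ((1 - w) * W e))
      = gm * (((1 - mu)*(1 - Q*mu)*gP*((1 - Q*(Q*mu))*(1 - Q*(Q*(Q*mu)))*gP')) * W e)"
      unfolding th_def using nzs(1) Q1 ww w0 nz'(8) by (simp add: mult_ac)
    show ?thesis unfolding distrib_left[of th] 1 2 3 A B C Sp S0 Sm by algebra
  qed
  finally show ?thesis unfolding rel using nz by simp
qed

section \<open>The difference equations in z\<close>

text \<open>Arguments stand for \<open>r*E1\<close>, \<open>r*E3\<close>, \<open>E4\<close>,
  \<open>F*G\<close> and \<open>r*F + r*G\<close>. In both applications these are rational in the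
  original parameters although \<open>r\<close> is a square root, so \<open>r\<close> times the
  middle coefficient can be compared with the operator.\<close>

definition four_shift_mid_scaled :: "complex \<Rightarrow> complex \<Rightarrow> complex \<Rightarrow> complex \<Rightarrow> complex \<Rightarrow> complex \<Rightarrow> complex" where
  "four_shift_mid_scaled q e1 e3 E4 P f =
     (q*P - q^2*E4) * ((q^2*E4 - 1) * ((e3 - e1*E4) - (E4 - 1) * f) - (P - q^2*E4) * (E4 - 1) * e1)
     - (E4 - 1) * (P - 1) * (e1*P + q*f)
     + q^2 * (E4 - 1) * (P - 1) * (e3 + q*E4*f)
     + (P - q^2*E4) * (P - 1) * (E4 - 1) * (1 + q) * e1"

lemma four_shift_mid_scale:
  "r * four_shift_mid q E1 E3 E4 F G = four_shift_mid_scaled q (r*E1) (r*E3) E4 (F*G) (r*F + r*G)"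
  unfolding four_shift_mid_def four_shift_mid_scaled_def by algebra

text \<open>The right side is the common denominator times A(z) + A(1/z) + \<Lambda>: up to a
  monomial the middle coefficient of the contiguous relation is the middle coefficient of the
  eigenvalue equation. \<open>AW_S_B_identity\<close> plays the same role for the reflected
  relation.\<close>

lemma AW_R_B_identity:
  fixes a b c d z e q :: complex
  assumes nz: "a \<noteq> 0" "z \<noteq> 0" "e \<noteq> 0" "q \<noteq> 0"
  shows "a*z^3 * four_shift_mid_scaled q (b*c*d/(q^2*z) + (b + c + d)/(q*z)) ((b*c + b*d + c*d)/(q^2*z^2) + 1/(q*z^2))
      (1/(q*z^2)) (q/(a*z)) (1/(a*z*(q*e)) + b*c*d*e/z)
    = - ((1 - a*z)*(1 - b*z)*(1 - c*z)*(1 - d*z)*(1 - q/z^2)/z^2)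
      + (1 - a/z)*(1 - b/z)*(1 - c/z)*(1 - d/z)*(1 - q*z^2)
      + (1 - q*z^2)*(1 - 1/z^2)*(1 - q/z^2) * ((1 - q*e)*(1 - a*b*c*d*e)/(q*e))"
  unfolding four_shift_mid_scaled_def by (simp add: nz divide_simps) algebra

lemma AW_S_B_identity:
  fixes a b c d z e q :: complex
  assumes nz: "z \<noteq> 0" "e \<noteq> 0" "q \<noteq> 0"
  shows "z^2 * four_shift_mid_scaled q ((b*c + b*d + c*d)*e + q*e) (b*c*d*e/(q*z) + (b + c + d)*e/z)
      (1/(q*z^2)) (a/z) (1 + a*b*c*d*q*e^2)
    = q*e * (- ((1 - a*z)*(1 - b*z)*(1 - c*z)*(1 - d*z)*(1 - q/z^2)/z^2)
      + (1 - a/z)*(1 - b/z)*(1 - c/z)*(1 - d/z)*(1 - q*z^2)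
      + (1 - q*z^2)*(1 - 1/z^2)*(1 - q/z^2) * ((1 - q*e)*(1 - a*b*c*d*e)/(q*e)))"
  unfolding four_shift_mid_scaled_def by (simp add: nz divide_simps) algebra

text \<open>Because \<open>1 - z^2\<close> is \<open>-z^2\<close> times \<open>1 - 1/z^2\<close>,
  three factors suffice as a common denominator of A(z) and A(1/z).\<close>

lemma B_op_coefficients:
  assumes q: "0 < q" and B: "B_defined q z" and z: "z \<noteq> 0" and Q: "Q = complex_of_real q"
    and \<Delta>: "\<Delta> = (1 - Q*z^2)*(1 - 1/z^2)*(1 - Q/z^2)"
  shows "\<Delta> \<noteq> 0"
    "\<Delta> * AW_Az q a b c d z = - ((1 - a*z)*(1 - b*z)*(1 - c*z)*(1 - d*z)*(1 - Q/z^2)/z^2)"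
    "\<Delta> * AW_Az q a b c d (1/z) = (1 - a/z)*(1 - b/z)*(1 - c/z)*(1 - d/z)*(1 - Q*z^2)"
proof -
  have nz: "1 - z^2 \<noteq> 0" "1 - Q*z^2 \<noteq> 0" "1 - 1/z^2 \<noteq> 0" "1 - Q/z^2 \<noteq> 0"
    using B unfolding B_defined_def Q by (auto simp: power_divide)
  show "\<Delta> \<noteq> 0" using nz by (simp add: \<Delta>)
  have "(1 - 1/z^2) = - ((1 - z^2)/z^2)" using z by (simp add: field_simps)
  thus "\<Delta> * AW_Az q a b c d z = - ((1 - a*z)*(1 - b*z)*(1 - c*z)*(1 - d*z)*(1 - Q/z^2)/z^2)"
    unfolding AW_Az_def \<Delta> Q[symmetric] using nz by (simp add: mult_ac)
  define p where "p = (1 - 1/z^2) * (1 - Q/z^2)"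
  have p0: "p \<noteq> 0" using nz by (simp add: p_def)
  have "AW_Az q a b c d (1/z) = (1 - a/z)*(1 - b/z)*(1 - c/z)*(1 - d/z) / p"
    unfolding AW_Az_def p_def Q[symmetric] by (simp add: power_divide)
  moreover have "\<Delta> = p * (1 - Q*z^2)" by (simp add: \<Delta> p_def)
  ultimately show "\<Delta> * AW_Az q a b c d (1/z) = (1 - a/z)*(1 - b/z)*(1 - c/z)*(1 - d/z)*(1 - Q*z^2)"
    using p0 by simp
qed

lemma AW_R_B:
  assumes q: "0 < q" "q < 1" and lg: "log_branch q lg"
    and nz: "a \<noteq> 0" "b \<noteq> 0" "c \<noteq> 0" "d \<noteq> 0" "z \<noteq> 0"
    and B: "B_defined q z" and R: "\<forall>w\<in>{z / q, z, q * z}. R_defined q a b c d \<gamma> w"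
  shows "B_op q a b c d (\<lambda>w. AW_R q lg a b c d \<gamma> w) z = AW_Lambda q a b c d \<gamma> * AW_R q lg a b c d \<gamma> z"
proof -
  define Q where "Q = complex_of_real q"
  define e where "e = qpow q (\<gamma> - 1)"
  note qs = qpow_shift[OF q(1) Q_def e_def]
  have Q0: "Q \<noteq> 0" and e0: "e \<noteq> 0" using q qs(1) by (simp_all add: Q_def)
  define bt where "bt = b*c*d/z"
  \<comment> \<open>The normalisation puts the lowest base at q z, since \<open>r^2\<close> is
    bcd/(q q z). The lowest argument \<open>y\<close> belongs to z/q, and the choice of the branch
    of the root does not affect the even expressions used below.\<close>
  define r where "r = csqrt bt / Q"
  have r2: "r^2 = bt/Q^2" by (simp add: r_def power_divide)
  have bt0: "bt \<noteq> 0" using nz by (simp add: bt_def)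
  have r0: "r \<noteq> 0" using bt0 Q0 by (simp add: r_def)
  define y where "y = z/a"
  define W where "W w = W87 q (b*c*d/(Q*w)) (b/w) (c/w) (d/w) (a*b*c*d*e) (1/(Q*e)) (Q*w/a)" for w
  have Rd: "R_defined q a b c d \<gamma> w" if "w \<in> {z/Q, z, Q*z}" for w by (rule bspec[OF R[folded Q_def] that])
  have Wd: "W87_defined q (b*c*d/(Q*w)) (b/w) (c/w) (d/w) (a*b*c*d*e) (1/(Q*e)) (Q*w/a)"
    if "w \<in> {z/Q, z, Q*z}" for w
    using Rd[OF that] unfolding R_defined_def qs unfolding Q_def by blast
  have wnz: "w \<noteq> 0" if "w \<in> {z/Q, z, Q*z}" for w using that nz Q0 by auto
  have Weq: "(1 - b*c*d/(Q*w)) * W w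
      = qcont q (vwp q (b*c*d/(Q*w)) [b*c*d/(Q*w), b/w, c/w, d/w, a*b*c*d*e, 1/(Q*e)]) (Q*w/a)"
    if "w \<in> {z/Q, z, Q*z}" for w
    unfolding W_def by (rule W87_eq_vwp[OF q Wd[OF that]]) (use wnz[OF that] nz Q0 in simp)
  define A1 A2 A3 where A: "A1 = b/(Q*z*r)" "A2 = c/(Q*z*r)" "A3 = d/(Q*z*r)"
  define F where "F = Q*r/(a*b*c*d*e)"
  define G where "G = Q*r*(Q*e)"
  have rA: "r*A1 = b/(Q*z)" "r*A2 = c/(Q*z)" "r*A3 = d/(Q*z)" using r0 by (simp_all add: A)
  have rFG: "Q*r/F = a*b*c*d*e" "Q*r/G = 1/(Q*e)" using r0 nz Q0 e0 by (simp_all add: F_def G_def)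
  have Wp: "(1 - r^2) * W (Q*z) = qcont q (vwp q (r^2) [r^2, r*A1, r*A2, r*A3, Q*r/F, Q*r/G]) (Q*(Q*y))"
    using Weq[of "Q*z"] unfolding r2 rA rFG by (simp add: bt_def y_def power2_eq_square mult_ac)
  have W0: "(1 - Q*r^2) * W z = qcont q (vwp q (Q*r^2) [Q*r^2, Q*(r*A1), Q*(r*A2), Q*(r*A3), Q*r/F, Q*r/G]) (Q*y)"
    using Weq[of z] Q0 unfolding r2 rA rFG by (simp add: bt_def y_def power2_eq_square mult_ac)
  have Wm: "(1 - Q*(Q*r^2)) * W (z/Q)
      = qcont q (vwp q (Q*(Q*r^2)) [Q*(Q*r^2), Q*(Q*(r*A1)), Q*(Q*(r*A2)), Q*(Q*(r*A3)), Q*r/F, Q*r/G]) y"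
    using Weq[of "z/Q"] Q0 unfolding r2 rA rFG by (simp add: bt_def y_def power2_eq_square mult_ac)
  define k1 k2 k3 where k: "k1 = A1 + A2 + A3" "k2 = A1*A2 + A1*A3 + A2*A3" "k3 = A1*A2*A3"
  define E1 E2 E3 E4 where E: "E1 = r + k1" "E2 = r*k1 + k2" "E3 = r*k2 + k3" "E4 = r*k3"
  have AA: "A1*A2 = 1/(d*z)" "A1*A3 = 1/(c*z)" "A2*A3 = 1/(b*z)"
  proof -
    have "A1*A2 = b*c/(Q^2*z^2*r^2)" "A1*A3 = b*d/(Q^2*z^2*r^2)" "A2*A3 = c*d/(Q^2*z^2*r^2)"
      by (simp_all add: A power2_eq_square mult_ac)
    thus "A1*A2 = 1/(d*z)" "A1*A3 = 1/(c*z)" "A2*A3 = 1/(b*z)"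
      unfolding r2 bt_def using nz Q0 by (simp_all add: power2_eq_square)
  qed
  have E4: "E4 = 1/(Q*z^2)"
  proof -
    have "E4 = (r*A1)*(A2*A3)" by (simp add: E k mult_ac)
    thus ?thesis unfolding rA AA using nz by (simp add: power2_eq_square)
  qed
  have rE: "r*E1 = b*c*d/(Q^2*z) + (b + c + d)/(Q*z)" "r*E3 = (b*c + b*d + c*d)/(Q^2*z^2) + 1/(Q*z^2)"
  proof -
    have "r*E1 = r^2 + (r*A1 + r*A2 + r*A3)" by (simp add: E k power2_eq_square distrib_left)
    thus "r*E1 = b*c*d/(Q^2*z) + (b + c + d)/(Q*z)"
      unfolding r2 rA bt_def by (simp add: add_divide_distrib mult_ac)
    have "r*E3 = r^2*(A1*A2 + A1*A3 + A2*A3) + E4" by (simp add: E k power2_eq_square distrib_left mult_ac)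
    thus "r*E3 = (b*c + b*d + c*d)/(Q^2*z^2) + 1/(Q*z^2)"
      unfolding r2 AA E4 bt_def using nz by (simp add: add_divide_distrib distrib_left power2_eq_square mult_ac)
  qed
  have FG: "F*G = Q/(a*z)" "r*F = 1/(a*z*(Q*e))" "r*G = bt*e"
  proof -
    have "F*G = r^2*Q*Q*Q*e/(a*b*c*d*e)" "r*F = r^2*Q/(a*b*c*d*e)" "r*G = r^2*Q*Q*e"
      by (simp_all add: F_def G_def power2_eq_square mult_ac)
    thus "F*G = Q/(a*z)" "r*F = 1/(a*z*(Q*e))" "r*G = bt*e"
      unfolding r2 bt_def using nz Q0 e0 by (simp_all add: power2_eq_square)
  qed
  have yd: "y \<notin> W87_poles q"
    using W87_defined_nonzero(9)[OF Wd[of "z/Q"]] Q0 by (simp add: y_def)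
  have den: "qpoch q (Q*(r/A1)) k \<noteq> 0" "qpoch q (Q*(r/A2)) k \<noteq> 0" "qpoch q (Q*(r/A3)) k \<noteq> 0"
      "qpoch q (r*F) k \<noteq> 0" "qpoch q (r*G) k \<noteq> 0" for k
  proof -
    note D = W87_defined_nonzero(1-5)[OF Wd[of z], folded Q_def, of k]
    have "r/A1 = r^2*Q*z/b" "r/A2 = r^2*Q*z/c" "r/A3 = r^2*Q*z/d"
      using r0 by (simp_all add: A power2_eq_square mult_ac)
    hence rr: "Q*(r/A1) = c*d" "Q*(r/A2) = b*d" "Q*(r/A3) = b*c"
      unfolding r2 bt_def using nz Q0 by (simp_all add: power2_eq_square)
    show "qpoch q (Q*(r/A1)) k \<noteq> 0" "qpoch q (Q*(r/A2)) k \<noteq> 0" "qpoch q (Q*(r/A3)) k \<noteq> 0"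
      unfolding rr using D(1-3) nz Q0 by (simp_all add: mult_ac)
    have "Q*(b*c*d/(Q*(Q*z)))/(a*b*c*d*e) = r*F" "Q*(b*c*d/(Q*(Q*z)))/(1/(Q*e)) = r*G"
      unfolding FG bt_def using nz Q0 by (simp_all add: mult_ac)
    thus "qpoch q (r*F) k \<noteq> 0" "qpoch q (r*G) k \<noteq> 0"
      using W87_defined_nonzero(4,5)[OF Wd[of "Q*z"], folded Q_def, of k] by simp_all
  qed
  have r1: "1 - r^2 \<noteq> 0"
    using W87_defined_nonzero(7)[OF Wd[of "Q*z"]] unfolding r2 bt_def by (simp add: power2_eq_square mult_ac)
  have nz': "A1 \<noteq> 0" "A2 \<noteq> 0" "A3 \<noteq> 0" "F \<noteq> 0" "G \<noteq> 0"
    using nz Q0 e0 r0 by (simp_all add: A F_def G_def)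
  have yE: "y * (Q^2*E4) = F*G" unfolding E4 FG y_def using nz Q0 by (simp add: power2_eq_square)
  define res where "res = 1 - k2 + k1*k3 - k3^2"
  \<comment> \<open>The products \<open>A_i*A_j\<close> are the reciprocals of dz, cz and bz, so the
    residual factor supplies three numerators of A(z). The numerators \<open>1 - b/z\<close>,
    \<open>1 - c/z\<close>, \<open>1 - d/z\<close> of A(1/z) come from the shift factors in
    \<open>cm\<close>.\<close>
  have res: "res = - ((1 - b*z)*(1 - c*z)*(1 - d*z)/(b*c*d*z^3))"
  proof -
    have "res = (1 - A1*A2)*(1 - A1*A3)*(1 - A2*A3)" unfolding res_def k by algebra
    thus ?thesis unfolding AA
      by (simp add: nz divide_simps power3_eq_cube) algebra
  qed
  define cp where "cp = - (Q^2*(Q^2*E4 - 1)*res) * r^2 * ((1 - r*F)*(1 - Q*(r*F))*(1 - r*G)*(1 - Q*(r*G))) / (1 - r^2)"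
  define c0 where "c0 = four_shift_mid Q E1 E3 E4 F G * r * ((1 - Q*(r*F))*(1 - Q*(r*G)))"
  define cm where "cm = (F*G - Q^2*E4)*(F*G - 1)*(E4 - 1) * ((1 - Q*r^2)*(1 - Q*(r*A1))*(1 - Q*(r*A2))*(1 - Q*(r*A3)))"
  have rel: "cp * ((1 - r^2) * W (Q*z)) + c0 * ((1 - Q*r^2) * W z) + cm * ((1 - Q*(Q*r^2)) * W (z/Q)) = 0"
    unfolding Wp W0 Wm cp_def c0_def cm_def res_def
    by (rule vwp_contiguous_four[where q = q, folded Q_def, OF q yd r0 nz' k E yE den r1])
  define \<Delta> where "\<Delta> = (1 - Q*z^2)*(1 - 1/z^2)*(1 - Q/z^2)"
  note coeffs = B_op_coefficients(1)[OF q(1) B nz(5) Q_def \<Delta>_def]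
    B_op_coefficients(2,3)[OF q(1) B nz(5) Q_def \<Delta>_def, where a = a and b = b and c = c and d = d]
  define Av Av' \<Lambda> where AL: "Av = AW_Az q a b c d z" "Av' = AW_Az q a b c d (1/z)" "\<Lambda> = AW_Lambda q a b c d \<gamma>"
  have \<Lambda>: "\<Lambda> = (1 - Q*e)*(1 - a*b*c*d*e)/(Q*e)"
    unfolding AL AW_Lambda_def qs by simp
  have mid: "a*z^3 * (four_shift_mid Q E1 E3 E4 F G * r) = \<Delta> * (Av + Av' + \<Lambda>)"
    using AW_R_B_identity[OF nz(1,5) e0 Q0, of b c d] coeffs(2,3)
    unfolding mult.commute[of _ r] four_shift_mid_scale rE E4 FG bt_def AL(1,2)[symmetric] \<Lambda>[symmetric] \<Delta>_def[symmetric]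
    by (simp add: distrib_left)
  \<comment> \<open>The factor \<open>1 - a*z\<close> completes the numerator of A(z), which
    \<open>cp\<close> lacks, and is at the same time the shift factor of the prefactor that
    \<open>c0\<close> and \<open>cm\<close> lack. The rest is a monomial.\<close>
  define th where "th = Q*e^2*(1 - a*z)*a^2*z^4"
  have e1: "th * (cp * (1 - r^2)) = (\<Delta> * Av) * ((1 - bt*e)*(1 - bt*(Q*e))*(1 - a*z*e)*(1 - a*z*(Q*e)))"
  proof -
    define w1 w2 w3 w4 p1 where w: "w1 = 1 - a*z*e" "w2 = 1 - a*z*(Q*e)" "w3 = 1 - bt*e" "w4 = 1 - bt*(Q*e)" "p1 = 1 - Q/z^2"
    have f: "1 - r*F = - w2/(a*z*(Q*e))" "1 - Q*(r*F) = - w1/(a*z*e)" "1 - r*G = w3" "1 - Q*(r*G) = w4"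
        "Q^2*E4 - 1 = - p1"
      unfolding FG E4 w using nz Q0 e0 by (simp_all add: field_simps power2_eq_square)
    have c1: "cp * (1 - r^2) = - (Q^2*(Q^2*E4 - 1)*res) * r^2 * ((1 - r*F)*(1 - Q*(r*F))*(1 - r*G)*(1 - Q*(r*G)))"
      using r1 by (simp add: cp_def)
    have r2': "r^2 = b*c*d/(Q^2*z)" unfolding r2 bt_def by simp
    have "th * (cp * (1 - r^2)) = - ((1 - a*z)*(1 - b*z)*(1 - c*z)*(1 - d*z)*p1/z^2) * (w3*w4*w1*w2)"
      unfolding c1 unfolding f res r2' th_def
      using nz Q0 e0 by (simp add: power2_eq_square power3_eq_cube power4_eq_xxxx mult_ac)
    thus ?thesis unfolding AL(1) coeffs(2) w .
  qed
  have e2: "th * (cm * (1 - Q*(Q*r^2))) = (\<Delta> * Av') * ((Q*e)^2*(1 - a*z/Q)*(1 - a*z)*(1 - bt/Q)*(1 - bt))"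
  proof -
    have r: "Q*(Q*r^2) = bt" "Q*r^2 = bt/Q" "Q*(r*A1) = b/z" "Q*(r*A2) = c/z" "Q*(r*A3) = d/z"
      unfolding r2 rA using Q0 by (simp_all add: power2_eq_square)
    have Y: "(F*G - Q^2*E4)*(F*G - 1)*(E4 - 1) = Q/(a*z)*(1 - a/z) * (Q/(a*z)*(1 - a*z/Q)) * ((1 - Q*z^2)/(Q*z^2))"
      unfolding FG E4 using nz Q0 by (simp add: field_simps power2_eq_square)
    define v where "v = 1 - Q*z^2"
    show ?thesis unfolding cm_def Y r AL(2) coeffs(3) th_def v_def[symmetric]
      using nz Q0 e0 by (simp add: power2_eq_square power4_eq_xxxx mult_ac)
  qed
  have e0': "th * (c0 * (1 - Q*r^2)) = - (\<Delta> * (Av + Av' + \<Lambda>)) * (Q*e*(1 - a*z)*(1 - bt*(Q*e))*(1 - bt/Q)*(1 - a*z*e))"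
  proof -
    have r: "Q*r^2 = bt/Q" "1 - Q*(r*F) = - (1 - a*z*e)/(a*z*e)" "Q*(r*G) = bt*(Q*e)"
      unfolding r2 FG using nz Q0 e0 by (simp_all add: field_simps power2_eq_square)
    show ?thesis unfolding c0_def mid[symmetric] r th_def
      by (simp add: nz Q0 e0 divide_simps power2_eq_square power3_eq_cube power4_eq_xxxx) algebra
  qed
  define M where "M = qpochs_inf q [a*b*(Q*e), a*c*(Q*e), a*d*(Q*e)] / qpochs_inf q [b*c*(Q*e), b*d*(Q*e), c*d*(Q*e)]"
  have Rg: "AW_R q lg a b c d \<gamma> w = M * (qpoch_inf q (a*w) * qpoch_inf q (b*c*d*(Q*e)/w)
      / (qpoch_inf q (b*c*d/w) * qpoch_inf q (a*w*(Q*e)))) * bpow lg (a/w) \<gamma> * W w" for w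
    unfolding AW_R_def AW_r_def qs W_def M_def qpochs_inf_Cons qpochs_inf_Nil
    unfolding Q_def[symmetric] by (simp add: divide_inverse mult_ac)
  have sh: "qpoch_inf q y = (1 - y) * qpoch_inf q (Q*y)" for y unfolding Q_def by (rule qpoch_inf_Suc[OF q])
  define Nb Db where NDb: "Nb = qpoch_inf q (Q*(a*z)) * qpoch_inf q (Q*(Q*(bt*e)))" "Db = qpoch_inf q (bt/Q) * qpoch_inf q (a*z*e)"
  have btQ: "Q*(bt/Q) = bt" "Q*(a*z/Q) = a*z" "Q*(a*z*e) = a*z*(Q*e)" using Q0 by simp_all
  have d1: "qpoch_inf q (bt/Q) = (1 - bt/Q) * qpoch_inf q bt" "qpoch_inf q bt = (1 - bt) * qpoch_inf q (Q*bt)"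
    "qpoch_inf q (a*z*e) = (1 - a*z*e) * qpoch_inf q (a*z*(Q*e))"
    "qpoch_inf q (a*z*(Q*e)) = (1 - a*z*(Q*e)) * qpoch_inf q (Q*(a*z*(Q*e)))"
    using sh[of "bt/Q"] sh[of bt] sh[of "a*z*e"] sh[of "a*z*(Q*e)"] unfolding btQ by simp_all
  have n1: "qpoch_inf q (a*z/Q) = (1 - a*z/Q) * ((1 - a*z) * qpoch_inf q (Q*(a*z)))"
    "qpoch_inf q (a*z) = (1 - a*z) * qpoch_inf q (Q*(a*z))"
    "qpoch_inf q (bt*e) = (1 - bt*e) * ((1 - bt*(Q*e)) * qpoch_inf q (Q*(Q*(bt*e))))"
    "qpoch_inf q (Q*(bt*e)) = (1 - bt*(Q*e)) * qpoch_inf q (Q*(Q*(bt*e)))"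
    using sh[of "a*z/Q"] sh[of "a*z"] sh[of "bt*e"] sh[of "Q*(bt*e)"] unfolding btQ by (simp_all add: mult_ac)
  have Db0: "qpoch_inf q (bt/Q) \<noteq> 0" "qpoch_inf q (a*z*e) \<noteq> 0"
  proof -
    have "qpoch_inf q (b*c*d/(Q*z)) \<noteq> 0" using Rd[of "Q*z"] unfolding R_defined_def by simp
    thus "qpoch_inf q (bt/Q) \<noteq> 0" by (simp add: bt_def mult_ac)
    have "qpoch_inf q (a*(z/Q)*(Q*e)) \<noteq> 0" using Rd[of "z/Q"] unfolding R_defined_def qs by simp
    thus "qpoch_inf q (a*z*e) \<noteq> 0" using Q0 by (simp add: mult_ac)
  qed
  have dn: "1 - bt/Q \<noteq> 0" "1 - bt \<noteq> 0" "qpoch_inf q (Q*bt) \<noteq> 0" "1 - a*z*e \<noteq> 0" "1 - a*z*(Q*e) \<noteq> 0"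
      "qpoch_inf q (Q*(a*z*(Q*e))) \<noteq> 0"
    using Db0 unfolding d1 by auto
  define Bp where "Bp = bpow lg (a/(Q*z)) \<gamma>"
  have bp: "bpow lg (a/z) \<gamma> = Q*e*Bp" "bpow lg (a/(z/Q)) \<gamma> = (Q*e)^2*Bp"
  proof -
    have "bpow lg (Q*(a/(Q*z))) \<gamma> = Q*e*Bp"
      unfolding Bp_def qs(2)[symmetric] unfolding Q_def by (rule bpow_q_mult[OF q(1) lg]) (use nz q in simp)
    thus 1: "bpow lg (a/z) \<gamma> = Q*e*Bp" using Q0 by simp
    have "bpow lg (Q*(a/z)) \<gamma> = Q*e*bpow lg (a/z) \<gamma>"
      unfolding qs(2)[symmetric] unfolding Q_def by (rule bpow_q_mult[OF q(1) lg]) (use nz in simp)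
    thus "bpow lg (a/(z/Q)) \<gamma> = (Q*e)^2*Bp" unfolding 1 by (simp add: power2_eq_square mult_ac)
  qed
  define K where "K = M * (Nb / Db) * Bp"
  have Rp: "AW_R q lg a b c d \<gamma> (Q*z) = K * ((1 - bt*e)*(1 - bt*(Q*e))*(1 - a*z*e)*(1 - a*z*(Q*e))) * W (Q*z)"
  proof -
    have t: "a*(Q*z) = Q*(a*z)" "b*c*d*(Q*e)/(Q*z) = bt*e" "b*c*d/(Q*z) = bt/Q" "Q*(a*z)*(Q*e) = Q*(a*z*(Q*e))"
      using Q0 by (simp_all add: bt_def mult_ac)
    show ?thesis unfolding Rg t Bp_def[symmetric] K_def NDb n1 d1(3,4) using dn Q0 by (simp add: mult_ac)
  qed
  have R0: "AW_R q lg a b c d \<gamma> z = K * (Q*e*(1 - a*z)*(1 - bt*(Q*e))*(1 - bt/Q)*(1 - a*z*e)) * W z"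
  proof -
    have t: "b*c*d*(Q*e)/z = Q*(bt*e)" "b*c*d/z = bt" by (simp_all add: bt_def mult_ac)
    show ?thesis unfolding Rg t bp K_def NDb n1 d1(1,3) using dn Q0 by (simp add: mult_ac)
  qed
  have Rm: "AW_R q lg a b c d \<gamma> (z/Q) = K * ((Q*e)^2*(1 - a*z/Q)*(1 - a*z)*(1 - bt/Q)*(1 - bt)) * W (z/Q)"
  proof -
    have t: "a*(z/Q) = a*z/Q" "b*c*d*(Q*e)/(z/Q) = Q*(Q*(bt*e))" "b*c*d/(z/Q) = Q*bt" "a*z/Q*(Q*e) = a*z*e"
      using Q0 by (simp_all add: bt_def mult_ac)
    show ?thesis unfolding Rg t bp K_def NDb n1 d1(1,2) using dn Q0 by (simp add: mult_ac)
  qed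
  have "\<Delta> * (B_op q a b c d (\<lambda>w. AW_R q lg a b c d \<gamma> w) z - AW_Lambda q a b c d \<gamma> * AW_R q lg a b c d \<gamma> z)
     = K * (((\<Delta> * Av) * ((1 - bt*e)*(1 - bt*(Q*e))*(1 - a*z*e)*(1 - a*z*(Q*e)))) * W (Q*z)
       + (- (\<Delta> * (Av + Av' + \<Lambda>)) * (Q*e*(1 - a*z)*(1 - bt*(Q*e))*(1 - bt/Q)*(1 - a*z*e))) * W z
       + ((\<Delta> * Av') * ((Q*e)^2*(1 - a*z/Q)*(1 - a*z)*(1 - bt/Q)*(1 - bt))) * W (z/Q))"
    unfolding B_op_def Q_def[symmetric] AL[symmetric] Rp R0 Rm by algebra
  also have "\<dots> = K * th * (cp * ((1 - r^2) * W (Q*z)) + c0 * ((1 - Q*r^2) * W z) + cm * ((1 - Q*(Q*r^2)) * W (z/Q)))"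
    unfolding e1[symmetric] e2[symmetric] e0'[symmetric] by algebra
  finally show ?thesis unfolding rel using coeffs(1) by simp
qed

text \<open>Explains the exponent of z in \<open>AW_S\<close>: replacing z by q z multiplies that
  power by abcd/q.\<close>

lemma qpow_log_branch:
  assumes "0 < q" "q < 1" "log_branch q lg" "x \<noteq> 0"
  shows "qpow q (- 1 + lg x / ln q) = x / of_real q"
proof -
  have "ln q \<noteq> 0" using assms(1,2) by simp
  hence "(- 1 + lg x / complex_of_real (ln q)) * complex_of_real (ln q) = lg x - complex_of_real (ln q)"
    by (simp add: left_diff_distrib)
  hence "qpow q (- 1 + lg x / ln q) = exp (lg x - complex_of_real (ln q))"
    using assms(1) by (simp add: powr_def Ln_of_real)
  also have "\<dots> = x / of_real q"
    using assms by (simp add: exp_diff log_branch_def exp_of_real)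
  finally show ?thesis .
qed

lemma AW_S_B:
  assumes q: "0 < q" "q < 1" and lg: "log_branch q lg"
    and nz: "a \<noteq> 0" "b \<noteq> 0" "c \<noteq> 0" "d \<noteq> 0" "z \<noteq> 0"
    and B: "B_defined q z" and S: "\<forall>w\<in>{z / q, z, q * z}. S_defined q a b c d \<gamma> w"
  shows "B_op q a b c d (\<lambda>w. AW_S q lg a b c d \<gamma> w) z = AW_Lambda q a b c d \<gamma> * AW_S q lg a b c d \<gamma> z"
proof -
  define Q where "Q = complex_of_real q"
  define e where "e = qpow q (\<gamma> - 1)"
  note qs0 = qpow_shift[OF q(1) Q_def e_def]
  have "qpow q (2*\<gamma> + 1) = Q * (Q^2 * e^2)"
    unfolding qpow_add1[OF q(1)] qs0 unfolding Q_def by (rule refl)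
  note qs = qs0 this
  have Q0: "Q \<noteq> 0" and e0: "e \<noteq> 0" using q qs(1) by (simp_all add: Q_def)
  \<comment> \<open>Now the lowest base, the lowest argument and the lowest moving parameter all
    belong to z/q: \<open>r^2\<close> is the base there, \<open>y\<close> the argument, and
    \<open>r/G = z/a\<close> the parameter. \<open>F = 1/r\<close> makes the base parameter the
    other member of the pair.\<close>
  define r where "r = csqrt (b*c*d*z*Q) * e"
  have r2: "r^2 = b*c*d*z*Q*e^2" by (simp add: r_def power_mult_distrib)
  have r0: "r \<noteq> 0" using nz Q0 e0 by (simp add: r_def)
  define y where "y = a*z/Q"
  define W where "W w = W87 q (b*c*d*w*(Q^2*e^2)) (b*c*(Q*e)) (b*d*(Q*e)) (c*d*(Q*e)) (Q*(Q*e)) (w*Q/a) (a*w)" for w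
  have Sd: "S_defined q a b c d \<gamma> w" if "w \<in> {z/Q, z, Q*z}" for w by (rule bspec[OF S[folded Q_def] that])
  have Wd: "W87_defined q (b*c*d*w*(Q^2*e^2)) (b*c*(Q*e)) (b*d*(Q*e)) (c*d*(Q*e)) (Q*(Q*e)) (w*Q/a) (a*w)"
    if "w \<in> {z/Q, z, Q*z}" for w
    using Sd[OF that] unfolding S_defined_def qs unfolding Q_def by blast
  have wnz: "w \<noteq> 0" if "w \<in> {z/Q, z, Q*z}" for w using that nz Q0 by auto
  have Weq: "(1 - b*c*d*w*(Q^2*e^2)) * W w
      = qcont q (vwp q (b*c*d*w*(Q^2*e^2)) [b*c*d*w*(Q^2*e^2), b*c*(Q*e), b*d*(Q*e), c*d*(Q*e), Q*(Q*e), w*Q/a]) (a*w)"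
    if "w \<in> {z/Q, z, Q*z}" for w
    unfolding W_def by (rule W87_eq_vwp[OF q Wd[OF that]]) (use wnz[OF that] nz Q0 e0 in simp)
  define A1 A2 A3 A4 where A: "A1 = b*c*e/r" "A2 = b*d*e/r" "A3 = c*d*e/r" "A4 = Q*e/r"
  define F where "F = 1/r"
  define G where "G = r*a/z"
  have rA: "r*A1 = b*c*e" "r*A2 = b*d*e" "r*A3 = c*d*e" "r*A4 = Q*e" using r0 by (simp_all add: A)
  have rG: "r/G = z/a" using r0 nz by (simp add: G_def)
  have Wp: "(1 - Q*(Q*r^2)) * W (Q*z)
      = qcont q (vwp q (Q*(Q*r^2)) [Q*(Q*r^2), Q*(r*A1), Q*(r*A2), Q*(r*A3), Q*(r*A4), Q*(Q*(r/G))]) (Q*(Q*y))"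
    using Weq[of "Q*z"] Q0 unfolding r2 rA rG by (simp add: y_def power2_eq_square mult_ac)
  have W0: "(1 - Q*r^2) * W z
      = qcont q (vwp q (Q*r^2) [Q*r^2, Q*(r*A1), Q*(r*A2), Q*(r*A3), Q*(r*A4), Q*(r/G)]) (Q*y)"
    using Weq[of z] Q0 unfolding r2 rA rG by (simp add: y_def power2_eq_square mult_ac)
  have Wm: "(1 - r^2) * W (z/Q)
      = qcont q (vwp q (r^2) [r^2, Q*(r*A1), Q*(r*A2), Q*(r*A3), Q*(r*A4), r/G]) y"
    using Weq[of "z/Q"] Q0 unfolding r2 rA rG by (simp add: y_def power2_eq_square mult_ac)
  define E1 E2 E3 E4 where E: "E1 = A1 + A2 + A3 + A4" "E2 = A1*A2 + A1*A3 + A1*A4 + A2*A3 + A2*A4 + A3*A4"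
      "E3 = A1*A2*A3 + A1*A2*A4 + A1*A3*A4 + A2*A3*A4" "E4 = A1*A2*A3*A4"
  have AA: "A1*A2 = b/(Q*z)" "A1*A3 = c/(Q*z)" "A2*A3 = d/(Q*z)" "A1*A4 = 1/(d*z)" "A2*A4 = 1/(c*z)" "A3*A4 = 1/(b*z)"
  proof -
    have "A1*A2 = b*c*(b*d)*e^2/r^2" "A1*A3 = b*c*(c*d)*e^2/r^2" "A2*A3 = b*d*(c*d)*e^2/r^2"
      "A1*A4 = b*c*Q*e^2/r^2" "A2*A4 = b*d*Q*e^2/r^2" "A3*A4 = c*d*Q*e^2/r^2"
      by (simp_all add: A power2_eq_square mult_ac)
    thus "A1*A2 = b/(Q*z)" "A1*A3 = c/(Q*z)" "A2*A3 = d/(Q*z)" "A1*A4 = 1/(d*z)" "A2*A4 = 1/(c*z)" "A3*A4 = 1/(b*z)"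
      unfolding r2 using nz Q0 e0 by (simp_all add: power2_eq_square)
  qed
  have E4: "E4 = 1/(Q*z^2)"
  proof -
    have "E4 = (A1*A2)*(A3*A4)" by (simp add: E)
    thus ?thesis unfolding AA using nz by (simp add: power2_eq_square)
  qed
  have rE: "r*E1 = (b*c + b*d + c*d)*e + Q*e" "r*E3 = b*c*d*e/(Q*z) + (b + c + d)*e/z"
  proof -
    have "r*E1 = r*A1 + r*A2 + r*A3 + r*A4" by (simp add: E distrib_left)
    thus "r*E1 = (b*c + b*d + c*d)*e + Q*e" unfolding rA by (simp add: distrib_right)
    have "r*E3 = (r*A1)*(A2*A3) + (r*A4)*(A1*A2 + A1*A3 + A2*A3)" unfolding E by algebra
    thus "r*E3 = b*c*d*e/(Q*z) + (b + c + d)*e/z"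
      unfolding rA AA using Q0 by (simp add: add_divide_distrib distrib_left distrib_right mult_ac)
  qed
  have FG: "F*G = a/z" "r*F = 1" "r*G = a*b*c*d*Q*e^2"
  proof -
    have "r*G = r^2*a/z" by (simp add: G_def power2_eq_square)
    thus "r*G = a*b*c*d*Q*e^2" unfolding r2 using nz by simp
    show "F*G = a/z" "r*F = 1" using r0 by (simp_all add: F_def G_def)
  qed
  have yd: "y \<notin> W87_poles q"
    using W87_defined_nonzero(9)[OF Wd[of "z/Q"]] by (simp add: y_def)
  have rr: "r/A1 = d*z*(Q*e)" "r/A2 = c*z*(Q*e)" "r/A3 = b*z*(Q*e)" "r/A4 = b*c*d*z*e"
  proof -
    have "r/A1 = r^2/(b*c*e)" "r/A2 = r^2/(b*d*e)" "r/A3 = r^2/(c*d*e)" "r/A4 = r^2/(Q*e)"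
      by (simp_all add: A power2_eq_square)
    thus "r/A1 = d*z*(Q*e)" "r/A2 = c*z*(Q*e)" "r/A3 = b*z*(Q*e)" "r/A4 = b*c*d*z*e"
      unfolding r2 using nz Q0 e0 by (simp_all add: power2_eq_square)
  qed
  have den: "qpoch q (r/A1) k \<noteq> 0" "qpoch q (r/A2) k \<noteq> 0" "qpoch q (r/A3) k \<noteq> 0"
      "qpoch q (r/A4) k \<noteq> 0" "qpoch q (Q*(r*G)) k \<noteq> 0" for k
  proof -
    note D = W87_defined_nonzero(1-5)[OF Wd[of "z/Q"], folded Q_def, of k]
    have "Q*(b*c*d*(z/Q)*(Q^2*e^2))/(b*c*(Q*e)) = r/A1" "Q*(b*c*d*(z/Q)*(Q^2*e^2))/(b*d*(Q*e)) = r/A2"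
      "Q*(b*c*d*(z/Q)*(Q^2*e^2))/(c*d*(Q*e)) = r/A3" "Q*(b*c*d*(z/Q)*(Q^2*e^2))/(Q*(Q*e)) = r/A4"
      "Q*(b*c*d*(z/Q)*(Q^2*e^2))/(z/Q*Q/a) = Q*(r*G)"
      unfolding rr FG using nz Q0 e0 by (simp_all add: power2_eq_square)
    thus "qpoch q (r/A1) k \<noteq> 0" "qpoch q (r/A2) k \<noteq> 0" "qpoch q (r/A3) k \<noteq> 0"
      "qpoch q (r/A4) k \<noteq> 0" "qpoch q (Q*(r*G)) k \<noteq> 0" using D by simp_all
  qed
  have r1: "1 - r^2 \<noteq> 0"
    using W87_defined_nonzero(7)[OF Wd[of "z/Q"]] Q0 unfolding r2 by (simp add: power2_eq_square mult_ac)
  have nz': "A1 \<noteq> 0" "A2 \<noteq> 0" "A3 \<noteq> 0" "A4 \<noteq> 0" "G \<noteq> 0"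
    using nz Q0 e0 r0 by (simp_all add: A G_def)
  have yE: "y * (Q^2*E4) = F*G" unfolding E4 FG y_def using nz Q0 by (simp add: power2_eq_square)
  define res where "res = four_shift_res E1 E2 E3 E4"
  \<comment> \<open>Of the six factors, those with b/(qz), c/(qz), d/(qz) are up to a monomial the
    shift factors \<open>zP'\<close> of the prefactor denominators; the other three give numerators
    of A(z).\<close>
  have res: "res = (1 - b/(Q*z))*(1 - c/(Q*z))*(1 - d/(Q*z))*((1 - 1/(d*z))*(1 - 1/(c*z))*(1 - 1/(b*z)))"
  proof -
    have "res = (1 - A1*A2)*(1 - A1*A3)*(1 - A2*A3)*((1 - A1*A4)*(1 - A2*A4)*(1 - A3*A4))"
      unfolding res_def four_shift_res_def E by algebra
    thus ?thesis unfolding AA .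
  qed
  define p0 p1 where p: "p0 = (1 - r/A1)*(1 - r/A2)*(1 - r/A3)*(1 - r/A4)"
    "p1 = (1 - Q*(r/A1))*(1 - Q*(r/A2))*(1 - Q*(r/A3))*(1 - Q*(r/A4))"
  define cp where "cp = - (Q^2*(Q^2*E4 - 1)*res) * G^2 * ((1 - Q*r^2)*(1 - r/G)*(1 - Q*(r/G)))"
  define c0 where "c0 = four_shift_mid Q E1 E3 E4 F G * E4 * G * (p1*(1 - r/G))"
  define cm where "cm = Q^2*((F*G - Q^2*E4)*(F*G - 1)*(E4 - 1)) * E4^2 * (p0*p1)"
  \<comment> \<open>The contiguous relation contains \<open>1 - r^2\<close> in its first two
    coefficients and, by \<open>W87_eq_vwp\<close>, in the third series. It is nonzero and is
    cancelled here.\<close>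
  have "(1 - r^2) * (cp * ((1 - Q*(Q*r^2)) * W (Q*z)) + c0 * ((1 - Q*r^2) * W z) + cm * W (z/Q))
    = - (Q^2*(Q^2*E4 - 1)*res) * G^2 * ((1 - r^2)*(1 - Q*r^2)*(1 - r/G)*(1 - Q*(r/G))) * ((1 - Q*(Q*r^2)) * W (Q*z))
    + four_shift_mid Q E1 E3 E4 F G * E4 * G * ((1 - Q*(r/A1))*(1 - Q*(r/A2))*(1 - Q*(r/A3))*(1 - Q*(r/A4))*(1 - r^2)*(1 - r/G))
        * ((1 - Q*r^2) * W z)
    + Q^2*((F*G - Q^2*E4)*(F*G - 1)*(E4 - 1)) * E4^2 * (((1 - r/A1)*(1 - r/A2)*(1 - r/A3)*(1 - r/A4))
        * ((1 - Q*(r/A1))*(1 - Q*(r/A2))*(1 - Q*(r/A3))*(1 - Q*(r/A4)))) * ((1 - r^2) * W (z/Q))"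
    unfolding cp_def c0_def cm_def p by (simp only: distrib_left mult_ac)
  also have "\<dots> = 0"
    unfolding Wp W0 Wm res_def
    by (rule vwp_contiguous_four_reflected[where q = q, folded Q_def, OF q yd nz' FG(2) E yE den])
  finally have rel: "cp * ((1 - Q*(Q*r^2)) * W (Q*z)) + c0 * ((1 - Q*r^2) * W z) + cm * W (z/Q) = 0"
    using r1 by simp
  define \<Delta> where "\<Delta> = (1 - Q*z^2)*(1 - 1/z^2)*(1 - Q/z^2)"
  note coeffs = B_op_coefficients(1)[OF q(1) B nz(5) Q_def \<Delta>_def]
    B_op_coefficients(2,3)[OF q(1) B nz(5) Q_def \<Delta>_def, where a = a and b = b and c = c and d = d]
  define Av Av' \<Lambda> where AL: "Av = AW_Az q a b c d z" "Av' = AW_Az q a b c d (1/z)" "\<Lambda> = AW_Lambda q a b c d \<gamma>"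
  have \<Lambda>: "\<Lambda> = (1 - Q*e)*(1 - a*b*c*d*e)/(Q*e)"
    unfolding AL AW_Lambda_def qs by simp
  have mid: "z^2 * (four_shift_mid Q E1 E3 E4 F G * r) = Q*e * (\<Delta> * (Av + Av' + \<Lambda>))"
    using AW_S_B_identity[OF nz(5) e0 Q0, of b c d a] coeffs(2,3)
    unfolding mult.commute[of _ r] four_shift_mid_scale rE E4 FG AL(1,2)[symmetric] \<Lambda>[symmetric] \<Delta>_def[symmetric]
    by (simp add: distrib_left)
  define zP zP' where zP: "zP = (1 - z/b)*(1 - z/c)*(1 - z/d)" "zP' = (1 - z*Q/b)*(1 - z*Q/c)*(1 - z*Q/d)"
  have iP: "(1 - b/z)*(1 - c/z)*(1 - d/z) = - (b*c*d*zP/z^3)"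
  proof -
    have "1 - x/z = - (x*(1 - z/x)/z)" if "x \<noteq> 0" for x using that nz by (simp add: field_simps)
    thus ?thesis using nz by (simp add: zP power3_eq_cube mult_ac)
  qed
  have iP': "(1 - b/(Q*z))*(1 - c/(Q*z))*(1 - d/(Q*z)) = - (b*c*d*zP'/(Q^3*z^3))"
  proof -
    have "1 - x/(Q*z) = - (x*(1 - z*Q/x)/(Q*z))" if "x \<noteq> 0" for x using that nz Q0 by (simp add: field_simps)
    thus ?thesis using nz by (simp add: zP power3_eq_cube mult_ac)
  qed
  define bP where "bP = (1 - b*z)*(1 - c*z)*(1 - d*z)"
  have jP: "(1 - 1/(d*z))*(1 - 1/(c*z))*(1 - 1/(b*z)) = - (bP/(b*c*d*z^3))"
  proof -
    have "1 - 1/(x*z) = - ((1 - x*z)/(x*z))" if "x \<noteq> 0" for x using that nz by (simp add: field_simps)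
    thus ?thesis using nz by (simp add: bP_def power3_eq_cube mult_ac)
  qed
  define t where "t = a*b*c*d*e"
  define d0 d1 where dd: "d0 = (1 - z/a)*zP*(1 - Q*r^2)" "d1 = (1 - z*Q/a)*zP'*(1 - Q*(Q*r^2))"
  define n0 n1 where nn: "n0 = (1 - a*z/Q)*p0" "n1 = (1 - a*z)*p1"
  \<comment> \<open>The product of \<open>1 - b/z\<close>, \<open>1 - c/z\<close>,
    \<open>1 - d/z\<close> is the part of A(1/z) missing from \<open>cm\<close>; by
    \<open>iP\<close> it is also, up to a monomial, the shift factor \<open>zP\<close> missing from
    \<open>cp\<close> and \<open>c0\<close>. Likewise \<open>1 - a*z\<close> completes both A(z) and
    \<open>n1\<close>. The power of z clears denominators.\<close>
  define th where "th = (1 - a*z)*((1 - b/z)*(1 - c/z)*(1 - d/z))*z^8"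
  have p8: "z^8 = z*z*z*z*z*z*z*z" by (simp add: eval_nat_numeral)
  have e1: "th * (cp * (1 - Q*(Q*r^2))) = (\<Delta> * Av) * (t^2*(d0*d1))"
  proof -
    define m1 where "m1 = 1 - Q/z^2"
    define u1 u2 where u: "u1 = 1 - z/a" "u2 = 1 - z*Q/a"
    have f: "Q^2*E4 - 1 = - m1" "1 - Q*(r/G) = u2" "1 - r/G = u1"
      unfolding E4 rG m1_def u using nz Q0 by (simp_all add: field_simps power2_eq_square)
    define y1 y2 where y12: "y1 = 1 - Q*r^2" "y2 = 1 - Q*(Q*r^2)"
    have G2: "G^2 = b*c*d*Q*e^2*a^2/z"
    proof -
      have "G^2 = r^2*a^2/z^2" by (simp add: G_def power_divide power_mult_distrib)
      thus ?thesis unfolding r2 using nz by (simp add: power2_eq_square)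
    qed
    have AW: "\<Delta> * Av = - ((1 - a*z)*bP*m1/z^2)" unfolding AL(1) coeffs(2) by (simp add: bP_def m1_def)
    show ?thesis
      unfolding AW cp_def th_def dd t_def y12[symmetric] G2 f(1) res iP iP' jP
      unfolding f(2,3) u[symmetric]
      using nz Q0 e0 by (simp add: p8 power2_eq_square power3_eq_cube mult_ac)
  qed
  have e2: "th * cm = (\<Delta> * Av') * (n0*n1)"
  proof -
    have Y: "(F*G - Q^2*E4)*(F*G - 1)*(E4 - 1) = (1 - a*z/Q)*(1 - a/z)*(1 - Q*z^2)/z^4"
      unfolding FG E4 using nz Q0 by (simp add: field_simps power2_eq_square power4_eq_xxxx)
    define m where "m = 1 - Q*z^2"
    have AW: "\<Delta> * Av' = (1 - a/z)*((1 - b/z)*(1 - c/z)*(1 - d/z))*m" unfolding AL(2) coeffs(3) by (simp add: m_def)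
    show ?thesis unfolding AW cm_def Y unfolding th_def nn E4 iP m_def[symmetric]
      using nz Q0 e0 by (simp add: p8 power2_eq_square power4_eq_xxxx mult_ac)
  qed
  have e0': "th * (c0 * (1 - Q*r^2)) = - (\<Delta> * (Av + Av' + \<Lambda>)) * (t*(n1*d0))"
  proof -
    define y1 where "y1 = 1 - Q*r^2"
    define u1 where "u1 = 1 - z/a"
    define MM where "MM = four_shift_mid Q E1 E3 E4 F G * r"
    have "\<Delta> * (Av + Av' + \<Lambda>) = z^2*MM/(Q*e)" using mid Q0 e0 by (simp add: MM_def)
    moreover have "c0 = MM * (E4*a/z) * (p1*(1 - r/G))" by (simp add: c0_def MM_def G_def mult_ac)
    ultimately show ?thesis
      unfolding th_def nn dd t_def y1_def[symmetric] iP E4 rG u1_def[symmetric]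
      using nz Q0 e0 by (simp add: p8 power2_eq_square power3_eq_cube mult_ac)
  qed
  define M where "M = qpoch_inf q (a*b*c*d*(Q^2*e^2))
     / (qpoch_inf q (b*c*(Q*e)) * qpoch_inf q (b*d*(Q*e)) * qpoch_inf q (c*d*(Q*e)) * qpoch_inf q (Q*(Q*e)))"
  define N where "N w = qpoch_inf q (a*w) * qpoch_inf q (b*w*(Q*(Q*e))) * qpoch_inf q (c*w*(Q*(Q*e)))
     * qpoch_inf q (d*w*(Q*(Q*e))) * qpoch_inf q (b*c*d*w*(Q*e))" for w
  define D where "D w = qpoch_inf q (w*Q/a) * qpoch_inf q (w*Q/b) * qpoch_inf q (w*Q/c) * qpoch_inf q (w*Q/d)
     * qpoch_inf q (b*c*d*w*(Q*(Q^2*e^2)))" for w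
  define s0 where "s0 = - 1 + lg (a*b*c*d) / ln q"
  define bb where "bb w = bpow lg w s0 * bpow lg (a*w) \<gamma>" for w
  have Sg: "AW_S q lg a b c d \<gamma> w = M * (N w / D w) * bb w * W w" for w
    unfolding AW_S_def AW_s_def qs W_def M_def N_def D_def bb_def s0_def[symmetric] qpochs_inf_Cons qpochs_inf_Nil
    unfolding Q_def[symmetric] by (simp add: divide_inverse mult_ac)
  have sh: "qpoch_inf q y = (1 - y) * qpoch_inf q (Q*y)" for y unfolding Q_def by (rule qpoch_inf_Suc[OF q])
  have Nsh: "N w = (1 - a*w)*(1 - b*w*(Q*(Q*e)))*(1 - c*w*(Q*(Q*e)))*(1 - d*w*(Q*(Q*e)))*(1 - b*c*d*w*(Q*e)) * N (Q*w)" for w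
    unfolding N_def
    using sh[of "a*w"] sh[of "b*w*(Q*(Q*e))"] sh[of "c*w*(Q*(Q*e))"] sh[of "d*w*(Q*(Q*e))"] sh[of "b*c*d*w*(Q*e)"]
    by (simp add: mult_ac)
  have Dsh: "D w = (1 - w*Q/a)*(1 - w*Q/b)*(1 - w*Q/c)*(1 - w*Q/d)*(1 - b*c*d*w*(Q*(Q^2*e^2))) * D (Q*w)" for w
    unfolding D_def
    using sh[of "w*Q/a"] sh[of "w*Q/b"] sh[of "w*Q/c"] sh[of "w*Q/d"] sh[of "b*c*d*w*(Q*(Q^2*e^2))"]
    by (simp add: mult_ac)
  have Qz: "Q*(z/Q) = z" using Q0 by simp
  have N1: "N (z/Q) = n0 * N z" "N z = n1 * N (Q*z)"
    using Nsh[of "z/Q"] Nsh[of z] Q0 unfolding Qz nn p rr by (simp_all add: mult_ac)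
  have D1: "D (z/Q) = d0 * D z" "D z = d1 * D (Q*z)"
    using Dsh[of "z/Q"] Dsh[of z] Q0 unfolding Qz dd zP r2 by (simp_all add: power2_eq_square mult_ac)
  have D0: "D (z/Q) \<noteq> 0"
    using Sd[of "z/Q"] unfolding S_defined_def qs unfolding D_def Q_def[symmetric] by simp
  have dn: "d0 \<noteq> 0" "d1 \<noteq> 0" "D (Q*z) \<noteq> 0" using D0 unfolding D1 by auto
  \<comment> \<open>The power of z contributes abcd/q and the power of az contributes q^\<gamma>;
    their product \<open>t\<close> is the factor per step that \<open>e1\<close> and
    \<open>e0'\<close> require.\<close>
  have bS: "bb (Q*w) = t * bb w" if "w \<noteq> 0" for w
  proof -
    have "bpow lg (Q*w) s0 = qpow q s0 * bpow lg w s0" unfolding Q_def by (rule bpow_q_mult[OF q(1) lg that])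
    moreover have "qpow q s0 = a*b*c*d/Q" unfolding s0_def Q_def by (rule qpow_log_branch[OF q lg]) (use nz in simp)
    moreover have "bpow lg (Q*(a*w)) \<gamma> = Q*e * bpow lg (a*w) \<gamma>"
      unfolding qs(2)[symmetric] unfolding Q_def by (rule bpow_q_mult[OF q(1) lg]) (use nz that in simp)
    ultimately show ?thesis using Q0 by (simp add: bb_def t_def mult_ac)
  qed
  have b1: "bb z = t * bb (z/Q)" "bb (Q*z) = t * (t * bb (z/Q))"
    using bS[of "z/Q"] bS[of z] nz Q0 by simp_all
  define K where "K = M * (N (Q*z) / D (z/Q)) * bb (z/Q)"
  have Sp: "AW_S q lg a b c d \<gamma> (Q*z) = K * (t^2*(d0*d1)) * W (Q*z)"
    unfolding Sg K_def b1 D1 using dn by (simp add: power2_eq_square mult_ac)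
  have S0: "AW_S q lg a b c d \<gamma> z = K * (t*(n1*d0)) * W z"
    unfolding Sg K_def b1 D1 N1 using dn Q0 by (simp add: mult_ac)
  have Sm: "AW_S q lg a b c d \<gamma> (z/Q) = K * (n0*n1) * W (z/Q)"
    unfolding Sg K_def N1 by (simp add: mult_ac)
  have "\<Delta> * (B_op q a b c d (\<lambda>w. AW_S q lg a b c d \<gamma> w) z - AW_Lambda q a b c d \<gamma> * AW_S q lg a b c d \<gamma> z)
     = K * (((\<Delta> * Av) * (t^2*(d0*d1))) * W (Q*z) + (- (\<Delta> * (Av + Av' + \<Lambda>)) * (t*(n1*d0))) * W z
       + ((\<Delta> * Av') * (n0*n1)) * W (z/Q))"
    unfolding B_op_def Q_def[symmetric] AL[symmetric] Sp S0 Sm by algebra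
  also have "\<dots> = K * th * (cp * ((1 - Q*(Q*r^2)) * W (Q*z)) + c0 * ((1 - Q*r^2) * W z) + cm * W (z/Q))"
    unfolding e1[symmetric] e2[symmetric] e0'[symmetric] by algebra
  finally show ?thesis unfolding rel using coeffs(1) by simp
qed

theorem theorem2p1:
  fixes q :: real and lg :: "complex \<Rightarrow> complex" and a b c d \<gamma> z :: complex
  assumes "0 < q" and "q < 1" and "log_branch q lg"
    and "a \<noteq> 0" and "b \<noteq> 0" and "c \<noteq> 0" and "d \<noteq> 0" and "z \<noteq> 0"
  shows
    "(L_defined q a b c d \<gamma> \<and> (\<forall>g\<in>{\<gamma> - 1, \<gamma>, \<gamma> + 1}. R_defined q a b c d g z) \<longrightarrow>
        L_op q a b c d (\<lambda>g. AW_R q lg a b c d g z) \<gamma> = (z + 1 / z) * AW_R q lg a b c d \<gamma> z) \<and>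
     (B_defined q z \<and> (\<forall>w\<in>{z / q, z, q * z}. R_defined q a b c d \<gamma> w) \<longrightarrow>
        B_op q a b c d (\<lambda>w. AW_R q lg a b c d \<gamma> w) z = AW_Lambda q a b c d \<gamma> * AW_R q lg a b c d \<gamma> z) \<and>
     (L_defined q a b c d \<gamma> \<and> (\<forall>g\<in>{\<gamma> - 1, \<gamma>, \<gamma> + 1}. S_defined q a b c d g z) \<longrightarrow>
        L_op q a b c d (\<lambda>g. AW_S q lg a b c d g z) \<gamma> = (z + 1 / z) * AW_S q lg a b c d \<gamma> z) \<and>
     (B_defined q z \<and> (\<forall>w\<in>{z / q, z, q * z}. S_defined q a b c d \<gamma> w) \<longrightarrow>
        B_op q a b c d (\<lambda>w. AW_S q lg a b c d \<gamma> w) z = AW_Lambda q a b c d \<gamma> * AW_S q lg a b c d \<gamma> z)"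
  using AW_R_L[OF assms(1-8)] AW_R_B[OF assms(1-8)] AW_S_L[OF assms(1-8)] AW_S_B[OF assms(1-8)] by blast

end
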